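(* The random variable $\mathbf{X}(0)$ is Cauchy distributed, namely it has probability density with respect to Lebesgue measure given by $$\frac{1}{\pi(1+x^2)},\qquad x\in\mathbb{R}.$$ Moreover, if $h\in\mathbb{C}$ with $\Re(h)\in\left(-\frac12,\frac12\right)$, then for all integers $N\ge1$: $$\frac{\mathcal{R}_N(0,h)}{N^{2h}}=\mathcal{R}(0,h)=2^{-2h}\frac{1}{\cos(\pi h)}.$$
   Context: Definition of $\mathbf{X}(s)$ (used here with $s=0$). For $s\in\mathbb{R}$, $s>-\frac12$, let $\mathbf{C}^{(s)}$ be the determinantal point process on $\mathbb{R}^*=(-\infty,0)\cup(0,\infty)$ (with respect to Lebesgue measure) with correlation kernel $$K^{(s)}(x,y)=\frac{1}{2\pi}\frac{\Gamma(s+1)^2}{\Gamma(2s+1)\Gamma(2s+2)}\,\frac{T^{(s)}(x)R^{(s)}(y)-T^{(s)}(y)R^{(s)}(x)}{x-y}$$ (extended to $x=y$ by continuity), where $$T^{(s)}(x)=2^{2s-\frac12}\,\Gamma\left(s+\tfrac12\right)|x|^{-1/2}J_{s-1/2}\left(\tfrac{1}{|x|}\right),\qquad R^{(s)}(x)=\operatorname{sgn}(x)\,2^{2s+\frac32}\,\Gamma\left(s+\tfrac32\right)|x|^{-1/2}J_{s+1/2}\left(\tfrac{1}{|x|}\right),$$ and $J_\nu$ is the Bessel function of the first kind. A determinantal point process on $E\subseteq\mathbb{R}$ with kernel $L$ is a random locally finite point configuration $\mathcal{X}$ on $E$ such that for all $n\in\mathbb{N}$ and all compactly supported bounded Borel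 $F$ on $E^n$, the expectation of $\sum F(x_{i_1},\dots,x_{i_n})$, summed over $n$-tuples of pairwise distinct points of $\mathcal{X}$, equals $\int_{E^n}F(y_1,\dots,y_n)\det[L(y_i,y_j)]_{i,j=1}^n\,dy_1\cdots dy_n$. The random variable $\mathbf{X}(s)$ is the principal value sum $$\mathbf{X}(s)=\lim_{m\to\infty}\Big[\sum_{x\in\mathbf{C}^{(s)}}x\,\mathbf{1}\left(|x|>\tfrac{1}{m^2}\right)\Big],$$ which is known to be well defined (Qiu). Joint moments. Let $\mathbb{U}(N)$ be the group of $N\times N$ unitary matrices with Haar probability measure $\mu_N$. For $\mathbf{U}\in\mathbb{U}(N)$ with eigenvalues $e^{i\theta_1},\dots,e^{i\theta_N}$ put $$\mathbf{S}_{\mathbf{U}}(\theta)=\det\left(I-e^{-i\theta}\mathbf{U}\right),\qquad \mathbf{G}_{\mathbf{U}}(\theta)=e^{\frac{iN}{2}(\theta+\pi)-i\sum_{k=1}^N\frac{\theta_k}{2}}\,\mathbf{S}_{\mathbf{U}}(\theta),$$ $$\mathcal{R}_N(s,h)=\int_{\mathbb{U}(N)}\left|\mathbf{G}_{\mathbf{U}}(0)\right|^{2s-2h}\left|\frac{d\mathbf{G}_{\mathbf{U}}}{d\theta}\Big|_{\theta=0}\right|^{2h}d\mu_N(\mathbf{U}).$$ $\mathcal{R}(s,h)$ denotes the limit $\lim_{N\to\infty}N^{-s^2-2h}\mathcal{R}_N(s,h)$; in particular $\mathcal{R}(0,h)=\lim_{N\to\infty}N^{-2h}\mathcal{R}_N(0,h)$.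 *)

theory Defs
  imports
    "HOL-Probability.Probability"
    "Jordan_Normal_Form.Determinant"
    "Jordan_Normal_Form.Char_Poly"
    "Jordan_Normal_Form.Schur_Decomposition"
begin

section \<open>Determinantal point processes\<close>

text \<open>
  Random locally finite configurations of distinct points of \<open>E\<close>. Local finiteness is relative
  to \<open>E\<close>: a configuration on the punctured line may accumulate at \<open>0\<close>.
  Measurability is with respect to the sigma-algebra generated by the numbers of points in
  relatively compact Borel subsets of \<open>E\<close>.
\<close>

definition point_configuration :: "'a measure \<Rightarrow> ('a \<Rightarrow> real set) \<Rightarrow> real set \<Rightarrow> bool" where
  "point_configuration M C E \<longleftrightarrow>
     prob_space M \<and>
     (\<forall>\<omega>\<in>space M. C \<omega> \<subseteq> E) \<and>
     (\<forall>\<omega>\<in>space M. \<forall>K. compact K \<and> K \<subseteq> E \<longrightarrow> finite (C \<omega> \<inter> K)) \<and>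
     (\<forall>B K. B \<in> sets borel \<and> B \<subseteq> K \<and> compact K \<and> K \<subseteq> E \<longrightarrow>
        (\<lambda>\<omega>. card (C \<omega> \<inter> B)) \<in> measurable M (count_space UNIV))"

text \<open>
  A test function on \<open>E\<^sup>n\<close> (points are functions on \<open>{..<n}\<close>) that vanishes
  off \<open>K\<^sup>n\<close> for some compact \<open>K \<subseteq> E\<close>; this is the same as having compact support in \<open>E\<^sup>n\<close>.
\<close>

definition test_function :: "real set \<Rightarrow> nat \<Rightarrow> ((nat \<Rightarrow> real) \<Rightarrow> real) \<Rightarrow> bool" where
  "test_function E n F \<longleftrightarrow>
     F \<in> borel_measurable (\<Pi>\<^sub>M i\<in>{..<n}. borel) \<and>
     bounded (range F) \<and>
     (\<exists>K. compact K \<and> K \<subseteq> E \<and> (\<forall>y. y \<notin> ({..<n} \<rightarrow>\<^sub>E K) \<longrightarrow> F y = 0))"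

definition distinct_tuples :: "nat \<Rightarrow> real set \<Rightarrow> (nat \<Rightarrow> real) set" where
  "distinct_tuples n X = {y \<in> {..<n} \<rightarrow>\<^sub>E X. inj_on y {..<n}}"

definition determinantal_process ::
  "'a measure \<Rightarrow> ('a \<Rightarrow> real set) \<Rightarrow> real set \<Rightarrow> (real \<Rightarrow> real \<Rightarrow> real) \<Rightarrow> bool" where
  "determinantal_process M C E L \<longleftrightarrow>
     point_configuration M C E \<and>
     (\<forall>n F. test_function E n F \<longrightarrow>
        set_integrable (\<Pi>\<^sub>M i\<in>{..<n}. lborel) ({..<n} \<rightarrow>\<^sub>E E)
          (\<lambda>y. F y * Determinant.det (Matrix.mat n n (\<lambda>(i, j). L (y i) (y j)))) \<and>
        has_bochner_integral M (\<lambda>\<omega>. \<Sum>\<^sub>\<infinity>y\<in>distinct_tuples n (C \<omega>). F y)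
          (LINT y:({..<n} \<rightarrow>\<^sub>E E)|(\<Pi>\<^sub>M i\<in>{..<n}. lborel).
             F y * Determinant.det (Matrix.mat n n (\<lambda>(i, j). L (y i) (y j)))))"


section \<open>The process \<open>C(s)\<close> and the random variable \<open>X(s)\<close>\<close>

text \<open>Bessel function of the first kind, real order, for arguments \<open>x > 0\<close>.\<close>

definition bessel_J :: "real \<Rightarrow> real \<Rightarrow> real" where
  "bessel_J \<nu> x =
     (\<Sum>m. (-1) ^ m / fact m * rGamma (real m + \<nu> + 1) * (x / 2) powr (2 * real m + \<nu>))"

definition kernel_T :: "real \<Rightarrow> real \<Rightarrow> real" where
  "kernel_T s x = 2 powr (2 * s - 1/2) * Gamma (s + 1/2) * \<bar>x\<bar> powr (- 1/2)
                    * bessel_J (s - 1/2) (1 / \<bar>x\<bar>)"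

definition kernel_R :: "real \<Rightarrow> real \<Rightarrow> real" where
  "kernel_R s x = sgn x * 2 powr (2 * s + 3/2) * Gamma (s + 3/2) * \<bar>x\<bar> powr (- 1/2)
                    * bessel_J (s + 1/2) (1 / \<bar>x\<bar>)"

definition kernel_K_offdiag :: "real \<Rightarrow> real \<Rightarrow> real \<Rightarrow> real" where
  "kernel_K_offdiag s x y =
     1 / (2 * pi) * (Gamma (s + 1) ^ 2 / (Gamma (2 * s + 1) * Gamma (2 * s + 2)))
       * ((kernel_T s x * kernel_R s y - kernel_T s y * kernel_R s x) / (x - y))"

definition kernel_K :: "real \<Rightarrow> real \<Rightarrow> real \<Rightarrow> real" where
  "kernel_K s x y =
     (if x = y then Lim (at x) (\<lambda>u. kernel_K_offdiag s u x) else kernel_K_offdiag s x y)"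

definition is_process_C :: "real \<Rightarrow> 'a measure \<Rightarrow> ('a \<Rightarrow> real set) \<Rightarrow> bool" where
  "is_process_C s M C \<longleftrightarrow> determinantal_process M C (- {0}) (kernel_K s)"

text \<open>
  For \<open>C = C(s)\<close> the inner sum is almost surely finite. (In the exceptional case of infinitely
  many points in \<open>{x. \<bar>x\<bar> > 1/m\<^sup>2}\<close> the family is not summable and its sum is \<open>0\<close> by
  convention.)
\<close>

definition pv_sum :: "('a \<Rightarrow> real set) \<Rightarrow> 'a \<Rightarrow> real" where
  "pv_sum C \<omega> = lim (\<lambda>m. \<Sum>\<^sub>\<infinity>x\<in>{x \<in> C \<omega>. \<bar>x\<bar> > 1 / (real m)\<^sup>2}. x)"


section \<open>Joint moments over the unitary group\<close>

definition unitary_group :: "nat \<Rightarrow> complex mat set" where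
  "unitary_group N = {U \<in> carrier_mat N N. U * mat_adjoint U = 1\<^sub>m N}"

text \<open>
  The Borel sigma-algebra of \<open>unitary_group N\<close>, seen as a subspace of the space of \<open>N\<^sup>2\<close>-tuples of
  complex numbers.
\<close>

definition unitary_borel :: "nat \<Rightarrow> complex mat measure" where
  "unitary_borel N =
     vimage_algebra (unitary_group N) (\<lambda>U. \<lambda>ij\<in>{..<N} \<times> {..<N}. U $$ ij)
       (\<Pi>\<^sub>M ij\<in>{..<N} \<times> {..<N}. borel)"

text \<open>The group being compact, a left-invariant probability measure is unique and bi-invariant.\<close>

definition unitary_haar :: "nat \<Rightarrow> complex mat measure \<Rightarrow> bool" where
  "unitary_haar N \<mu> \<longleftrightarrow>
     prob_space \<mu> \<and> sets \<mu> = sets (unitary_borel N) \<and>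
     (\<forall>V\<in>unitary_group N. distr \<mu> \<mu> (\<lambda>U. V * U) = \<mu>)"

text \<open>
  Arguments of the eigenvalues with multiplicity. They are determined up to order and multiples
  of \<open>2\<pi>\<close>; another choice multiplies \<open>G_fun U\<close> by a constant \<open>\<plusminus>1\<close>.
\<close>

definition eigenangles :: "complex mat \<Rightarrow> real list" where
  "eigenangles U = (SOME \<theta>s. char_poly U = (\<Prod>\<theta>\<leftarrow>\<theta>s. [:- cis \<theta>, 1:]))"

definition S_fun :: "complex mat \<Rightarrow> real \<Rightarrow> complex" where
  "S_fun U \<theta> = Determinant.det (1\<^sub>m (dim_row U) - exp (- (\<i> * of_real \<theta>)) \<cdot>\<^sub>m U)"

definition G_fun :: "complex mat \<Rightarrow> real \<Rightarrow> complex" where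
  "G_fun U \<theta> =
     exp (\<i> * of_nat (dim_row U) / 2 * (of_real \<theta> + of_real pi)
          - \<i> * (\<Sum>\<phi>\<leftarrow>eigenangles U. of_real \<phi> / 2)) * S_fun U \<theta>"

definition joint_moment :: "complex mat measure \<Rightarrow> real \<Rightarrow> complex \<Rightarrow> complex" where
  "joint_moment \<mu> s h =
     (LINT U|\<mu>. of_real (norm (G_fun U 0)) powr (2 * of_real s - 2 * h)
              * of_real (norm (vector_derivative (G_fun U) (at 0))) powr (2 * h))"

definition joint_moment_limit :: "(nat \<Rightarrow> complex mat measure) \<Rightarrow> real \<Rightarrow> complex \<Rightarrow> complex" where
  "joint_moment_limit \<mu> s h =
     lim (\<lambda>N. of_nat N powr (- ((of_real s)\<^sup>2) - 2 * h) * joint_moment (\<mu> N) s h)"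

end

theory Submission
  imports Defs "HOL-Complex_Analysis.Complex_Analysis" "HOL-Real_Asymp.Real_Asymp"
begin

text \<open>
  Both halves rest on one principle: a function with nonnegative real part that is invariant on
  average is Cauchy distributed on the boundary, because \<open>exp (- t F)\<close> is bounded and holomorphic.

  For a unitary matrix, \<open>|G'(0)| / |G(0)|\<close> is \<open>N / 2\<close> times the modulus of the boundary value at \<open>1\<close>
  of the Herglotz function \<open>H(z)\<close>, the mean of \<open>(1 + w z) / (1 - w z)\<close> over the eigenvalues \<open>w\<close>. Haar
  measure is invariant under multiplication by scalars of modulus \<open>1\<close>, so the mean value property
  gives \<open>E exp (- t H(r)) = exp (- t H(0)) = exp (- t)\<close> for all \<open>r < 1\<close>, and \<open>H(1) / i\<close> is Cauchy for
  every \<open>N\<close>. The joint moments are then absolute moments of the Cauchy distribution.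

  For the point process, the substitution \<open>u = 1 / x\<close> turns \<open>C(0)\<close> into the sine process with density
  \<open>1 / \<pi>\<close>. The sum of \<open>1 / (u - z)\<close> over its points has nonnegative imaginary part, a law that is
  invariant under real shifts of \<open>z\<close>, and concentrates near \<open>i\<close> as \<open>Im z\<close> grows. Cauchy's theorem on a
  long flat rectangle compares the averages of \<open>exp (i t Y(z))\<close> over two horizontal lines, so the
  characteristic function is \<open>exp (- t)\<close> at every height, and at height \<open>0\<close> in the limit.
\<close>

subsection \<open>The Cauchy distribution and its absolute moments\<close>

text \<open>The sum of \<open>1 / (u - z)\<close> over the sine process converges only
  conditionally, so every identity is proved in a bounded window, and this shapes the second half.
  Invariance under shifts is exact for a window that moves with \<open>z\<close>, whereas Cauchy's
  theorem needs one window for the whole rectangle. Passing from one to the other costs a linear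
  statistic of a function that vanishes near the real point below \<open>z\<close>, and its
  fluctuations are small however close \<open>z\<close> comes to the real line. Errors of this kind
  involve only the one- and two-point functions, through a bound of the mean absolute deviation by
  the variance; correlation functions of every order enter in the shift invariance. The vertical
  sides of the rectangle need no better estimate than their length, because in an average over
  length \<open>L\<close> they count at most \<open>2 \<eta> / L\<close>. That the principal value
  exists is part of the proof: cut-offs at the squares \<open>m^2\<close> make the increments
  summable in mean.\<close>

definition cauchy_density :: "real \<Rightarrow> real" where
  "cauchy_density x = 1 / (pi * (1 + x\<^sup>2))"

lemma cauchy_density_pos: "cauchy_density x > 0"
  unfolding cauchy_density_def by (intro divide_pos_pos mult_pos_pos) (auto simp: add_pos_nonneg)

lemma borel_measurable_cauchy_density [measurable]: "cauchy_density \<in> borel_measurable borel"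
  unfolding cauchy_density_def by measurable

lemma has_bochner_integral_inverse_square:
  "has_bochner_integral lborel (\<lambda>x::real. 1 / (1 + x\<^sup>2)) pi"
proof -
  have deriv: "DERIV arctan x :> 1 / (1 + x\<^sup>2)" for x :: real
    using DERIV_arctan[of x] by (simp add: field_simps)
  have cont: "isCont (\<lambda>x. 1 / (1 + x\<^sup>2)) x" for x :: real
    by (intro continuous_intros) (auto simp: add_nonneg_eq_0_iff)
  have A: "((arctan \<circ> real_of_ereal) \<longlongrightarrow> - pi / 2) (at_right (- \<infinity>))"
    using tendsto_arctan_at_bot by (simp add: ereal_tendsto_simps1 comp_assoc)
  have B: "((arctan \<circ> real_of_ereal) \<longlongrightarrow> pi / 2) (at_left \<infinity>)"
    using tendsto_arctan_at_top by (simp add: ereal_tendsto_simps1 comp_assoc)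
  have 1: "set_integrable lborel (einterval (- \<infinity>) \<infinity>) (\<lambda>x::real. 1 / (1 + x\<^sup>2))"
    by (rule interval_integral_FTC_nonneg(1)[where F = arctan and A = "- pi / 2" and B = "pi / 2"])
       (use deriv cont A B in \<open>auto simp: ereal_tendsto_simps1\<close>)
  have 2: "(LBINT x=- \<infinity>..\<infinity>. 1 / (1 + x\<^sup>2)) = pi / 2 - (- pi / 2)"
    by (rule interval_integral_FTC_nonneg(2)[where F = arctan])
       (use deriv cont A B in \<open>auto simp: ereal_tendsto_simps1\<close>)
  have E: "einterval (- \<infinity>) \<infinity> = UNIV" by (auto simp: einterval_def)
  show ?thesis
    using 1 2 by (simp add: E interval_lebesgue_integral_def set_integrable_def
        set_lebesgue_integral_def has_bochner_integral_iff)
qed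

lemma integrable_inverse_square_bound:
  fixes f :: "real \<Rightarrow> complex"
  assumes [measurable]: "f \<in> borel_measurable borel" and "\<And>x. norm (f x) \<le> c"
  shows "integrable lborel (\<lambda>x. f x / (1 + of_real x ^ 2))"
proof (rule Bochner_Integration.integrable_bound)
  show "integrable lborel (\<lambda>x::real. c * (1 / (1 + x\<^sup>2)))"
    using has_bochner_integral_inverse_square by (intro integrable_mult_right) (auto simp: has_bochner_integral_iff)
  have "norm (1 + complex_of_real x ^ 2) = 1 + x\<^sup>2" for x
    by (metis abs_of_nonneg norm_of_real of_real_1 of_real_add of_real_power zero_le_one zero_le_power2 add_nonneg_nonneg)
  then show "AE x in lborel. norm (f x / (1 + complex_of_real x ^ 2)) \<le> norm (c * (1 / (1 + x\<^sup>2)))"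
    using assms(2) by (auto simp: norm_divide intro!: divide_right_mono order_trans[OF assms(2)])
qed measurable

text \<open>Subtracting \<open>g \<i>\<close> makes the singularity at \<open>\<i>\<close>
  removable, so the closed contour gives \<open>0\<close> with no residue. On the arc the numerator
  is at most \<open>2\<close>, because \<open>g\<close> is bounded by \<open>1\<close> on the closed
  upper half plane, and \<open>z^2 + 1\<close> has modulus at least \<open>R^2 - 1\<close>.\<close>

lemma cauchy_fourier_semicircle:
  fixes t R :: real
  assumes t: "t \<ge> 0" and R: "R > 1"
  defines "g \<equiv> \<lambda>z. exp (\<i> * of_real t * z)"
  defines "F \<equiv> \<lambda>z. (if z = \<i> then deriv g \<i> else (g z - g \<i>) / (z - \<i>)) / (z + \<i>)"
  shows "norm (integral {-R..R} (\<lambda>x. F (of_real x))) \<le> 2 / (R\<^sup>2 - 1) * R * pi"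
proof -
  \<comment> \<open>The line \<open>Im z = -1\<close> carries the other zero of
    \<open>z^2 + 1\<close>; the half plane above it is convex and contains the whole
    contour.\<close>
  define S where "S = {z. Im z > -1}"
  have S: "open S" "convex S"
    unfolding S_def by (auto simp: open_halfspace_Im_gt convex_halfspace_Im_gt)
  have hol: "F holomorphic_on S"
    unfolding F_def
    by (intro holomorphic_on_divide pole_lemma_open S)
       (auto simp: g_def S_def complex_eq_iff intro!: holomorphic_intros)
  let ?a = "part_circlepath 0 R 0 pi" and ?l = "linepath (of_real (-R)) (of_real R :: complex)"
  have pa: "path_image ?a \<subseteq> {z. norm z = R \<and> Im z \<ge> 0}"
    using R by (auto simp: path_image_part_circlepath' norm_mult cis_conv_exp[symmetric] sin_ge_zero closed_segment_eq_real_ivl)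
  have pl: "path_image ?l \<subseteq> S"
    by (auto simp: path_image_linepath closed_segment_def S_def)
  have ends: "pathfinish ?l = pathstart ?a" "pathfinish ?a = pathstart ?l"
    by (auto simp: exp_Euler)
  have paS: "path_image ?a \<subseteq> S" using pa by (force simp: S_def)
  have "(F has_contour_integral 0) (?l +++ ?a)"
    by (rule Cauchy_theorem_convex_simple[OF hol S(2)])
       (use pl paS ends in \<open>auto simp: path_image_join intro!: valid_path_join\<close>)
  moreover have i: "F contour_integrable_on ?l" "F contour_integrable_on ?a"
    using hol pl paS by (auto intro!: contour_integrable_continuous_linepath contour_integrable_continuous_part_circlepath
        holomorphic_on_imp_continuous_on intro: holomorphic_on_subset continuous_on_subset)
  ultimately have "contour_integral ?l F + contour_integral ?a F = 0"
    using contour_integral_join[of F ?l ?a] contour_integral_unique by fastforce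
  then have "contour_integral ?l F = - contour_integral ?a F" by (simp add: add_eq_0_iff2)
  moreover have "norm (contour_integral ?a F) \<le> 2 / (R\<^sup>2 - 1) * R * \<bar>pi - 0\<bar>"
  proof (rule contour_integral_bound_part_circlepath[OF i(2)])
    fix z assume "z \<in> path_image ?a"
    then have z: "norm z = R" "Im z \<ge> 0" using pa by auto
    have "z \<noteq> \<i>" using z R by auto
    have "norm (g z) \<le> 1" "norm (g \<i>) \<le> 1" using z t by (auto simp: g_def)
    then have "norm (g z - g \<i>) \<le> 2" using norm_triangle_ineq4[of "g z" "g \<i>"] by simp
    moreover have "norm (z\<^sup>2 + 1) \<ge> R\<^sup>2 - 1"
      using norm_diff_ineq[of "z\<^sup>2" 1] z by (simp add: norm_power)
    moreover have "F z = (g z - g \<i>) / (z\<^sup>2 + 1)"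
      using \<open>z \<noteq> \<i>\<close> by (simp add: F_def algebra_simps power2_eq_square)
    moreover have "R\<^sup>2 > 1" using R by (simp add: power2_eq_square less_1_mult)
    ultimately show "norm (F z) \<le> 2 / (R\<^sup>2 - 1)"
      by (auto simp: norm_divide intro!: frac_le)
  qed (use R in \<open>auto simp: power2_eq_square less_imp_le less_1_mult\<close>)
  moreover have "contour_integral ?l F = integral {-R..R} (\<lambda>x. F (of_real x))"
    using R by (subst contour_integral_linepath_Reals_eq) auto
  ultimately show ?thesis by (metis diff_zero abs_of_pos pi_gt_zero norm_minus_cancel)
qed

text \<open>As \<open>R\<close> tends to infinity the integral of
  \<open>(g x - g \<i>) / (1 + x^2)\<close> vanishes. The constant \<open>g \<i> = exp (- t)\<close>
  may thus replace \<open>g\<close>, and the integral \<open>pi\<close> of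
  \<open>1 / (1 + x^2)\<close> is left.\<close>

lemma cauchy_fourier:
  assumes t: "t \<ge> 0"
  shows "(\<integral>x. exp (\<i> * of_real (t * x)) / (1 + of_real x ^ 2) \<partial>lborel) = of_real (pi * exp (- t))"
proof -
  define g where "g = (\<lambda>z. exp (\<i> * of_real t * z))"
  define F where "F = (\<lambda>z. (if z = \<i> then deriv g \<i> else (g z - g \<i>) / (z - \<i>)) / (z + \<i>))"
  have gi: "g \<i> = of_real (exp (- t))"
  proof -
    have "\<i> * of_real t * \<i> = of_real (- t)" by (simp add: complex_eq_iff)
    then show ?thesis unfolding g_def by (simp flip: exp_of_real)
  qed
  have Fx: "F (of_real x) = (g (of_real x) - g \<i>) / (1 + of_real x ^ 2)" for x
  proof -
    have "of_real x \<noteq> \<i>" by (metis Im_complex_of_real imaginary_unit.simps(2) zero_neq_one)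
    then show ?thesis by (simp add: F_def algebra_simps power2_eq_square)
  qed
  have gm [measurable]: "(\<lambda>x::real. g (of_real x)) \<in> borel_measurable borel"
    unfolding g_def by measurable
  have gb: "norm (g (of_real x)) \<le> 1" for x :: real by (simp add: g_def)
  have "norm (g \<i>) \<le> 1" using t by (simp add: gi)
  then have "norm (g (of_real x) - g \<i>) \<le> 2" for x :: real
    using norm_triangle_ineq4[of "g (of_real x)" "g \<i>"] gb[of x] by simp
  then have int: "integrable lborel (\<lambda>x. F (of_real x))"
    unfolding Fx by (intro integrable_inverse_square_bound) auto
  have "(\<lambda>n. \<integral>x. indicator {- real n..real n} x *\<^sub>R F (of_real x) \<partial>lborel) \<longlonglongrightarrow> (\<integral>x. F (of_real x) \<partial>lborel)"
  proof (rule integral_dominated_convergence)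
    show "integrable lborel (\<lambda>x. norm (F (of_real x)))" using int by simp
    show "AE x in lborel. (\<lambda>n. indicator {- real n..real n} x *\<^sub>R F (of_real x)) \<longlonglongrightarrow> F (of_real x)"
    proof (intro AE_I2 tendsto_eventually)
      fix x :: real
      show "\<forall>\<^sub>F n in sequentially. indicator {- real n..real n} x *\<^sub>R F (of_real x) = F (of_real x)"
        using eventually_ge_at_top[of "nat \<lceil>\<bar>x\<bar>\<rceil>"]
        by eventually_elim (auto simp: indicator_def)
    qed
  qed (use int in \<open>auto simp: indicator_def\<close>)
  moreover have "(\<lambda>n. \<integral>x. indicator {- real n..real n} x *\<^sub>R F (of_real x) \<partial>lborel) \<longlonglongrightarrow> 0"
  proof (rule Lim_null_comparison)
    show "\<forall>\<^sub>F n in sequentially. norm (\<integral>x. indicator {- real n..real n} x *\<^sub>R F (of_real x) \<partial>lborel)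
            \<le> 2 / ((real n)\<^sup>2 - 1) * real n * pi"
      using eventually_gt_at_top[of 1]
    proof eventually_elim
      case (elim n)
      have "(\<integral>x. indicator {- real n..real n} x *\<^sub>R F (of_real x) \<partial>lborel) = integral {- real n..real n} (\<lambda>x. F (of_real x))"
        using set_borel_integral_eq_integral(2)[of "{- real n..real n}" "\<lambda>x. F (of_real x)"]
              integrable_mult_indicator[OF _ int, of "{- real n..real n}"]
        by (simp add: set_lebesgue_integral_def set_integrable_def)
      then show ?case
        using cauchy_fourier_semicircle[OF t, of "real n"] elim unfolding F_def g_def by simp
    qed
    show "(\<lambda>n. 2 / ((real n)\<^sup>2 - 1) * real n * pi) \<longlonglongrightarrow> 0" by real_asymp
  qed
  ultimately have 0: "(\<integral>x. F (of_real x) \<partial>lborel) = 0" using LIMSEQ_unique by blast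
  have i1: "integrable lborel (\<lambda>x. g (of_real x) / (1 + of_real x ^ 2))"
    using gb by (intro integrable_inverse_square_bound) auto
  have i2: "has_bochner_integral lborel (\<lambda>x. g \<i> / (1 + of_real x ^ 2)) (g \<i> * of_real pi)"
  proof -
    have "has_bochner_integral lborel (\<lambda>x. g \<i> * of_real (1 / (1 + x\<^sup>2))) (g \<i> * of_real pi)"
      using has_bochner_integral_inverse_square
      by (intro has_bochner_integral_mult_right has_bochner_integral_of_real) auto
    then show ?thesis by simp
  qed
  have "(\<integral>x. F (of_real x) \<partial>lborel) = (\<integral>x. g (of_real x) / (1 + of_real x ^ 2) \<partial>lborel) - g \<i> * of_real pi"
    unfolding Fx diff_divide_distrib using i1 i2 by (simp add: has_bochner_integral_iff)
  with 0 show ?thesis by (simp add: g_def gi[unfolded g_def] mult_ac exp_of_real[of "- t", symmetric])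
qed

lemma prob_space_cauchy: "prob_space (density lborel (\<lambda>x. ennreal (cauchy_density x)))"
proof
  have eq: "cauchy_density = (\<lambda>x. 1 / pi * (1 / (1 + x\<^sup>2)))"
    by (auto simp: cauchy_density_def)
  have "integrable lborel cauchy_density"
    unfolding eq using has_bochner_integral_inverse_square
    by (intro integrable_mult_right) (auto simp: has_bochner_integral_iff)
  then have "(\<integral>\<^sup>+x. ennreal (cauchy_density x) \<partial>lborel) = ennreal (\<integral>x. cauchy_density x \<partial>lborel)"
    using less_imp_le[OF cauchy_density_pos] by (intro nn_integral_eq_integral) auto
  also have "\<dots> = 1"
    unfolding eq integral_mult_right_zero using has_bochner_integral_inverse_square by (simp add: has_bochner_integral_iff)
  finally show "emeasure (density lborel (\<lambda>x. ennreal (cauchy_density x)))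
      (space (density lborel (\<lambda>x. ennreal (cauchy_density x)))) = 1"
    by (simp add: emeasure_density)
qed

lemma char_cauchy:
  assumes "t \<ge> 0"
  shows "char (density lborel (\<lambda>x. ennreal (cauchy_density x))) t = of_real (exp (- t))"
proof -
  have "char (density lborel (\<lambda>x. ennreal (cauchy_density x))) t
      = (\<integral>x. (exp (\<i> * of_real (t * x)) / (1 + of_real x ^ 2)) / of_real pi \<partial>lborel)"
    unfolding char_def using less_imp_le[OF cauchy_density_pos]
    by (subst integral_density) (auto simp: cauchy_density_def scaleR_conv_of_real field_simps)
  then show ?thesis unfolding integral_divide_zero cauchy_fourier[OF assms] by simp
qed

text \<open>Positive \<open>t\<close> suffice because \<open>X\<close> is real: its characteristic
  function takes conjugate values at \<open>t\<close> and \<open>- t\<close>. Only this sign will be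
  available, since \<open>exp (- t F)\<close> is bounded for \<open>t \<ge> 0\<close> when
  \<open>F\<close> has nonnegative real part.\<close>

lemma cauchy_distributedI:
  assumes "prob_space M" and [measurable]: "X \<in> borel_measurable M"
    and char: "\<And>t. t > 0 \<Longrightarrow> (\<integral>\<omega>. exp (\<i> * of_real (t * X \<omega>)) \<partial>M) = of_real (exp (- t))"
  shows "distributed M lborel X (\<lambda>x. ennreal (cauchy_density x))"
proof -
  interpret prob_space M by fact
  let ?C = "density lborel (\<lambda>x. ennreal (cauchy_density x))"
  interpret D: prob_space "distr M borel X" by (rule prob_space_distr) simp
  interpret C: prob_space ?C by (rule prob_space_cauchy)
  have rD: "real_distribution (distr M borel X)" and rC: "real_distribution ?C"
    by unfold_locales auto
  interpret D: real_distribution "distr M borel X" by (rule rD)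
  interpret C: real_distribution ?C by (rule rC)
  have pos: "char (distr M borel X) t = char ?C t" if "t > 0" for t
    using char[OF that] char_cauchy[of t] that by (simp add: char_def integral_distr)
  have neg: "char N (- t) = cnj (char N t)" for N t
    unfolding char_def by (subst Bochner_Integration.integral_cnj[symmetric]) (simp add: exp_cnj)
  have "char (distr M borel X) = char ?C"
  proof
    fix t :: real
    consider "t > 0" | "t = 0" | "t < 0" by linarith
    then show "char (distr M borel X) t = char ?C t"
    proof cases
      case 3
      then show ?thesis using pos[of "- t"] neg[of _ "- t"] by simp
    qed (auto simp: pos D.char_zero C.char_zero)
  qed
  then have "distr M borel X = ?C" by (rule Levy_uniqueness[OF rD rC])
  then show ?thesis
    unfolding distributed_def by (auto cong: distr_cong simp: distr_cong[of M M lborel borel X X])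
qed

text \<open>Rounding \<open>a\<close> down to the grid of mesh \<open>1 / Suc n\<close> leaves
  countably many parameters, for each of which measurability in \<open>\<omega>\<close> is enough;
  continuity in \<open>a\<close> carries this to the limit.\<close>

lemma borel_measurable_Caratheodory:
  fixes f :: "real \<Rightarrow> 'a \<Rightarrow> 'b :: {second_countable_topology, real_normed_vector}"
  assumes meas: "\<And>a. f a \<in> borel_measurable M"
    and cont: "\<And>\<omega>. \<omega> \<in> space M \<Longrightarrow> continuous_on UNIV (\<lambda>a. f a \<omega>)"
  shows "(\<lambda>(a, \<omega>). f a \<omega>) \<in> borel_measurable (borel \<Otimes>\<^sub>M M)"
proof -
  define q :: "nat \<Rightarrow> real \<Rightarrow> real" where "q n a = real_of_int \<lfloor>real (Suc n) * a\<rfloor> / real (Suc n)" for n a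
  have q: "(\<lambda>n. q n a) \<longlonglongrightarrow> a" for a
  proof (rule tendsto_sandwich)
    show "\<forall>\<^sub>F n in sequentially. a - 1 / real (Suc n) \<le> q n a"
      unfolding q_def
    proof (intro always_eventually allI)
      fix n
      have "real (Suc n) * a - 1 \<le> real_of_int \<lfloor>real (Suc n) * a\<rfloor>" by linarith
      from divide_right_mono[OF this, of "real (Suc n)"]
      show "a - 1 / real (Suc n) \<le> real_of_int \<lfloor>real (Suc n) * a\<rfloor> / real (Suc n)"
        by (simp add: diff_divide_distrib)
    qed
    show "\<forall>\<^sub>F n in sequentially. q n a \<le> a"
      unfolding q_def by (intro always_eventually allI) (auto simp: divide_le_eq mult.commute)
    show "(\<lambda>n. a - 1 / real (Suc n)) \<longlonglongrightarrow> a"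
      using tendsto_diff[OF tendsto_const[of a] LIMSEQ_Suc[OF lim_1_over_n]] by simp
  qed simp
  have m: "(\<lambda>(a, \<omega>). f (q n a) \<omega>) \<in> borel_measurable (borel \<Otimes>\<^sub>M M)" for n
  proof -
    have "(\<lambda>p. f (real_of_int \<lfloor>real (Suc n) * fst p\<rfloor> / real (Suc n)) (snd p)) \<in> borel_measurable (borel \<Otimes>\<^sub>M M)"
    proof (rule measurable_compose_countable[where f = "\<lambda>i p. f (real_of_int i / real (Suc n)) (snd p)"])
      show "(\<lambda>p. f (real_of_int i / real (Suc n)) (snd p)) \<in> borel_measurable (borel \<Otimes>\<^sub>M M)" for i
        using meas by (rule measurable_compose[OF measurable_snd])
    qed measurable
    then show ?thesis by (simp add: q_def split_beta')
  qed
  show ?thesis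
  proof (rule borel_measurable_LIMSEQ_metric[OF m])
    fix p :: "real \<times> 'a" assume "p \<in> space (borel \<Otimes>\<^sub>M M)"
    then have "isCont (\<lambda>a. f a (snd p)) (fst p)"
      using cont[of "snd p"] by (auto simp: space_pair_measure continuous_on_eq_continuous_at)
    from isCont_tendsto_compose[OF this q]
    show "(\<lambda>n. case p of (a, \<omega>) \<Rightarrow> f (q n a) \<omega>) \<longlonglongrightarrow> (case p of (a, \<omega>) \<Rightarrow> f a \<omega>)"
      by (simp add: split_beta)
  qed
qed

section \<open>Gamma and Beta integrals for the absolute moments\<close>

lemma set_integrable_Ioi_lebesgue_lborel:
  fixes f :: "real \<Rightarrow> complex"
  assumes "f absolutely_integrable_on {0<..}" "continuous_on {0<..} f"
  shows "integrable lborel (\<lambda>x. indicator {0<..} x *\<^sub>R f x)"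
proof -
  have [measurable]: "(\<lambda>x. indicator {0<..} x *\<^sub>R f x) \<in> borel_measurable borel"
    using assms(2) by (intro borel_measurable_continuous_on_indicator) auto
  show ?thesis using assms(1) by (simp add: set_integrable_def integrable_completion)
qed

lemma Gamma_lborel:
  fixes z :: complex
  assumes z: "Re z > 0"
  shows "has_bochner_integral lborel (\<lambda>t. indicator {0<..} t *\<^sub>R (of_real t powr (z - 1) * of_real (exp (- t)))) (Gamma z)"
proof -
  let ?f = "\<lambda>t. of_real t powr (z - 1) * of_real (exp (- t)) :: complex"
  have f: "?f = (\<lambda>t. of_real t powr (z - 1) / of_real (exp t))"
    by (auto simp: exp_minus divide_inverse)
  have c: "continuous_on {0<..} ?f"
    by (auto intro!: continuous_intros)
  have a: "?f absolutely_integrable_on {0<..}"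
    unfolding f by (rule absolutely_integrable_Gamma_integral'[OF z])
  have i: "integrable lborel (\<lambda>x. indicator {0<..} x *\<^sub>R ?f x)"
    by (rule set_integrable_Ioi_lebesgue_lborel[OF a c])
  have "(\<integral>x. indicator {0<..} x *\<^sub>R ?f x \<partial>lborel) = integral {0<..} ?f"
    using set_borel_integral_eq_integral(2)[of "{0<..}" ?f] i
    by (simp add: set_lebesgue_integral_def set_integrable_def)
  also have "\<dots> = Gamma z"
    unfolding f using Gamma_integral_complex'[OF z] by (rule integral_unique)
  finally show ?thesis using i by (simp add: has_bochner_integral_iff)
qed

text \<open>Near \<open>0\<close> the factor \<open>x powr a\<close> decides, near infinity
  \<open>x powr (a - p)\<close>. The case \<open>p = 1\<close> serves the Beta integral in
  \<open>s\<close>, the case \<open>p = 2\<close> the moment integral in \<open>x\<close>.\<close>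

lemma integrable_powr_div:
  fixes a :: real and p :: nat
  assumes a: "-1 < a" "a < real p - 1"
  shows "integrable lborel (\<lambda>x. indicator {0<..} x *\<^sub>R (x powr a / (1 + x ^ p)))"
proof -
  have 1: "set_integrable lborel {0<..1} (\<lambda>x. x powr a)"
    using nonnegative_absolutely_integrable_1[OF integrable_on_powr_from_0'[of a 1]] a
    by (simp add: set_integrable_def integrable_completion)
  have "(\<lambda>x. x powr (a - real p)) integrable_on {1..}"
    using has_integral_powr_to_inf[of "a - real p" 1] a by (auto simp: integrable_on_def)
  then have 2: "set_integrable lborel {1..} (\<lambda>x. x powr (a - real p))"
    using nonnegative_absolutely_integrable_1[of "\<lambda>x. x powr (a - real p)" "{1..}"] a
    by (simp add: set_integrable_def integrable_completion)
  have "integrable lborel (\<lambda>x. indicator {0<..1} x *\<^sub>R x powr a + indicator {1..} x *\<^sub>R x powr (a - real p))"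
    using 1 2 unfolding set_integrable_def by (rule Bochner_Integration.integrable_add)
  then show ?thesis
  proof (rule Bochner_Integration.integrable_bound)
    show "AE x in lborel. norm (indicator {0<..} x *\<^sub>R (x powr a / (1 + x ^ p)))
       \<le> norm (indicator {0<..1} x *\<^sub>R x powr a + indicator {1..} x *\<^sub>R x powr (a - real p))"
    proof (rule AE_I2)
      fix x :: real
      show "norm (indicator {0<..} x *\<^sub>R (x powr a / (1 + x ^ p)))
         \<le> norm (indicator {0<..1} x *\<^sub>R x powr a + indicator {1..} x *\<^sub>R x powr (a - real p))"
      proof (cases "x > 0")
        case True
        have "x powr a / (1 + x ^ p) \<le> x powr a / 1"
          using True by (intro divide_left_mono) (auto simp: add_pos_pos)
        moreover have "x powr a / (1 + x ^ p) \<le> x powr a / x ^ p"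
          using True by (intro divide_left_mono) (auto simp: add_pos_pos)
        moreover have "x powr (a - real p) = x powr a / x ^ p"
          using True by (simp add: powr_diff powr_realpow)
        moreover have "0 \<le> x powr a / (1 + x ^ p)" using True by simp
        ultimately show ?thesis using True by (simp add: indicator_def)
      qed (auto simp: indicator_def)
    qed
  qed measurable
qed

text \<open>Euler's Beta integral: replace \<open>1 / (1 + s)\<close> by the integral of
  \<open>exp (- b * (1 + s))\<close> over \<open>b > 0\<close> and integrate in \<open>s\<close>
  first. The two bounds on \<open>Re h\<close> are integrability at \<open>0\<close> and at
  infinity.\<close>

lemma Gamma_product_integral:
  fixes h :: complex
  assumes h: "-1/2 < Re h" "Re h < 1/2"
  shows "has_bochner_integral lborel
           (\<lambda>s. indicator {0<..} s *\<^sub>R (of_real s powr (h - 1/2) / of_real (1 + s)))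
           (Gamma (1/2 + h) * Gamma (1/2 - h))"
proof -
  define I where "I = (indicator {0<..} :: real \<Rightarrow> real)"
  define k where "k = (\<lambda>(s, b). (I s * I b) *\<^sub>R (complex_of_real s powr (h - 1/2) * of_real (exp (- b * (1 + s)))))"
  have [measurable]: "k \<in> borel_measurable (lborel \<Otimes>\<^sub>M lborel)"
    unfolding k_def I_def powr_def by measurable
  have expi: "has_bochner_integral lborel (\<lambda>b. I b *\<^sub>R exp (- b * c)) (1 / c)" if "c > 0" for c :: real
    using has_bochner_integral_I0i_power_exp_m[of 0]
      lborel_has_bochner_integral_real_affine_iff[of c "\<lambda>b. I b *\<^sub>R exp (- b)" 1 0] that
    by (auto simp: I_def indicator_def zero_less_mult_iff mult.commute divide_inverse if_distrib cong: if_cong)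
  have expic: "has_bochner_integral lborel (\<lambda>b. I b *\<^sub>R complex_of_real (exp (- b * c))) (1 / of_real c)" if "c > 0" for c :: real
    using has_bochner_integral_of_real[OF expi[OF that], where 'a = complex]
    by (simp add: scaleR_conv_of_real)
  have inner: "has_bochner_integral lborel (\<lambda>b. k (s, b)) (I s *\<^sub>R (of_real s powr (h - 1/2) / of_real (1 + s)))" for s
  proof (cases "s > 0")
    case True
    have "has_bochner_integral lborel (\<lambda>b. (I s *\<^sub>R of_real s powr (h - 1/2)) * (I b *\<^sub>R complex_of_real (exp (- b * (1 + s)))))
        ((I s *\<^sub>R of_real s powr (h - 1/2)) * (1 / of_real (1 + s)))"
      using True by (intro has_bochner_integral_mult_right expic) auto
    then show ?thesis by (simp add: k_def mult_ac)
  next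
    case False
    then show ?thesis by (simp add: k_def I_def has_bochner_integral_zero)
  qed
  have nk: "norm (k (s, b)) = I s * s powr (Re h - 1/2) * (I b * exp (- b * (1 + s)))" for s b
    by (auto simp: k_def I_def indicator_def norm_mult norm_powr_real_powr)
  have "integrable (lborel \<Otimes>\<^sub>M lborel) k"
  proof (rule lborel_pair.Fubini_integrable)
    have "(\<integral>b. norm (k (s, b)) \<partial>lborel) = I s *\<^sub>R (s powr (Re h - 1/2) / (1 + s))" for s
      using expi[of "1 + s"] by (cases "s > 0") (auto simp: nk has_bochner_integral_iff I_def)
    then show "integrable lborel (\<lambda>s. \<integral>b. norm (k (s, b)) \<partial>lborel)"
      using integrable_powr_div[of "Re h - 1/2" 1] h by (simp add: I_def)
    show "AE s in lborel. integrable lborel (\<lambda>b. k (s, b))"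
      using inner by (auto simp: has_bochner_integral_iff)
  qed measurable
  note k = this
  have outer: "(\<integral>s. k (s, b) \<partial>lborel) = Gamma (1/2 + h) * (I b *\<^sub>R (of_real b powr ((1/2 - h) - 1) * of_real (exp (- b))))" for b
  proof (cases "b > 0")
    case True
    define q where "q = (\<lambda>t. I t *\<^sub>R (of_real t powr (h - 1/2) * complex_of_real (exp (- t))))"
    have "Gamma (1/2 + h) = (\<integral>t. q t \<partial>lborel)"
    proof -
      have eq: "1/2 + h - 1 = h - 1/2" by simp
      show ?thesis using Gamma_lborel[of "1/2 + h", unfolded eq] h
        unfolding has_bochner_integral_iff I_def q_def by simp
    qed
    also have "\<dots> = b *\<^sub>R (\<integral>s. q (b * s) \<partial>lborel)"
      using lborel_integral_real_affine[of b q 0] True by simp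
    finally have G: "Gamma (1/2 + h) = b *\<^sub>R (\<integral>s. q (b * s) \<partial>lborel)" .
    \<comment> \<open>Powers of \<open>b\<close> in the substitution \<open>t = b * s\<close>: one
      from the Jacobian, one from \<open>t powr (h - 1/2)\<close>, and the power that must stand in
      front to cancel them.\<close>
    have pw: "of_real b * (of_real b powr (h - 1/2) * of_real b powr (- h - 1/2)) = (1 :: complex)"
    proof -
      have "of_real b powr (h - 1/2) * of_real b powr (- h - 1/2) = (of_real b powr (- 1) :: complex)"
        by (subst powr_add[symmetric]) simp
      then show ?thesis using True by (simp add: powr_minus powr_one')
    qed
    have "k (s, b) = of_real b * (of_real b powr (- h - 1/2) * of_real (exp (- b))) * q (b * s)" for s
    proof (cases "s > 0")
      case s: True
      have "complex_of_real (b * s) powr (h - 1/2) = of_real b powr (h - 1/2) * of_real s powr (h - 1/2)"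
        using True s by (simp add: powr_times_real)
      moreover have "exp (- b * (1 + s)) = exp (- b) * exp (- (b * s))"
        by (simp add: exp_add[symmetric] algebra_simps)
      ultimately have "of_real b * (of_real b powr (- h - 1/2) * of_real (exp (- b))) * q (b * s)
          = (of_real b * (of_real b powr (h - 1/2) * of_real b powr (- h - 1/2))) * k (s, b)"
        using True s by (simp add: k_def q_def I_def mult_ac)
      then show ?thesis unfolding pw by simp
    qed (use True in \<open>auto simp: k_def q_def I_def zero_less_mult_iff\<close>)
    then have "(\<integral>s. k (s, b) \<partial>lborel) = (of_real b powr (- h - 1/2) * of_real (exp (- b))) * (b *\<^sub>R (\<integral>s. q (b * s) \<partial>lborel))"
      by (simp add: scaleR_conv_of_real mult_ac)
    also have "- h - 1/2 = (1/2 - h) - 1" by simp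
    finally show ?thesis using True by (simp add: G I_def mult_ac scaleR_conv_of_real)
  qed (simp add: k_def I_def)
  have "(\<integral>s. I s *\<^sub>R (of_real s powr (h - 1/2) / of_real (1 + s)) \<partial>lborel) = (\<integral>s. \<integral>b. k (s, b) \<partial>lborel \<partial>lborel)"
    using inner by (simp add: has_bochner_integral_iff)
  also have "\<dots> = (\<integral>b. \<integral>s. k (s, b) \<partial>lborel \<partial>lborel)"
    using lborel_pair.Fubini_integral[of "\<lambda>s b. k (s, b)"] k by simp
  also have "\<dots> = Gamma (1/2 + h) * Gamma (1/2 - h)"
    unfolding outer integral_mult_right_zero using Gamma_lborel[of "1/2 - h"] h
    by (simp add: has_bochner_integral_iff I_def)
  finally have v: "(\<integral>s. I s *\<^sub>R (of_real s powr (h - 1/2) / of_real (1 + s)) \<partial>lborel) = Gamma (1/2 + h) * Gamma (1/2 - h)" .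
  have "integrable lborel (\<lambda>s. \<integral>b. k (s, b) \<partial>lborel)"
    using lborel_pair.integrable_fst'[OF k] by simp
  then have "integrable lborel (\<lambda>s. I s *\<^sub>R (of_real s powr (h - 1/2) / of_real (1 + s)))"
    using inner by (simp add: has_bochner_integral_iff)
  with v show ?thesis by (simp add: has_bochner_integral_iff I_def)
qed


text \<open>Substituting \<open>s = x\<^sup>2\<close> gives a Beta integral, evaluated by the reflection formula for \<open>Gamma\<close>.\<close>

lemma abs_moment_inverse_square:
  fixes h :: complex
  assumes h: "-1/2 < Re h" "Re h < 1/2"
  shows "has_bochner_integral lborel (\<lambda>x. of_real \<bar>x\<bar> powr (2 * h) / (1 + of_real x ^ 2)) (of_real pi / cos (of_real pi * h))"
proof -
  define f where "f = (\<lambda>s. complex_of_real s powr (h - 1/2) / of_real (1 + s))"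
  define g where "g = (\<lambda>x. complex_of_real \<bar>x\<bar> powr (2 * h) / (1 + of_real x ^ 2))"
  have ein: "einterval 0 \<infinity> = {0<..}" by (auto simp: einterval_def zero_ereal_def)
  have nz: "1 + (complex_of_real s)\<^sup>2 \<noteq> 0" for s
  proof -
    have "1 + s\<^sup>2 > 0" by (simp add: add_pos_nonneg)
    then have "complex_of_real (1 + s\<^sup>2) \<noteq> 0" by (metis less_irrefl of_real_eq_0_iff)
    then show ?thesis by simp
  qed
  have fg: "(2 * x) *\<^sub>R f (x\<^sup>2) = 2 * g x" if "x > 0" for x
  proof -
    have "complex_of_real (x\<^sup>2) powr (h - 1/2) = exp (2 * h * of_real (ln x)) / of_real x"
      using that by (simp add: powr_def ln_realpow Ln_of_real exp_diff algebra_simps flip: of_real_power)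
         (simp add: exp_of_real that)
    also have "exp (2 * h * of_real (ln x)) = of_real x powr (2 * h)"
      using that by (simp add: powr_def Ln_of_real)
    finally show ?thesis using that by (simp add: f_def g_def scaleR_conv_of_real)
  qed
  have gi: "integrable lborel (\<lambda>x. indicator {0<..} x *\<^sub>R g x)"
  proof (rule Bochner_Integration.integrable_bound)
    show "integrable lborel (\<lambda>x. indicator {0<..} x *\<^sub>R (x powr (2 * Re h) / (1 + x ^ 2)))"
      using h by (intro integrable_powr_div) auto
    have "cmod (1 + (of_real x)\<^sup>2) = 1 + x\<^sup>2" for x
      by (metis abs_of_nonneg norm_of_real of_real_1 of_real_add of_real_power zero_le_one zero_le_power2 add_nonneg_nonneg)
    then show "AE x in lborel. norm (indicator {0<..} x *\<^sub>R g x) \<le> norm (indicator {0<..} x *\<^sub>R (x powr (2 * Re h) / (1 + x ^ 2)))"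
      by (intro AE_I2) (auto simp: g_def indicator_def norm_divide norm_powr_real_powr)
  qed (unfold g_def powr_def, measurable)
  have "(LBINT s=0..\<infinity>. f s) = (LBINT x=0..\<infinity>. (2 * x) *\<^sub>R f (x\<^sup>2))"
  proof (rule interval_integral_substitution_integrable)
    show "set_integrable lborel (einterval 0 \<infinity>) f"
      using Gamma_product_integral[OF h] by (simp add: f_def ein set_integrable_def has_bochner_integral_iff)
    have "integrable lborel (\<lambda>x. 2 * (indicator {0<..} x *\<^sub>R g x))"
      using gi by (intro integrable_mult_right)
    also have "(\<lambda>x. 2 * (indicator {0<..} x *\<^sub>R g x)) = (\<lambda>x. indicator {0<..} x *\<^sub>R ((2 * x) *\<^sub>R f (x\<^sup>2)))"
      by (rule ext) (auto simp: indicator_def fg simp del: scaleR_scaleR)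
    finally show "set_integrable lborel (einterval 0 \<infinity>) (\<lambda>x. (2 * x) *\<^sub>R f (x\<^sup>2))"
      unfolding set_integrable_def ein .
    have "((\<lambda>x::real. x\<^sup>2) \<longlongrightarrow> 0) (at_right 0)"
      by (auto intro!: tendsto_eq_intros)
    then show "((ereal \<circ> power2 \<circ> real_of_ereal) \<longlongrightarrow> 0) (at_right 0)"
      by (simp add: zero_ereal_def ereal_tendsto_simps1 o_assoc[symmetric] del: ereal_eq_0) (simp add: o_def)
    have "filterlim (\<lambda>x::real. x\<^sup>2) at_top at_top" by real_asymp
    then have "((\<lambda>x::real. ereal (x\<^sup>2)) \<longlongrightarrow> \<infinity>) at_top"
      by (simp add: tendsto_PInfty_eq_at_top)
    then show "((ereal \<circ> power2 \<circ> real_of_ereal) \<longlongrightarrow> \<infinity>) (at_left \<infinity>)"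
      by (simp add: ereal_tendsto_simps1) (simp add: o_def)
  qed (use f_def nz in \<open>auto simp: zero_ereal_def intro!: derivative_eq_intros continuous_intros
         simp: complex_nonpos_Reals_iff add_pos_nonneg simp del: ereal_eq_0\<close>)
  then have "(\<integral>s. indicator {0<..} s *\<^sub>R f s \<partial>lborel) = (\<integral>x. indicator {0<..} x *\<^sub>R ((2 * x) *\<^sub>R f (x\<^sup>2)) \<partial>lborel)"
    by (simp add: interval_lebesgue_integral_def ein set_lebesgue_integral_def zero_ereal_def)
  also have "(\<lambda>x. indicator {0<..} x *\<^sub>R ((2 * x) *\<^sub>R f (x\<^sup>2))) = (\<lambda>x. 2 * (indicator {0<..} x *\<^sub>R g x))"
    by (rule ext) (auto simp: indicator_def fg simp del: scaleR_scaleR)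
  finally have "(\<integral>x. 2 * (indicator {0<..} x *\<^sub>R g x) \<partial>lborel) = Gamma (1/2 + h) * Gamma (1/2 - h)"
    using Gamma_product_integral[OF h] by (simp add: has_bochner_integral_iff f_def)
  then have "2 * (\<integral>x. indicator {0<..} x *\<^sub>R g x \<partial>lborel) = Gamma (1/2 + h) * Gamma (1/2 - h)"
    unfolding integral_mult_right_zero .
  also have "\<dots> = of_real pi / cos (of_real pi * h)"
  proof -
    have "Gamma (1/2 + h) * Gamma (1 - (1/2 + h)) = of_real pi / sin (of_real pi * (1/2 + h))"
      by (rule Gamma_reflection_complex)
    moreover have "sin (of_real pi * (1/2 + h)) = cos (of_real pi * h)"
      using sin_cos_eq[of "of_real pi * (1/2 + h)"] by (simp add: algebra_simps)
    moreover have "1 - (1/2 + h) = 1/2 - h" by simp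
    ultimately show ?thesis by metis
  qed
  finally have half: "2 * (\<integral>x. indicator {0<..} x *\<^sub>R g x \<partial>lborel) = of_real pi / cos (of_real pi * h)" .
  have "(\<integral>x. indicator {0<..} x *\<^sub>R g x \<partial>lborel) = of_real pi / cos (of_real pi * h) / 2"
    unfolding half[symmetric] by (rule nonzero_mult_div_cancel_left[symmetric]) simp
  with gi have pos: "has_bochner_integral lborel (\<lambda>x. indicator {0<..} x *\<^sub>R g x) (of_real pi / cos (of_real pi * h) / 2)"
    unfolding has_bochner_integral_iff by blast
  have neg: "has_bochner_integral lborel (\<lambda>x. indicator {0<..} (- x) *\<^sub>R g (- x)) (of_real pi / cos (of_real pi * h) / 2)"
    using pos lborel_has_bochner_integral_real_affine_iff[of "-1" "\<lambda>x. indicator {0<..} x *\<^sub>R g x" _ 0] by simp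
  have "has_bochner_integral lborel (\<lambda>x. indicator {0<..} x *\<^sub>R g x + indicator {0<..} (- x) *\<^sub>R g (- x)) (of_real pi / cos (of_real pi * h) / 2 + of_real pi / cos (of_real pi * h) / 2)"
    by (rule has_bochner_integral_add[OF pos neg])
  also have "(\<lambda>x. indicator {0<..} x *\<^sub>R g x + indicator {0<..} (- x) *\<^sub>R g (- x)) = g"
    by (rule ext) (auto simp: g_def indicator_def)
  finally show ?thesis by (simp add: g_def)
qed

text \<open>Used twice, for the rotations of a spectrum and for the horizontal sides of the
  rectangle. Continuity in \<open>a\<close> supplies joint measurability, and the constant
  \<open>B\<close> integrability on a bounded interval.\<close>

lemma Fubini_bounded_Caratheodory:
  fixes f :: "real \<Rightarrow> 'a \<Rightarrow> complex"
  assumes M: "prob_space M"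
    and meas: "\<And>a. f a \<in> borel_measurable M"
    and cont: "\<And>\<omega>. \<omega> \<in> space M \<Longrightarrow> continuous_on UNIV (\<lambda>a. f a \<omega>)"
    and bound: "\<And>a \<omega>. \<omega> \<in> space M \<Longrightarrow> norm (f a \<omega>) \<le> B"
  shows "(\<integral>\<omega>. (LINT a:{0..L}|lborel. f a \<omega>) \<partial>M) = (LINT a:{0..L}|lborel. (\<integral>\<omega>. f a \<omega> \<partial>M))"
    and "(\<lambda>\<omega>. LINT a:{0..L}|lborel. f a \<omega>) \<in> borel_measurable M"
    and "set_integrable lborel {0..L} (\<lambda>a. \<integral>\<omega>. f a \<omega> \<partial>M)"
proof -
  interpret prob_space M by fact
  interpret pair_sigma_finite lborel M ..
  define g where "g = (\<lambda>(a, \<omega>). indicator {0..L} a *\<^sub>R f a \<omega>)"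
  have [measurable]: "(\<lambda>(a, \<omega>). f a \<omega>) \<in> borel_measurable (lborel \<Otimes>\<^sub>M M)"
    using borel_measurable_Caratheodory[OF meas cont] by simp
  have g [measurable]: "g \<in> borel_measurable (lborel \<Otimes>\<^sub>M M)"
    unfolding g_def by measurable
  have "integrable (lborel \<Otimes>\<^sub>M M) g"
  proof (rule Bochner_Integration.integrable_bound)
    show "integrable (lborel \<Otimes>\<^sub>M M) (\<lambda>(a, \<omega>). indicator {0..L} a * B)"
    proof (rule Fubini_integrable)
      have "integrable lborel (indicator {0..L} :: real \<Rightarrow> real)"
        by (simp add: integrable_indicator_iff emeasure_lborel_Icc_eq)
      then show "integrable lborel (\<lambda>a. \<integral>\<omega>. norm (case (a, \<omega>) of (a, \<omega>) \<Rightarrow> indicator {0..L} a * B) \<partial>M)"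
        by (simp add: prob_space abs_mult)
    qed auto
    show "AE p in lborel \<Otimes>\<^sub>M M. norm (g p) \<le> norm (case p of (a, \<omega>) \<Rightarrow> indicator {0..L} a * B)"
      using bound by (intro AE_I2) (auto simp: g_def space_pair_measure indicator_def intro: order_trans[OF _ abs_ge_self])
  qed measurable
  note i = this
  show "(\<integral>\<omega>. (LINT a:{0..L}|lborel. f a \<omega>) \<partial>M) = (LINT a:{0..L}|lborel. (\<integral>\<omega>. f a \<omega> \<partial>M))"
    using Fubini_integral[of "\<lambda>a \<omega>. g (a, \<omega>)"] i by (simp add: g_def set_lebesgue_integral_def)
  show "(\<lambda>\<omega>. LINT a:{0..L}|lborel. f a \<omega>) \<in> borel_measurable M"
    using borel_measurable_integrable[OF integrable_snd[of "\<lambda>a \<omega>. g (a, \<omega>)"]] i by (simp add: g_def set_lebesgue_integral_def)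
  show "set_integrable lborel {0..L} (\<lambda>a. \<integral>\<omega>. f a \<omega> \<partial>M)"
    using integrable_fst[of "\<lambda>a \<omega>. g (a, \<omega>)"] i by (simp add: g_def set_integrable_def)
qed

subsection \<open>Herglotz functions and Haar measure\<close>

lemma circle_mean_value:
  fixes h :: "complex \<Rightarrow> complex"
  assumes hol: "h holomorphic_on ball 0 1" and r: "0 < r" "r < 1"
  shows "(LINT a:{0..1}|lborel. h (of_real r * exp (2 * of_real pi * \<i> * of_real a))) = h 0"
proof -
  let ?h = "\<lambda>a. h (of_real r * exp (2 * of_real pi * \<i> * of_real a))"
  have hol': "h holomorphic_on cball 0 r"
    using r by (intro holomorphic_on_subset[OF hol]) auto
  have "((\<lambda>u. h u / (u - 0)) has_contour_integral (2 * of_real pi * \<i> * h 0)) (circlepath 0 r)"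
    by (rule Cauchy_integral_circlepath_simple[OF hol']) (use r in auto)
  then have "((\<lambda>a. h (circlepath 0 r a) / circlepath 0 r a * (2 * pi * \<i> * r * exp (2 * of_real pi * \<i> * a)))
       has_integral (2 * of_real pi * \<i> * h 0)) {0..1}"
    unfolding has_contour_integral_def
    by (elim has_integral_eq[rotated]) (simp add: vector_derivative_circlepath01)
  then have "((\<lambda>a. (2 * of_real pi * \<i>) * ?h a) has_integral (2 * of_real pi * \<i>) * h 0) {0..1}"
    using r by (elim has_integral_eq[rotated]) (simp add: circlepath)
  then have 1: "(?h has_integral h 0) {0..1}"
    using has_integral_mult_right[of "\<lambda>a. (2 * of_real pi * \<i>) * ?h a" "(2 * of_real pi * \<i>) * h 0" "{0..1}" "1 / (2 * of_real pi * \<i>)"]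
    by simp
  have "continuous_on {0..1} ?h"
    by (rule continuous_on_compose2[OF holomorphic_on_imp_continuous_on[OF hol']])
       (use r in \<open>auto intro!: continuous_intros simp: norm_mult\<close>)
  then have "set_integrable lborel {0..1} ?h"
    by (intro borel_integrable_atLeastAtMost') 
  then show ?thesis
    using set_borel_integral_eq_integral(2)[of "{0..1}" ?h] integral_unique[OF 1] by simp
qed

section \<open>Herglotz functions of finite subsets of the unit circle\<close>

definition reciprocal_poly :: "complex list \<Rightarrow> complex \<Rightarrow> complex" where
  "reciprocal_poly ws z = (\<Prod>w\<leftarrow>ws. 1 - z * w)"

text \<open>The mean of \<open>(1 + w z) / (1 - w z)\<close>, written through a logarithmic
  derivative. For a matrix this depends on the characteristic polynomial alone: no ordering of the
  eigenvalues has to be chosen, and measurability reduces to that of a determinant and its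
  derivative. At a zero of \<open>reciprocal_poly\<close> division by zero gives the value
  \<open>1\<close>.\<close>

definition herglotz :: "complex list \<Rightarrow> complex \<Rightarrow> complex" where
  "herglotz ws z = 1 - 2 / of_nat (length ws) * (z * deriv (reciprocal_poly ws) z / reciprocal_poly ws z)"

lemma reciprocal_poly_simps [simp]:
  "reciprocal_poly [] z = 1" "reciprocal_poly (w # ws) z = (1 - z * w) * reciprocal_poly ws z"
  by (simp_all add: reciprocal_poly_def)

lemma Re_sum_list: "Re (\<Sum>w\<leftarrow>ws. f w) = (\<Sum>w\<leftarrow>ws. Re (f w))"
  by (induction ws) auto

lemma reciprocal_poly_eq_0_iff: "reciprocal_poly ws z = 0 \<longleftrightarrow> (\<exists>w\<in>set ws. z * w = 1)"
  by (induction ws) auto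

lemma holomorphic_reciprocal_poly: "reciprocal_poly ws holomorphic_on A"
proof -
  have "(\<lambda>z. reciprocal_poly ws z) holomorphic_on A"
    by (induction ws) (auto intro!: holomorphic_intros)
  then show ?thesis by simp
qed

lemma has_field_derivative_reciprocal_poly:
  assumes "reciprocal_poly ws z \<noteq> 0"
  shows "(reciprocal_poly ws has_field_derivative (reciprocal_poly ws z * (\<Sum>w\<leftarrow>ws. - w / (1 - z * w)))) (at z)"
  using assms
proof (induction ws)
  case Nil
  then show ?case by (simp add: reciprocal_poly_def[abs_def])
next
  case (Cons w ws)
  have eq: "reciprocal_poly (w # ws) = (\<lambda>z. (1 - z * w) * reciprocal_poly ws z)" by auto
  show ?case
    unfolding eq using Cons by (auto intro!: derivative_eq_intros simp: field_simps)
qed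

lemma herglotz_eq:
  assumes "reciprocal_poly ws z \<noteq> 0" "ws \<noteq> []"
  shows "herglotz ws z = (\<Sum>w\<leftarrow>ws. (1 + z * w) / (1 - z * w)) / of_nat (length ws)"
proof -
  have "(\<Sum>w\<leftarrow>ws. (1 + z * w) / (1 - z * w)) = (\<Sum>w\<leftarrow>ws. 1 - 2 * z * (- w / (1 - z * w)))"
    using assms(1) by (intro arg_cong[of _ _ sum_list] map_cong refl) (auto simp: reciprocal_poly_eq_0_iff field_simps)
  also have "\<dots> = of_nat (length ws) - 2 * z * (\<Sum>w\<leftarrow>ws. - w / (1 - z * w))"
  proof -
    have "(\<Sum>w\<leftarrow>ws. 1 - c * g w) = of_nat (length ws) - c * (\<Sum>w\<leftarrow>ws. g w)" for c and g :: "complex \<Rightarrow> complex"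
      by (induction ws) (auto simp: algebra_simps)
    then show ?thesis .
  qed
  finally show ?thesis
    using assms DERIV_imp_deriv[OF has_field_derivative_reciprocal_poly[OF assms(1)]]
    by (simp add: herglotz_def diff_divide_distrib)
qed

text \<open>The Poisson kernel. Its numerator is nonnegative in the disc and vanishes on the circle,
  which yields positivity inside and purely imaginary boundary values.\<close>

lemma Re_cayley: "Re ((1 + u) / (1 - u)) = (1 - (norm u)\<^sup>2) / (norm (1 - u))\<^sup>2"
  by (cases "u = 1") (simp_all add: Re_divide cmod_power2, simp add: power2_eq_square algebra_simps)

context
  fixes ws :: "complex list"
  assumes unit: "\<And>w. w \<in> set ws \<Longrightarrow> norm w = 1" and ne: "ws \<noteq> []"
begin

lemma reciprocal_poly_nonzero: "norm z < 1 \<Longrightarrow> reciprocal_poly ws z \<noteq> 0"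
  using unit by (force simp: reciprocal_poly_eq_0_iff dest: arg_cong[of _ _ norm] simp: norm_mult)

lemma Re_herglotz_nonneg:
  assumes "norm z < 1"
  shows "Re (herglotz ws z) \<ge> 0"
proof -
  have "Re (herglotz ws z) = (\<Sum>w\<leftarrow>ws. Re ((1 + z * w) / (1 - z * w))) / of_nat (length ws)"
    by (simp add: herglotz_eq[OF reciprocal_poly_nonzero[OF assms] ne] Re_sum_list o_def Re_divide_of_nat)
  moreover have "0 \<le> (\<Sum>w\<leftarrow>ws. Re ((1 + z * w) / (1 - z * w)))"
    unfolding Re_cayley using unit assms
    by (intro sum_list_nonneg) (auto simp: norm_mult power_le_one intro!: divide_nonneg_nonneg)
  ultimately show ?thesis by simp
qed

lemma herglotz_0: "herglotz ws 0 = 1"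
  by (simp add: herglotz_def)

lemma holomorphic_herglotz: "herglotz ws holomorphic_on ball 0 1"
  unfolding herglotz_def [abs_def]
  by (intro holomorphic_intros holomorphic_reciprocal_poly holomorphic_deriv)
     (use reciprocal_poly_nonzero in auto)

lemma herglotz_mean:
  assumes "0 < r" "r < 1"
  shows "(LINT a:{0..1}|lborel. exp (- of_real t * herglotz ws (of_real r * exp (2 * of_real pi * \<i> * of_real a)))) = exp (- of_real t)"
  using circle_mean_value[OF _ assms, of "\<lambda>z. exp (- of_real t * herglotz ws z)"]
  by (simp add: herglotz_0 holomorphic_intros holomorphic_herglotz)

lemma Re_herglotz_1:
  assumes "reciprocal_poly ws 1 \<noteq> 0"
  shows "Re (herglotz ws 1) = 0"
proof -
  have "Re (herglotz ws 1) = (\<Sum>w\<leftarrow>ws. Re ((1 + w) / (1 - w))) / of_nat (length ws)"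
    by (simp add: herglotz_eq[OF assms ne] Re_sum_list o_def Re_divide_of_nat)
  also have "(\<Sum>w\<leftarrow>ws. Re ((1 + w) / (1 - w))) = (\<Sum>w\<leftarrow>ws. 0)"
    unfolding Re_cayley using unit by (intro arg_cong[of _ _ sum_list] map_cong) auto
  finally show ?thesis by simp
qed

lemma tendsto_herglotz_1:
  assumes "reciprocal_poly ws 1 \<noteq> 0"
  shows "((\<lambda>r. herglotz ws (of_real r)) \<longlongrightarrow> herglotz ws 1) (at_left 1)"
proof -
  have "isCont (deriv (reciprocal_poly ws)) 1" "isCont (reciprocal_poly ws) 1"
    using holomorphic_reciprocal_poly[of ws UNIV] holomorphic_deriv[OF holomorphic_reciprocal_poly[of ws UNIV]]
    by (auto intro!: continuous_on_interior[of UNIV] holomorphic_on_imp_continuous_on)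
  then have "isCont (herglotz ws) 1"
    unfolding herglotz_def [abs_def] using assms ne by (auto intro!: continuous_intros)
  moreover have "((\<lambda>r. complex_of_real r) \<longlongrightarrow> 1) (at_left 1)"
    by (auto intro!: tendsto_eq_intros)
  ultimately show ?thesis by (rule isCont_tendsto_compose)
qed

text \<open>If \<open>1\<close> is an eigenvalue, the real part tends to infinity radially, so such matrices drop out below.\<close>

lemma tendsto_exp_herglotz_pole:
  assumes "reciprocal_poly ws 1 = 0" and t: "t > 0"
  shows "((\<lambda>r. exp (- of_real t * herglotz ws (of_real r))) \<longlongrightarrow> 0) (at_left 1)"
proof (rule Lim_null_comparison)
  let ?n = "real (length ws)"
  have n: "?n > 0" using ne by simp
  have "eventually (\<lambda>r. r \<in> {0<..<1::real}) (at_left 1)"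
    by (rule eventually_at_left_real) simp
  then show "\<forall>\<^sub>F r in at_left 1. norm (exp (- of_real t * herglotz ws (of_real r))) \<le> exp (- t / ?n * ((1 + r) / (1 - r)))"
  proof eventually_elim
    case (elim r)
    have r: "norm (complex_of_real r) < 1" using elim by simp
    have 1: "1 \<in> set ws" using assms by (auto simp: reciprocal_poly_eq_0_iff)
    have "Re (herglotz ws (of_real r)) = (\<Sum>w\<leftarrow>ws. Re ((1 + of_real r * w) / (1 - of_real r * w))) / of_nat (length ws)"
      by (simp add: herglotz_eq[OF reciprocal_poly_nonzero[OF r] ne] Re_sum_list o_def Re_divide_of_nat)
    \<comment> \<open>All summands have nonnegative real part, so the one belonging to the
      eigenvalue \<open>1\<close> is a lower bound; it is real and grows like
      \<open>2 / (1 - r)\<close>.\<close>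
    moreover have "Re ((1 + of_real r * 1) / (1 - of_real r * 1)) \<le> (\<Sum>w\<leftarrow>ws. Re ((1 + of_real r * w) / (1 - of_real r * w)))"
    proof (rule member_le_sum_list)
      show "Re ((1 + of_real r * 1) / (1 - of_real r * 1)) \<in> set (map (\<lambda>w. Re ((1 + of_real r * w) / (1 - of_real r * w))) ws)"
        using 1 by force
      fix x assume "x \<in> set (map (\<lambda>w. Re ((1 + of_real r * w) / (1 - of_real r * w))) ws)"
      then show "0 \<le> x"
        using unit elim unfolding Re_cayley by (auto simp: norm_mult power_le_one intro!: divide_nonneg_nonneg)
    qed
    moreover have "Re ((1 + of_real r * 1) / (1 - of_real r * 1)) = (1 + r) / (1 - r)"
    proof -
      have "(1 + of_real r * 1) / (1 - of_real r * 1) = complex_of_real ((1 + r) / (1 - r))" by simp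
      then show ?thesis by (metis Re_complex_of_real)
    qed
    ultimately have "(1 + r) / (1 - r) \<le> ?n * Re (herglotz ws (of_real r))"
      using n by simp
    then have "(1 + r) / (1 - r) / ?n \<le> Re (herglotz ws (of_real r))"
      using n by (subst pos_divide_le_eq) (auto simp: mult.commute)
    then have "t * ((1 + r) / (1 - r) / ?n) \<le> t * Re (herglotz ws (of_real r))"
      using t by (intro mult_left_mono) auto
    then show ?case by (simp add: mult_ac)
  qed
  have "((\<lambda>r::real. exp (- c * ((1 + r) / (1 - r)))) \<longlongrightarrow> 0) (at_left 1)" if "c > 0" for c :: real
  proof -
    have "filterlim (\<lambda>r::real. (1 + r) / (1 - r)) at_top (at_left 1)" by real_asymp
    then have "filterlim (\<lambda>r::real. c * ((1 + r) / (1 - r))) at_top (at_left 1)"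
      by (rule filterlim_tendsto_pos_mult_at_top[OF tendsto_const that])
    then show ?thesis
      unfolding mult_minus_left by (rule filterlim_compose[OF exp_at_bot filterlim_compose[OF filterlim_uminus_at_bot_at_top]])
  qed
  from this[of "t / ?n"] t n
  show "((\<lambda>r. exp (- t / ?n * ((1 + r) / (1 - r)))) \<longlongrightarrow> 0) (at_left 1)"
    by simp
qed

end

section \<open>Characteristic polynomials of unitary matrices\<close>

definition rev_char :: "complex mat \<Rightarrow> complex \<Rightarrow> complex" where
  "rev_char U z = Determinant.det (1\<^sub>m (dim_row U) - z \<cdot>\<^sub>m U)"

text \<open>For \<open>z \<noteq> 0\<close> the determinant is \<open>z ^ N\<close> times the
  characteristic polynomial at \<open>1 / z\<close>, so each linear factor is reversed; at
  \<open>0\<close> both sides are \<open>1\<close>.\<close>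

lemma rev_char_factorized:
  assumes U: "U \<in> carrier_mat N N" and ws: "char_poly U = (\<Prod>w\<leftarrow>ws. [:- w, 1:])" "length ws = N"
  shows "rev_char U z = reciprocal_poly ws z"
proof (cases "z = 0")
  case True
  have "1\<^sub>m N - 0 \<cdot>\<^sub>m U = 1\<^sub>m N" using U by (intro eq_matI) auto
  moreover have "reciprocal_poly ws 0 = 1" by (induction ws) auto
  ultimately show ?thesis using True U by (simp add: rev_char_def)
next
  case False
  have eq: "1\<^sub>m N - z \<cdot>\<^sub>m U = z \<cdot>\<^sub>m (- (char_matrix U (1 / z)))"
    using U False by (intro eq_matI) (auto simp: char_matrix_def field_simps)
  have "rev_char U z = z ^ N * poly (char_poly U) (1 / z)"
    using U unfolding rev_char_def char_poly_matrix[OF U] carrier_matD(1)[OF U] eq det_smult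
    by (simp add: char_matrix_def)
  also have "\<dots> = reciprocal_poly ws z"
    unfolding ws(1) ws(2)[symmetric] using False by (induction ws) (auto simp: field_simps)
  finally show ?thesis .
qed

lemma index_mat_adjoint:
  fixes U :: "complex mat"
  assumes "U \<in> carrier_mat N N" "i < N" "j < N"
  shows "mat_adjoint U $$ (i, j) = cnj (U $$ (j, i))"
  using assms by (auto simp: mat_adjoint_def mat_of_rows_index)

lemma smult_smult_mat: "a \<cdot>\<^sub>m (b \<cdot>\<^sub>m U) = (a * b) \<cdot>\<^sub>m (U :: complex mat)"
  by (intro eq_matI) auto

text \<open>The definition of \<open>unitary_group\<close> makes the rows orthonormal. A one-sided
  inverse of a square matrix is two-sided, which gives the same for the columns.\<close>

lemma unitary_columns:
  assumes "U \<in> unitary_group N" "j < N" "k < N"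
  shows "(\<Sum>i<N. cnj (U $$ (i, j)) * U $$ (i, k)) = (if j = k then 1 else 0)"
proof -
  have U: "U \<in> carrier_mat N N" and UU: "U * mat_adjoint U = 1\<^sub>m N"
    using assms(1) by (auto simp: unitary_group_def)
  have A: "mat_adjoint U \<in> carrier_mat N N" using U by (auto simp: mat_adjoint_def)
  have "mat_adjoint U * U = 1\<^sub>m N" by (rule mat_mult_left_right_inverse[OF U A UU])
  then have "(mat_adjoint U * U) $$ (j, k) = 1\<^sub>m N $$ (j, k)" by simp
  then show ?thesis
    using U assms(2,3) by (simp add: mat_adjoint_def scalar_prod_def lessThan_atLeast0)
qed

text \<open>Orthonormal columns preserve the length of the eigenvector, while the eigenvalue
  equation multiplies its square by \<open>cnj w * w\<close>.\<close>

lemma unitary_eigenvalue_norm: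
  assumes "U \<in> unitary_group N" "eigenvalue U w"
  shows "norm w = 1"
proof -
  have U: "U \<in> carrier_mat N N" using assms(1) by (auto simp: unitary_group_def)
  obtain v where v: "v \<in> carrier_vec N" "v \<noteq> 0\<^sub>v N" "U *\<^sub>v v = w \<cdot>\<^sub>v v"
    using assms(2) U by (auto simp: eigenvalue_def eigenvector_def)
  define y where "y i = (\<Sum>k<N. U $$ (i, k) * v $ k)" for i
  have y: "y i = w * v $ i" if "i < N" for i
  proof -
    have "(U *\<^sub>v v) $ i = w * v $ i" using v that by simp
    then show ?thesis using U v(1) that by (simp add: y_def scalar_prod_def lessThan_atLeast0)
  qed
  have "(\<Sum>i<N. cnj (y i) * y i) = (\<Sum>i<N. \<Sum>j<N. \<Sum>k<N. (cnj (v $ j) * v $ k) * (cnj (U $$ (i, j)) * U $$ (i, k)))"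
    unfolding y_def cnj_sum sum_product by (intro sum.cong refl) (simp add: mult_ac)
  also have "\<dots> = (\<Sum>j<N. \<Sum>i<N. \<Sum>k<N. (cnj (v $ j) * v $ k) * (cnj (U $$ (i, j)) * U $$ (i, k)))"
    by (rule sum.swap)
  also have "\<dots> = (\<Sum>j<N. \<Sum>k<N. \<Sum>i<N. (cnj (v $ j) * v $ k) * (cnj (U $$ (i, j)) * U $$ (i, k)))"
    by (intro sum.cong refl sum.swap)
  also have "\<dots> = (\<Sum>j<N. \<Sum>k<N. (cnj (v $ j) * v $ k) * (if j = k then 1 else 0))"
    using unitary_columns[OF assms(1)] by (intro sum.cong refl) (simp add: sum_distrib_left[symmetric])
  also have "\<dots> = (\<Sum>j<N. cnj (v $ j) * v $ j)"
    by (intro sum.cong refl) (simp add: if_distrib cong: if_cong)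
  finally have 1: "(\<Sum>i<N. cnj (y i) * y i) = (\<Sum>j<N. cnj (v $ j) * v $ j)" .
  have "(\<Sum>i<N. cnj (y i) * y i) = cnj w * w * (\<Sum>j<N. cnj (v $ j) * v $ j)"
    unfolding sum_distrib_left using y by (intro sum.cong) (auto simp: mult_ac)
  moreover have "(\<Sum>j<N. cnj (v $ j) * v $ j) \<noteq> 0"
  proof
    assume "(\<Sum>j<N. cnj (v $ j) * v $ j) = 0"
    then have "complex_of_real (\<Sum>j<N. (norm (v $ j))\<^sup>2) = 0"
      by (simp add: complex_norm_square mult.commute del: of_real_power)
    then have "(\<Sum>j<N. (norm (v $ j))\<^sup>2) = 0" by (metis of_real_eq_0_iff)
    then have "\<forall>j<N. v $ j = 0" by (subst (asm) sum_nonneg_eq_0_iff) auto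
    then have "v = 0\<^sub>v N" using v(1) by (intro eq_vecI) auto
    with v(2) show False by simp
  qed
  ultimately have "cnj w * w = 1" using 1 by simp
  then have "complex_of_real ((norm w)\<^sup>2) = 1" by (simp add: complex_norm_square mult.commute del: of_real_power)
  then have "(norm w)\<^sup>2 = 1" by (metis of_real_eq_1_iff)
  then show ?thesis using real_sqrt_abs[of "norm w"] by simp
qed

lemma unitary_rev_char:
  assumes U: "U \<in> unitary_group N"
  obtains ws where "length ws = N" "\<And>w. w \<in> set ws \<Longrightarrow> norm w = 1" "rev_char U = reciprocal_poly ws"
proof -
  have C: "U \<in> carrier_mat N N" using U by (auto simp: unitary_group_def)
  obtain ws where ws: "char_poly U = (\<Prod>w\<leftarrow>ws. [:- w, 1:])" "length ws = N"
    using char_poly_factorized[OF C] by blast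
  have "norm w = 1" if "w \<in> set ws" for w
  proof (rule unitary_eigenvalue_norm[OF U])
    have "poly (char_poly U) w = 0"
      unfolding ws(1) using that by (induction ws) auto
    then show "eigenvalue U w" using eigenvalue_root_char_poly[OF C] by simp
  qed
  moreover have "rev_char U = reciprocal_poly ws"
    using rev_char_factorized[OF C ws] by auto
  ultimately show thesis using that ws(2) by blast
qed

lemma unitary_group_smult:
  assumes "U \<in> unitary_group N" "norm c = 1"
  shows "c \<cdot>\<^sub>m U \<in> unitary_group N"
proof -
  have U: "U \<in> carrier_mat N N" and UU: "U * mat_adjoint U = 1\<^sub>m N"
    using assms(1) by (auto simp: unitary_group_def)
  have A: "mat_adjoint U \<in> carrier_mat N N" using U by (auto simp: mat_adjoint_def)
  have "mat_adjoint (c \<cdot>\<^sub>m U) = cnj c \<cdot>\<^sub>m mat_adjoint U"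
  proof (rule eq_matI)
    fix i j assume "i < dim_row (cnj c \<cdot>\<^sub>m mat_adjoint U)" "j < dim_col (cnj c \<cdot>\<^sub>m mat_adjoint U)"
    then have "i < N" "j < N" using A by auto
    then show "mat_adjoint (c \<cdot>\<^sub>m U) $$ (i, j) = (cnj c \<cdot>\<^sub>m mat_adjoint U) $$ (i, j)"
      using U A index_mat_adjoint[OF U] index_mat_adjoint[OF smult_carrier_mat[OF U]] by simp
  qed (simp_all add: mat_adjoint_def)
  then have "(c \<cdot>\<^sub>m U) * mat_adjoint (c \<cdot>\<^sub>m U) = (c * cnj c) \<cdot>\<^sub>m (U * mat_adjoint U)"
    using mult_smult_assoc_mat[OF U smult_carrier_mat[OF A, of "cnj c"], of c] mult_smult_distrib[OF U A, of "cnj c"]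
    by (simp add: smult_smult_mat)
  moreover have "c * cnj c = 1" using assms(2) by (simp add: complex_norm_square[symmetric])
  ultimately have "(c \<cdot>\<^sub>m U) * mat_adjoint (c \<cdot>\<^sub>m U) = 1\<^sub>m N" using UU by (simp, intro eq_matI, auto)
  then show ?thesis using U by (simp add: unitary_group_def)
qed

lemma rev_char_smult: "rev_char (c \<cdot>\<^sub>m U) z = rev_char U (z * c)"
  by (simp add: rev_char_def smult_smult_mat)

definition matrix_herglotz :: "complex mat \<Rightarrow> complex \<Rightarrow> complex" where
  "matrix_herglotz U z = 1 - 2 / of_nat (dim_row U) * (z * deriv (rev_char U) z / rev_char U z)"

lemma matrix_herglotz_eq:
  "dim_row U = length ws \<Longrightarrow> rev_char U = reciprocal_poly ws \<Longrightarrow> matrix_herglotz U z = herglotz ws z"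
  by (simp add: matrix_herglotz_def herglotz_def)

text \<open>A scalar factor acts as a rotation of the argument. Through this identity the invariance
  of Haar measure becomes invariance under the rotations over which the mean value property
  averages.\<close>

lemma matrix_herglotz_smult:
  assumes "U \<in> unitary_group N"
  shows "matrix_herglotz (c \<cdot>\<^sub>m U) z = matrix_herglotz U (z * c)"
proof -
  obtain ws where ws: "rev_char U = reciprocal_poly ws" using unitary_rev_char[OF assms] by blast
  have "(rev_char U has_field_derivative deriv (rev_char U) (z * c)) (at (z * c))"
    unfolding ws by (rule holomorphic_derivI[OF holomorphic_reciprocal_poly open_UNIV]) simp
  then have "((\<lambda>z. rev_char U (z * c)) has_field_derivative deriv (rev_char U) (z * c) * c) (at z)"
    by (rule DERIV_chain2) (auto intro!: derivative_eq_intros)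
  then have "deriv (rev_char (c \<cdot>\<^sub>m U)) z = deriv (rev_char U) (z * c) * c"
    unfolding rev_char_smult[abs_def] by (rule DERIV_imp_deriv)
  then show ?thesis by (simp add: matrix_herglotz_def rev_char_smult mult_ac)
qed

section \<open>Measurability on the unitary group\<close>

lemma space_unitary_borel [simp]: "space (unitary_borel N) = unitary_group N"
  by (simp add: unitary_borel_def)

lemma measurable_entry:
  assumes "i < N" "j < N"
  shows "(\<lambda>U. U $$ (i, j)) \<in> borel_measurable (unitary_borel N)"
proof -
  have "(\<lambda>U. \<lambda>ij\<in>{..<N} \<times> {..<N}. U $$ ij) \<in> measurable (unitary_borel N) (\<Pi>\<^sub>M ij\<in>{..<N} \<times> {..<N}. borel)"
    unfolding unitary_borel_def by (rule measurable_vimage_algebra1) (auto simp: space_PiM)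
  from measurable_compose[OF this measurable_component_singleton[of "(i, j)"]]
  show ?thesis using assms by simp
qed

lemma measurable_smult_unitary:
  assumes "norm c = 1"
  shows "(\<lambda>U. c \<cdot>\<^sub>m U) \<in> measurable (unitary_borel N) (unitary_borel N)"
proof -
  have "(\<lambda>U. \<lambda>ij\<in>{..<N} \<times> {..<N}. (c \<cdot>\<^sub>m U) $$ ij) \<in> measurable (unitary_borel N) (\<Pi>\<^sub>M ij\<in>{..<N} \<times> {..<N}. borel)"
  proof (rule measurable_restrict)
    fix ij assume "ij \<in> {..<N} \<times> {..<N}"
    then obtain i j where ij: "ij = (i, j)" "i < N" "j < N" by auto
    have "(\<lambda>U. c * U $$ (i, j)) \<in> borel_measurable (unitary_borel N)"
      using measurable_entry[OF ij(2,3)] by measurable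
    then show "(\<lambda>U. (c \<cdot>\<^sub>m U) $$ ij) \<in> borel_measurable (unitary_borel N)"
      using ij by (subst measurable_cong[where g = "\<lambda>U. c * U $$ (i, j)"]) (auto simp: unitary_group_def)
  qed
  then show ?thesis
    using unitary_group_smult[OF _ assms]
    by (subst (2) unitary_borel_def) (rule measurable_vimage_algebra2, auto)
qed

lemma measurable_rev_char: "(\<lambda>U. rev_char U z) \<in> borel_measurable (unitary_borel N)"
proof -
  have m: "(\<lambda>U. \<Sum>p\<in>{p. p permutes {0..<N}}. signof p * (\<Prod>i = 0..<N. (if i = p i then 1 else 0) - z * U $$ (i, p i)))
      \<in> borel_measurable (unitary_borel N)"
  proof (intro borel_measurable_sum borel_measurable_times borel_measurable_const borel_measurable_prod borel_measurable_diff)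
    fix p i assume "p \<in> {p. p permutes {0..<N}}" "i \<in> {0..<N}"
    then show "(\<lambda>U. U $$ (i, p i)) \<in> borel_measurable (unitary_borel N)"
      using permutes_in_image[of p "{0..<N}" i] by (intro measurable_entry) auto
  qed
  have "rev_char U z = (\<Sum>p\<in>{p. p permutes {0..<N}}. signof p * (\<Prod>i = 0..<N. (if i = p i then 1 else 0) - z * U $$ (i, p i)))"
    if "U \<in> unitary_group N" for U
  proof -
    have U: "U \<in> carrier_mat N N" using that by (auto simp: unitary_group_def)
    then have "1\<^sub>m N - z \<cdot>\<^sub>m U \<in> carrier_mat N N" by auto
    from det_def'[OF this]
    have "rev_char U z = (\<Sum>p\<in>{p. p permutes {0..<N}}. signof p * (\<Prod>i = 0..<N. (1\<^sub>m N - z \<cdot>\<^sub>m U) $$ (i, p i)))"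
      using U by (simp add: rev_char_def)
    also have "\<dots> = (\<Sum>p\<in>{p. p permutes {0..<N}}. signof p * (\<Prod>i = 0..<N. (if i = p i then 1 else 0) - z * U $$ (i, p i)))"
    proof (intro sum.cong refl arg_cong2[of _ _ _ _ "(*)"] prod.cong)
      fix p i assume "p \<in> {p. p permutes {0..<N}}" "i \<in> {0..<N}"
      then have "i < N" "p i < N" using permutes_in_image[of p "{0..<N}" i] by auto
      then show "(1\<^sub>m N - z \<cdot>\<^sub>m U) $$ (i, p i) = (if i = p i then 1 else 0) - z * U $$ (i, p i)"
        using U by simp
    qed
    finally show ?thesis .
  qed
  then have eq: "rev_char U z = (\<Sum>p\<in>{p. p permutes {0..<N}}. signof p * (\<Prod>i = 0..<N. (if i = p i then 1 else 0) - z * U $$ (i, p i)))"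
    if "U \<in> space (unitary_borel N)" for U using that by simp
  show ?thesis by (rule iffD2[OF measurable_cong[OF eq] m])
qed

text \<open>The complex derivative exists, so difference quotients along one fixed sequence of
  increments converge to it, and each of them is measurable in \<open>U\<close>.\<close>

lemma measurable_deriv_rev_char: "(\<lambda>U. deriv (rev_char U) z) \<in> borel_measurable (unitary_borel N)"
proof (rule borel_measurable_LIMSEQ_metric)
  let ?h = "\<lambda>n. of_real (1 / real (Suc n)) :: complex"
  show "(\<lambda>U. (rev_char U (z + ?h n) - rev_char U z) / ?h n) \<in> borel_measurable (unitary_borel N)" for n
    by (intro borel_measurable_divide borel_measurable_diff measurable_rev_char borel_measurable_const)
  fix U assume "U \<in> space (unitary_borel N)"
  then have "U \<in> unitary_group N" by simp
  then obtain ws where ws: "rev_char U = reciprocal_poly ws" using unitary_rev_char by blast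
  have "(rev_char U has_field_derivative deriv (rev_char U) z) (at z)"
    unfolding ws by (rule holomorphic_derivI[OF holomorphic_reciprocal_poly open_UNIV]) simp
  then have "((\<lambda>h. (rev_char U (z + h) - rev_char U z) / h) \<longlongrightarrow> deriv (rev_char U) z) (at 0)"
    by (simp add: DERIV_def)
  moreover have "filterlim ?h (at 0) sequentially"
    unfolding filterlim_at
  proof
    show "?h \<longlonglongrightarrow> 0"
      using tendsto_of_real[OF LIMSEQ_Suc[OF lim_1_over_n], where 'a = complex] by simp
  qed (auto simp del: of_nat_Suc)
  ultimately show "(\<lambda>n. (rev_char U (z + ?h n) - rev_char U z) / ?h n) \<longlonglongrightarrow> deriv (rev_char U) z"
    by (rule filterlim_compose)
qed

lemma measurable_matrix_herglotz: "(\<lambda>U. matrix_herglotz U z) \<in> borel_measurable (unitary_borel N)"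
proof -
  have "(\<lambda>U. 1 - 2 / of_nat N * (z * deriv (rev_char U) z / rev_char U z)) \<in> borel_measurable (unitary_borel N)"
    by (intro borel_measurable_divide borel_measurable_diff borel_measurable_times
        measurable_rev_char measurable_deriv_rev_char borel_measurable_const)
  then show ?thesis
    by (subst measurable_cong[where g = "\<lambda>U. 1 - 2 / of_nat N * (z * deriv (rev_char U) z / rev_char U z)"])
       (auto simp: matrix_herglotz_def unitary_group_def)
qed

lemma S_fun_eq: "S_fun U \<theta> = rev_char U (exp (- (\<i> * of_real \<theta>)))"
  by (simp add: S_fun_def rev_char_def)

text \<open>The prefactor of \<open>G_fun\<close> has modulus \<open>1\<close> for any real list of
  angles, so nothing about the choice made in \<open>eigenangles\<close> has to be known.
  Differentiating it in \<open>\<theta>\<close> contributes \<open>\<i> * N / 2\<close>, which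
  becomes the summand \<open>1\<close> of \<open>matrix_herglotz\<close>; the logarithmic derivative
  comes from the determinant.\<close>

lemma norm_G_fun_0: "norm (G_fun U 0) = norm (rev_char U 1)"
  and norm_deriv_G_fun_0:
    "U \<in> unitary_group N \<Longrightarrow> N \<ge> 1 \<Longrightarrow> rev_char U 1 \<noteq> 0 \<Longrightarrow>
      norm (vector_derivative (G_fun U) (at 0)) = norm (rev_char U 1) * (real N / 2 * norm (matrix_herglotz U 1))"
proof -
  have "Re (\<Sum>\<phi>\<leftarrow>xs. complex_of_real \<phi> / 2) = (\<Sum>\<phi>\<leftarrow>xs. \<phi>) / 2 \<and> Im (\<Sum>\<phi>\<leftarrow>xs. complex_of_real \<phi> / 2) = 0" for xs
    by (induction xs) auto
  then have n: "norm (exp (\<i> * of_nat (dim_row U) / 2 * (0 + of_real pi) - \<i> * (\<Sum>\<phi>\<leftarrow>eigenangles U. of_real \<phi> / 2))) = 1"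
    by simp
  then show "norm (G_fun U 0) = norm (rev_char U 1)"
    by (simp add: G_fun_def S_fun_eq norm_mult)
  assume U: "U \<in> unitary_group N" and N: "N \<ge> 1" and nz: "rev_char U 1 \<noteq> 0"
  have dim: "dim_row U = N" using U by (auto simp: unitary_group_def)
  obtain ws where ws: "rev_char U = reciprocal_poly ws" using unitary_rev_char[OF U] by blast
  define c where "c = \<i> * (\<Sum>\<phi>\<leftarrow>eigenangles U. of_real \<phi> / 2)"
  define g where "g = (\<lambda>z. exp (\<i> * of_nat N / 2 * (z + of_real pi) - c) * rev_char U (exp (- (\<i> * z))))"
  have G: "G_fun U = (\<lambda>\<theta>. g (of_real \<theta>))"
    by (auto simp: G_fun_def g_def S_fun_eq dim c_def)
  have d: "(rev_char U has_field_derivative deriv (rev_char U) 1) (at 1)"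
    unfolding ws by (rule holomorphic_derivI[OF holomorphic_reciprocal_poly open_UNIV]) simp
  have "((\<lambda>z. rev_char U (exp (- (\<i> * z)))) has_field_derivative deriv (rev_char U) 1 * (- \<i>)) (at 0)"
    by (rule DERIV_chain2[where g = "\<lambda>z. exp (- (\<i> * z))"]) (use d in \<open>auto intro!: derivative_eq_intros\<close>)
  then have "(g has_field_derivative exp (\<i> * of_nat N / 2 * (0 + of_real pi) - c) * (\<i> * of_nat N / 2 * rev_char U 1 + deriv (rev_char U) 1 * (- \<i>))) (at 0)"
    unfolding g_def by (auto intro!: derivative_eq_intros simp: algebra_simps)
  then have "(g has_field_derivative exp (\<i> * of_nat N / 2 * (0 + of_real pi) - c) * (\<i> * of_nat N / 2 * rev_char U 1 + deriv (rev_char U) 1 * (- \<i>))) (at (of_real 0))"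
    by simp
  from has_vector_derivative_real_field[OF this]
  have "vector_derivative (G_fun U) (at 0) = exp (\<i> * of_nat N / 2 * (0 + of_real pi) - c) * (\<i> * of_nat N / 2 * rev_char U 1 + deriv (rev_char U) 1 * (- \<i>))"
    unfolding G by (rule vector_derivative_at)
  also have "\<i> * of_nat N / 2 * rev_char U 1 + deriv (rev_char U) 1 * (- \<i>) = rev_char U 1 * (\<i> * of_nat N / 2 * matrix_herglotz U 1)"
    using nz N by (simp add: matrix_herglotz_def dim field_simps)
  also have "norm (exp (\<i> * of_nat N / 2 * (0 + of_real pi) - c) * \<dots>) = norm (rev_char U 1) * (real N / 2 * norm (matrix_herglotz U 1))"
  proof -
    have "norm (exp (\<i> * of_nat N / 2 * (0 + of_real pi) - c)) = 1"
      using n unfolding c_def dim .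
    then show ?thesis by (simp only: norm_mult norm_divide mult_1) simp
  qed
  finally show "norm (vector_derivative (G_fun U) (at 0)) = norm (rev_char U 1) * (real N / 2 * norm (matrix_herglotz U 1))" .
qed

text \<open>In the application \<open>a\<close> is the modulus of \<open>G_fun U 0\<close>: at
  \<open>s = 0\<close> its power \<open>- 2 * h\<close> cancels the same factor inside the modulus
  of the derivative. The factors \<open>b\<close> and \<open>c\<close> may vanish.\<close>

lemma powr_cancel_factor:
  fixes w :: complex and a b c :: real
  assumes "a > 0" "b \<ge> 0" "c \<ge> 0"
  shows "of_real a powr (- w) * of_real (a * (b * c)) powr w = of_real b powr w * of_real c powr w"
proof -
  have 1: "complex_of_real (a * (b * c)) powr w = of_real a powr w * of_real (b * c) powr w"
    using powr_times_real[of "of_real a" "of_real (b * c)" w] assms by simp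
  have 2: "complex_of_real (b * c) powr w = of_real b powr w * of_real c powr w"
    using powr_times_real[of "of_real b" "of_real c" w] assms by simp
  show ?thesis unfolding 1 2 using assms(1) by (simp add: powr_minus)
qed

section \<open>Expectations under Haar measure\<close>

context
  fixes N :: nat and \<mu> :: "complex mat measure"
  assumes N: "N \<ge> 1" and haar: "unitary_haar N \<mu>"
begin

lemma prob_space_haar: "prob_space \<mu>"
  and sets_haar [measurable_cong]: "sets \<mu> = sets (unitary_borel N)"
  and haar_invariant: "V \<in> unitary_group N \<Longrightarrow> distr \<mu> \<mu> (\<lambda>U. V * U) = \<mu>"
  using haar by (auto simp: unitary_haar_def)

lemma space_haar: "space \<mu> = unitary_group N"
  using sets_eq_imp_space_eq[OF sets_haar] by simp

lemma measurable_haar_eq: "measurable \<mu> = measurable (unitary_borel N)"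
  using sets_haar by (intro ext measurable_cong_sets) auto

lemma measurable_herglotz_haar [measurable]: "(\<lambda>U. matrix_herglotz U z) \<in> borel_measurable \<mu>"
  unfolding measurable_haar_eq by (rule measurable_matrix_herglotz)

lemma distr_haar_smult:
  assumes c: "norm c = 1"
  shows "distr \<mu> \<mu> (\<lambda>U. c \<cdot>\<^sub>m U) = \<mu>"
proof -
  have V: "c \<cdot>\<^sub>m 1\<^sub>m N \<in> unitary_group N"
  proof (rule unitary_group_smult[OF _ c])
    have "mat_adjoint (1\<^sub>m N :: complex mat) = 1\<^sub>m N"
    proof (rule eq_matI)
      fix i j assume "i < dim_row (1\<^sub>m N :: complex mat)" "j < dim_col (1\<^sub>m N :: complex mat)"
      then show "mat_adjoint (1\<^sub>m N) $$ (i, j) = (1\<^sub>m N :: complex mat) $$ (i, j)"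
        using index_mat_adjoint[of "1\<^sub>m N" N i j] by simp
    qed (simp_all add: mat_adjoint_def)
    then show "1\<^sub>m N \<in> unitary_group N" by (simp add: unitary_group_def)
  qed
  have "distr \<mu> \<mu> (\<lambda>U. c \<cdot>\<^sub>m U) = distr \<mu> \<mu> (\<lambda>U. (c \<cdot>\<^sub>m 1\<^sub>m N) * U)"
  proof (rule distr_cong[OF refl refl])
    fix U assume "U \<in> space \<mu>"
    then have "U \<in> carrier_mat N N" by (auto simp: space_haar unitary_group_def)
    then show "c \<cdot>\<^sub>m U = (c \<cdot>\<^sub>m 1\<^sub>m N) * U"
      by (metis left_mult_one_mat mult_smult_assoc_mat one_carrier_mat)
  qed
  then show ?thesis using haar_invariant[OF V] by simp
qed

lemma haar_herglotz_spectrum: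
  assumes "U \<in> space \<mu>"
  obtains ws where "ws \<noteq> []" "\<And>w. w \<in> set ws \<Longrightarrow> norm w = 1" "rev_char U = reciprocal_poly ws"
    "matrix_herglotz U = herglotz ws"
proof -
  have U: "U \<in> unitary_group N" using assms by (simp add: space_haar)
  obtain ws where ws: "length ws = N" "\<And>w. w \<in> set ws \<Longrightarrow> norm w = 1" "rev_char U = reciprocal_poly ws"
    using unitary_rev_char[OF U] by blast
  have "dim_row U = length ws" using U ws(1) by (auto simp: unitary_group_def)
  then have "matrix_herglotz U = herglotz ws" using matrix_herglotz_eq ws(3) by blast
  moreover have "ws \<noteq> []" using ws(1) N by auto
  ultimately show thesis using that ws(2,3) by blast
qed

lemma norm_exp_herglotz_le:
  assumes "U \<in> space \<mu>" "norm z < 1" "t \<ge> 0"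
  shows "norm (exp (- of_real t * matrix_herglotz U z)) \<le> 1"
proof -
  obtain ws where ws: "ws \<noteq> []" "\<And>w. w \<in> set ws \<Longrightarrow> norm w = 1" "matrix_herglotz U = herglotz ws"
    using haar_herglotz_spectrum[OF assms(1)] by blast
  have "Re (herglotz ws z) \<ge> 0" using Re_herglotz_nonneg[OF ws(2,1) assms(2)] by simp
  then show ?thesis using assms(3) by (simp add: ws(3))
qed

text \<open>The expectation is the same at every point of the circle of radius \<open>r\<close>, so
  averaging it over the circle changes nothing. After the integrals are exchanged, the inner average
  is evaluated for each matrix separately and no longer depends on the matrix.\<close>

lemma integral_exp_herglotz:
  assumes r: "0 < r" "r < 1" and t: "t > 0"
  shows "(\<integral>U. exp (- of_real t * matrix_herglotz U (of_real r)) \<partial>\<mu>) = exp (- of_real t)"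
proof -
  interpret prob_space \<mu> by (rule prob_space_haar)
  define e where "e = (\<lambda>a::real. exp (2 * of_real pi * \<i> * of_real a) :: complex)"
  have ne: "norm (e a) = 1" for a by (simp add: e_def)
  have re: "norm (of_real r * e a) < 1" for a using r by (simp add: norm_mult ne)
  define f where "f = (\<lambda>a U. exp (- of_real t * matrix_herglotz U (of_real r * e a)))"
  have fm [measurable]: "f a \<in> borel_measurable \<mu>" for a
    unfolding f_def by measurable
  have inv: "(\<integral>U. f a U \<partial>\<mu>) = (\<integral>U. exp (- of_real t * matrix_herglotz U (of_real r)) \<partial>\<mu>)" for a
  proof -
    have "(\<integral>U. exp (- of_real t * matrix_herglotz U (of_real r)) \<partial>\<mu>)
        = (\<integral>U. exp (- of_real t * matrix_herglotz U (of_real r)) \<partial>(distr \<mu> \<mu> (\<lambda>U. e a \<cdot>\<^sub>m U)))"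
      by (simp add: distr_haar_smult[OF ne])
    also have "\<dots> = (\<integral>U. exp (- of_real t * matrix_herglotz (e a \<cdot>\<^sub>m U) (of_real r)) \<partial>\<mu>)"
    proof (rule integral_distr)
      show "(\<lambda>U. e a \<cdot>\<^sub>m U) \<in> \<mu> \<rightarrow>\<^sub>M \<mu>"
        using measurable_smult_unitary[OF ne] measurable_cong_sets[OF sets_haar sets_haar] by blast
    qed measurable
    also have "\<dots> = (\<integral>U. f a U \<partial>\<mu>)"
    proof (rule Bochner_Integration.integral_cong[OF refl])
      fix U assume "U \<in> space \<mu>"
      then show "exp (- of_real t * matrix_herglotz (e a \<cdot>\<^sub>m U) (of_real r)) = f a U"
        using matrix_herglotz_smult[of U N "e a" "of_real r"] by (simp add: f_def space_haar)
    qed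
    finally show ?thesis by simp
  qed
  have cont: "continuous_on UNIV (\<lambda>a. f a U)" if U: "U \<in> space \<mu>" for U
  proof -
    obtain ws where ws: "ws \<noteq> []" "\<And>w. w \<in> set ws \<Longrightarrow> norm w = 1" "matrix_herglotz U = herglotz ws"
      using haar_herglotz_spectrum[OF U] by blast
    have "continuous_on (ball 0 1) (herglotz ws)"
      using holomorphic_herglotz[OF ws(2,1)] by (intro holomorphic_on_imp_continuous_on) auto
    then have "continuous_on UNIV (\<lambda>a. herglotz ws (of_real r * e a))"
      by (rule continuous_on_compose2) (use re in \<open>auto simp: e_def intro!: continuous_intros\<close>)
    then show ?thesis unfolding f_def ws(3) by (intro continuous_intros)
  qed
  have bound: "norm (f a U) \<le> 1" if "U \<in> space \<mu>" for a U
    unfolding f_def using norm_exp_herglotz_le[OF that re] t by simp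
  have mean: "(LINT a:{0..1}|lborel. f a U) = exp (- of_real t)" if U: "U \<in> space \<mu>" for U
  proof -
    obtain ws where ws: "ws \<noteq> []" "\<And>w. w \<in> set ws \<Longrightarrow> norm w = 1" "matrix_herglotz U = herglotz ws"
      using haar_herglotz_spectrum[OF U] by blast
    show ?thesis unfolding f_def e_def ws(3) using herglotz_mean[OF ws(2,1) r] by simp
  qed
  have "(\<integral>U. (LINT a:{0..1}|lborel. f a U) \<partial>\<mu>) = (LINT a:{0..1}|lborel. (\<integral>U. f a U \<partial>\<mu>))"
    using fm cont bound by (rule Fubini_bounded_Caratheodory(1)[OF prob_space_haar])
  also have "(\<integral>U. (LINT a:{0..1}|lborel. f a U) \<partial>\<mu>) = (\<integral>U. exp (- of_real t) \<partial>\<mu>)"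
    using mean by (intro Bochner_Integration.integral_cong) auto
  also have "\<dots> = exp (- of_real t)" by (simp add: prob_space)
  finally show ?thesis unfolding inv by (simp add: set_lebesgue_integral_def)
qed

definition nonsingular :: "complex mat set" where
  "nonsingular = {U \<in> space \<mu>. rev_char U 1 \<noteq> 0}"

lemma sets_nonsingular [measurable]: "nonsingular \<in> sets \<mu>"
proof -
  have "(\<lambda>U. rev_char U 1) \<in> borel_measurable \<mu>"
    unfolding measurable_haar_eq by (rule measurable_rev_char)
  then show ?thesis unfolding nonsingular_def by measurable
qed

text \<open>Radial limit under the constant bound \<open>1\<close>. Matrices with eigenvalue
  \<open>1\<close> need not be excluded beforehand: the integrand tends to \<open>0\<close> there,
  and this produces the indicator.\<close>

lemma integral_exp_herglotz_1:
  assumes t: "t > 0"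
  shows "(\<integral>U. indicator nonsingular U * exp (- of_real t * matrix_herglotz U 1) \<partial>\<mu>) = exp (- of_real t)"
proof -
  interpret prob_space \<mu> by (rule prob_space_haar)
  \<comment> \<open>The shift by \<open>2\<close> keeps \<open>r 0\<close> strictly
    positive.\<close>
  define r where "r n = 1 - 1 / real (n + 2)" for n
  have r: "0 < r n" "r n < 1" for n by (auto simp: r_def)
  have rt: "filterlim r (at_left 1) sequentially"
  proof -
    have "r \<longlonglongrightarrow> 1" unfolding r_def by real_asymp
    then show ?thesis using r(2) by (auto simp: filterlim_at less_imp_neq)
  qed
  have "(\<lambda>n. \<integral>U. exp (- of_real t * matrix_herglotz U (of_real (r n))) \<partial>\<mu>) \<longlonglongrightarrow>
      (\<integral>U. indicator nonsingular U * exp (- of_real t * matrix_herglotz U 1) \<partial>\<mu>)"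
  proof (rule integral_dominated_convergence)
    show "integrable \<mu> (\<lambda>_. 1 :: real)" by simp
    show "AE U in \<mu>. (\<lambda>n. exp (- of_real t * matrix_herglotz U (of_real (r n)))) \<longlonglongrightarrow>
        indicator nonsingular U * exp (- of_real t * matrix_herglotz U 1)"
    proof (rule AE_I2)
      fix U assume U: "U \<in> space \<mu>"
      obtain ws where ws: "ws \<noteq> []" "\<And>w. w \<in> set ws \<Longrightarrow> norm w = 1" "rev_char U = reciprocal_poly ws" "matrix_herglotz U = herglotz ws"
        using haar_herglotz_spectrum[OF U] by blast
      have "((\<lambda>x. exp (- of_real t * herglotz ws (of_real x))) \<longlongrightarrow> indicator nonsingular U * exp (- of_real t * herglotz ws 1)) (at_left 1)"
      proof (cases "rev_char U 1 = 0")
        case True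
        then show ?thesis
          using tendsto_exp_herglotz_pole[OF ws(2,1) _ t] by (simp add: ws(3) nonsingular_def)
      next
        case False
        then have "((\<lambda>x. herglotz ws (of_real x)) \<longlongrightarrow> herglotz ws 1) (at_left 1)"
          using tendsto_herglotz_1[OF ws(2,1)] by (simp add: ws(3))
        then have "((\<lambda>x. exp (- of_real t * herglotz ws (of_real x))) \<longlongrightarrow> exp (- of_real t * herglotz ws 1)) (at_left 1)"
          by (intro tendsto_intros)
        then show ?thesis using False U by (simp add: nonsingular_def)
      qed
      from filterlim_compose[OF this rt]
      show "(\<lambda>n. exp (- of_real t * matrix_herglotz U (of_real (r n)))) \<longlonglongrightarrow>
          indicator nonsingular U * exp (- of_real t * matrix_herglotz U 1)"
        unfolding ws(4) .
    qed
    show "AE U in \<mu>. norm (exp (- of_real t * matrix_herglotz U (of_real (r n)))) \<le> 1" for n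
      using norm_exp_herglotz_le[of _ "of_real (r n)" t] r[of n] t by (intro AE_I2) auto
  qed measurable
  moreover have "(\<lambda>n. \<integral>U. exp (- of_real t * matrix_herglotz U (of_real (r n))) \<partial>\<mu>) \<longlonglongrightarrow> exp (- of_real t)"
    using integral_exp_herglotz[OF r t] by simp
  ultimately show ?thesis by (rule LIMSEQ_unique)
qed

lemma Re_herglotz_nonsingular:
  assumes "U \<in> nonsingular"
  shows "Re (matrix_herglotz U 1) = 0"
proof -
  have U: "U \<in> space \<mu>" "rev_char U 1 \<noteq> 0" using assms by (auto simp: nonsingular_def)
  obtain ws where ws: "ws \<noteq> []" "\<And>w. w \<in> set ws \<Longrightarrow> norm w = 1" "rev_char U = reciprocal_poly ws" "matrix_herglotz U = herglotz ws"
    using haar_herglotz_spectrum[OF U(1)] by blast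
  show ?thesis using Re_herglotz_1[OF ws(2,1)] U(2) by (simp add: ws(3,4))
qed

text \<open>Let \<open>t\<close> tend to \<open>0\<close> in \<open>integral_exp_herglotz_1\<close>.\<close>

lemma AE_nonsingular: "AE U in \<mu>. U \<in> nonsingular"
proof -
  interpret prob_space \<mu> by (rule prob_space_haar)
  define \<tau> where "\<tau> n = 1 / real (Suc n)" for n
  have \<tau>: "\<tau> n > 0" for n by (simp add: \<tau>_def)
  have \<tau>0: "\<tau> \<longlonglongrightarrow> 0" unfolding \<tau>_def by real_asymp
  have "(\<lambda>n. \<integral>U. indicator nonsingular U * exp (- of_real (\<tau> n) * matrix_herglotz U 1) \<partial>\<mu>) \<longlonglongrightarrow>
      (\<integral>U. indicator nonsingular U * exp (- of_real 0 * matrix_herglotz U 1) \<partial>\<mu>)"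
  proof (rule integral_dominated_convergence)
    show "integrable \<mu> (\<lambda>_. 1 :: real)" by simp
    show "AE U in \<mu>. (\<lambda>n. indicator nonsingular U * exp (- of_real (\<tau> n) * matrix_herglotz U 1)) \<longlonglongrightarrow>
        indicator nonsingular U * exp (- of_real 0 * matrix_herglotz U 1)"
      by (intro AE_I2 tendsto_intros \<tau>0)
    show "AE U in \<mu>. norm (indicator nonsingular U * exp (- of_real (\<tau> n) * matrix_herglotz U 1)) \<le> 1" for n
      using Re_herglotz_nonsingular by (intro AE_I2) (auto simp: norm_mult indicator_def)
  qed measurable
  moreover have "(\<lambda>n. \<integral>U. indicator nonsingular U * exp (- of_real (\<tau> n) * matrix_herglotz U 1) \<partial>\<mu>) \<longlonglongrightarrow> exp (- of_real 0)"
    unfolding integral_exp_herglotz_1[OF \<tau>] by (intro tendsto_intros \<tau>0)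
  ultimately have "(\<integral>U. indicator nonsingular U * exp (- of_real 0 * matrix_herglotz U 1) \<partial>\<mu>) = (exp (- of_real 0) :: complex)"
    by (rule LIMSEQ_unique)
  then have "(\<integral>U. of_real (indicator nonsingular U) \<partial>\<mu>) = (1 :: complex)"
    by (simp add: of_real_indicator)
  then have "complex_of_real (prob nonsingular) = 1"
    by (simp add: integral_complex_of_real)
  then have "prob nonsingular = 1" by (metis of_real_eq_1_iff)
  then show ?thesis using prob_eq_1[OF sets_nonsingular] by simp
qed

text \<open>On nonsingular matrices the boundary value is \<open>\<i> * y\<close> with real
  \<open>y\<close>, and \<open>- t * (\<i> * y)\<close> equals \<open>\<i> * t * (- y)\<close>;
  hence the sign in the random variable.\<close>

lemma cauchy_distributed_herglotz:
  "distributed \<mu> lborel (\<lambda>U. - Im (matrix_herglotz U 1)) (\<lambda>x. ennreal (cauchy_density x))"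
proof (rule cauchy_distributedI[OF prob_space_haar])
  fix t :: real assume t: "t > 0"
  have "(\<integral>U. exp (\<i> * of_real (t * - Im (matrix_herglotz U 1))) \<partial>\<mu>)
      = (\<integral>U. indicator nonsingular U * exp (- of_real t * matrix_herglotz U 1) \<partial>\<mu>)"
  proof (rule integral_cong_AE)
    show "AE U in \<mu>. exp (\<i> * of_real (t * - Im (matrix_herglotz U 1))) = indicator nonsingular U * exp (- of_real t * matrix_herglotz U 1)"
      using AE_nonsingular
    proof eventually_elim
      case (elim U)
      have "matrix_herglotz U 1 = \<i> * of_real (Im (matrix_herglotz U 1))"
        using Re_herglotz_nonsingular[OF elim] by (simp add: complex_eq_iff)
      then have "- of_real t * matrix_herglotz U 1 = \<i> * of_real (t * - Im (matrix_herglotz U 1))"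
        by (simp add: complex_eq_iff)
      moreover have "indicator nonsingular U = (1 :: complex)" using elim by simp
      ultimately show ?case by (simp only: mult_1)
    qed
  qed measurable
  then show "(\<integral>U. exp (\<i> * of_real (t * - Im (matrix_herglotz U 1))) \<partial>\<mu>) = of_real (exp (- t))"
    using integral_exp_herglotz_1[OF t] by (simp add: exp_of_real[of "- t", symmetric])
qed measurable

lemma joint_moment_integrand:
  fixes h :: complex
  assumes U: "U \<in> space \<mu>"
  shows "of_real (norm (G_fun U 0)) powr (2 * of_real 0 - 2 * h) * of_real (norm (vector_derivative (G_fun U) (at 0))) powr (2 * h)
     = of_real (real N / 2) powr (2 * h) * of_real \<bar>- Im (matrix_herglotz U 1)\<bar> powr (2 * h)"
proof (cases "U \<in> nonsingular")
  case True
  then have nz: "rev_char U 1 \<noteq> 0" by (simp add: nonsingular_def)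
  define a where "a = norm (rev_char U 1)"
  have a: "a > 0" using nz by (simp add: a_def)
  have abs: "norm (matrix_herglotz U 1) = \<bar>- Im (matrix_herglotz U 1)\<bar>"
    using Re_herglotz_nonsingular[OF True] by (simp add: cmod_def)
  have "norm (vector_derivative (G_fun U) (at 0)) = a * (real N / 2 * \<bar>- Im (matrix_herglotz U 1)\<bar>)"
    using norm_deriv_G_fun_0[OF _ N nz] U unfolding space_haar abs a_def by blast
  moreover have "norm (G_fun U 0) = a" by (simp add: norm_G_fun_0 a_def)
  moreover have "2 * of_real 0 - 2 * h = - (2 * h)" by simp
  moreover have "complex_of_real a powr (- (2 * h)) * of_real (a * (real N / 2 * \<bar>- Im (matrix_herglotz U 1)\<bar>)) powr (2 * h)
      = of_real (real N / 2) powr (2 * h) * of_real \<bar>- Im (matrix_herglotz U 1)\<bar> powr (2 * h)"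
    by (rule powr_cancel_factor[OF a]) simp_all
  ultimately show ?thesis by (simp only:)
next
  case False
  \<comment> \<open>Both sides are \<open>0 powr _\<close>, that is \<open>0\<close>: the left
    because \<open>G_fun U 0\<close> vanishes, the right because division by zero turns
    \<open>matrix_herglotz U 1\<close> into \<open>1\<close>, with imaginary part \<open>0\<close>.
    Thus the identity holds at every matrix, without an exceptional set.\<close>
  then have z: "rev_char U 1 = 0" using U by (simp add: nonsingular_def)
  then have "norm (G_fun U 0) = 0" by (simp add: norm_G_fun_0)
  then show ?thesis by (simp add: matrix_herglotz_def z)
qed

lemma joint_moment_haar:
  assumes h: "- 1/2 < Re h" "Re h < 1/2"
  shows "joint_moment \<mu> 0 h = of_real (real N / 2) powr (2 * h) * (1 / cos (of_real pi * h))"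
proof -
  define k where "k = (\<lambda>x::real. complex_of_real \<bar>x\<bar> powr (2 * h))"
  have k [measurable]: "k \<in> borel_measurable borel" unfolding k_def powr_def by measurable
  define Y where "Y = (\<lambda>U. - Im (matrix_herglotz U 1))"
  have Y [measurable]: "Y \<in> borel_measurable \<mu>" unfolding Y_def by measurable
  have D: "distr \<mu> lborel Y = density lborel (\<lambda>x. ennreal (cauchy_density x))"
    using cauchy_distributed_herglotz by (simp add: distributed_def Y_def)
  have "joint_moment \<mu> 0 h = (\<integral>U. of_real (real N / 2) powr (2 * h) * k (Y U) \<partial>\<mu>)"
    unfolding joint_moment_def k_def Y_def
    by (rule Bochner_Integration.integral_cong[OF refl joint_moment_integrand])
  also have "\<dots> = of_real (real N / 2) powr (2 * h) * (\<integral>U. k (Y U) \<partial>\<mu>)"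
    by (rule integral_mult_right_zero)
  also have "(\<integral>U. k (Y U) \<partial>\<mu>) = (\<integral>x. k x \<partial>(distr \<mu> lborel Y))"
    by (rule integral_distr[symmetric]) auto
  also have "\<dots> = (\<integral>x. (k x / (1 + of_real x ^ 2)) / of_real pi \<partial>lborel)"
    unfolding D using less_imp_le[OF cauchy_density_pos]
    by (subst integral_density) (auto simp: cauchy_density_def scaleR_conv_of_real field_simps)
  also have "\<dots> = 1 / cos (of_real pi * h)"
    unfolding integral_divide_zero using abs_moment_inverse_square[OF h] by (simp add: has_bochner_integral_iff k_def)
  finally show ?thesis .
qed

end

text \<open>The moment is known exactly for each \<open>N\<close>, so the sequence behind
  \<open>joint_moment_limit\<close> is constant from \<open>N = 1\<close> on. The factor
  \<open>2 powr (- 2 * h)\<close> stems from the \<open>N / 2\<close> in the derivative of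
  \<open>G_fun\<close>.\<close>

lemma joint_moments_unitary:
  assumes haar: "\<forall>N\<ge>1. unitary_haar N (\<mu> N)" and h: "- 1/2 < Re h" "Re h < 1/2" and N: "N \<ge> 1"
  shows "joint_moment (\<mu> N) 0 h / of_nat N powr (2 * h) = joint_moment_limit \<mu> 0 h"
    and "joint_moment_limit \<mu> 0 h = 2 powr (- 2 * h) * (1 / cos (of_real pi * h))"
proof -
  define R where "R = 2 powr (- 2 * h) * (1 / cos (of_real pi * h))"
  have m: "joint_moment (\<mu> n) 0 h = of_nat n powr (2 * h) * R" if n: "n \<ge> 1" for n
  proof -
    have "of_real (real n / 2) powr (2 * h) = of_nat n powr (2 * h) * (1 / 2) powr (2 * h)"
      using powr_times_real[of "of_nat n" "1/2" "2 * h"] by simp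
    also have "(1 / 2 :: complex) powr (2 * h) = 2 powr (- 2 * h)"
    proof -
      have "Ln (1 / 2) = - Ln 2" by (simp add: Ln_inverse[symmetric] inverse_eq_divide complex_nonpos_Reals_iff)
      then show ?thesis by (simp add: powr_def)
    qed
    finally show ?thesis using joint_moment_haar[OF n _ h] haar n by (simp add: R_def)
  qed
  have l: "of_nat n powr (- ((of_real 0)\<^sup>2) - 2 * h) * joint_moment (\<mu> n) 0 h = R" if n: "n \<ge> 1" for n
    using n unfolding m[OF n] by (simp add: powr_minus field_simps)
  have "(\<lambda>n. of_nat n powr (- ((of_real 0)\<^sup>2) - 2 * h) * joint_moment (\<mu> n) 0 h) \<longlonglongrightarrow> R"
    by (rule tendsto_eventually, rule eventually_mono[OF eventually_ge_at_top[of 1] l])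
  then have lim: "joint_moment_limit \<mu> 0 h = R"
    unfolding joint_moment_limit_def by (rule limI)
  then show "joint_moment_limit \<mu> 0 h = 2 powr (- 2 * h) * (1 / cos (of_real pi * h))" by (simp add: R_def)
  show "joint_moment (\<mu> N) 0 h / of_nat N powr (2 * h) = joint_moment_limit \<mu> 0 h"
    unfolding lim m[OF N] using N by simp
qed

subsection \<open>The sine kernel\<close>

definition psd :: "nat \<Rightarrow> (nat \<Rightarrow> nat \<Rightarrow> real) \<Rightarrow> bool" where
  "psd n A \<longleftrightarrow> (\<forall>i<n. \<forall>j<n. A i j = A j i) \<and> (\<forall>x. 0 \<le> (\<Sum>i<n. \<Sum>j<n. x i * x j * A i j))"

lemma psdD: "psd n A \<Longrightarrow> 0 \<le> (\<Sum>i<n. \<Sum>j<n. x i * x j * A i j)"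
  by (simp add: psd_def)

lemma psd_diag_nonneg:
  assumes "psd n A" "k < n"
  shows "0 \<le> A k k"
proof -
  have "0 \<le> (\<Sum>i<n. \<Sum>j<n. (if i = k then 1 else 0) * (if j = k then 1 else 0) * A i j)"
    by (rule psdD[OF assms(1)])
  also have "\<dots> = (\<Sum>i<n. if i = k then A k k else 0)"
  proof (intro sum.cong refl)
    fix i
    have "(\<Sum>j<n. (if i = k then 1 else 0) * (if j = k then 1 else 0) * A i j)
        = (\<Sum>j<n. if j = k then (if i = k then A k k else 0) else 0)"
      by (intro sum.cong) auto
    then show "(\<Sum>j<n. (if i = k then 1 else 0) * (if j = k then 1 else 0) * A i j) = (if i = k then A k k else 0)"
      using assms(2) by simp
  qed
  also have "\<dots> = A k k" using assms(2) by simp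
  finally show ?thesis .
qed

lemma psd_Suc_form:
  fixes A :: "nat \<Rightarrow> nat \<Rightarrow> real"
  assumes "\<forall>i<Suc n. \<forall>j<Suc n. A i j = A j i"
  shows "(\<Sum>i<Suc n. \<Sum>j<Suc n. x i * x j * A i j)
    = x 0 ^ 2 * A 0 0 + 2 * x 0 * (\<Sum>j<n. x (Suc j) * A 0 (Suc j)) + (\<Sum>i<n. \<Sum>j<n. x (Suc i) * x (Suc j) * A (Suc i) (Suc j))"
proof -
  have sym: "A (Suc i) 0 = A 0 (Suc i)" if "i < n" for i using assms that by simp
  have "(\<Sum>i<n. x (Suc i) * x 0 * A (Suc i) 0) = x 0 * (\<Sum>j<n. x (Suc j) * A 0 (Suc j))"
    unfolding sum_distrib_left by (intro sum.cong) (auto simp: sym)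
  moreover have "(\<Sum>j<n. x 0 * x (Suc j) * A 0 (Suc j)) = x 0 * (\<Sum>j<n. x (Suc j) * A 0 (Suc j))"
    unfolding sum_distrib_left by (intro sum.cong) auto
  ultimately show ?thesis
    by (simp only: sum.lessThan_Suc_shift sum.distrib) (simp add: power2_eq_square)
qed

text \<open>When \<open>A 0 0 = 0\<close>, the quadratic form is affine in the coordinate
  \<open>x 0\<close>; a nonzero slope would make it negative somewhere.\<close>

lemma psd_zero_row:
  assumes A: "psd (Suc n) A" and 0: "A 0 0 = 0" and j: "j < n"
  shows "A 0 (Suc j) = 0"
proof (rule ccontr)
  assume nz: "A 0 (Suc j) \<noteq> 0"
  define b c where "b = A 0 (Suc j)" and "c = A (Suc j) (Suc j)"
  have sym: "\<forall>i<Suc n. \<forall>j<Suc n. A i j = A j i" using A by (simp add: psd_def)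
  \<comment> \<open>The value of \<open>x 0\<close> is solved for so that the form, here
    \<open>2 * x 0 * b + c\<close>, equals \<open>- 1\<close>.\<close>
  define x where "x i = (if i = 0 then - (c + 1) / (2 * b) else if i = Suc j then 1 else 0)" for i
  have "0 \<le> (\<Sum>i<Suc n. \<Sum>j<Suc n. x i * x j * A i j)" by (rule psdD[OF A])
  also have "\<dots> = 2 * x 0 * b + c"
  proof -
    have "(\<Sum>k<n. x (Suc k) * A 0 (Suc k)) = (\<Sum>k<n. if k = j then b else 0)"
      by (intro sum.cong) (auto simp: x_def b_def)
    moreover have "(\<Sum>k<n. x (Suc i) * x (Suc k) * A (Suc i) (Suc k)) = (if i = j then c else 0)" for i
    proof -
      have "(\<Sum>k<n. x (Suc i) * x (Suc k) * A (Suc i) (Suc k)) = (\<Sum>k<n. if k = j then (if i = j then c else 0) else 0)"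
        by (intro sum.cong) (auto simp: x_def c_def)
      then show ?thesis using j by simp
    qed
    ultimately show ?thesis
      unfolding psd_Suc_form[OF sym] 0 using j by simp
  qed
  also have "2 * x 0 * b = - (c + 1)" using nz by (simp add: x_def b_def field_simps)
  finally show False by simp
qed

text \<open>One step of Gaussian elimination as a block factorization: a lower triangular block
  matrix of determinant \<open>1\<close> times an upper triangular one whose diagonal blocks are the
  pivot and the complement.\<close>

lemma det_Schur_complement:
  fixes A :: "nat \<Rightarrow> nat \<Rightarrow> real"
  assumes a: "A 0 0 \<noteq> 0"
  shows "Determinant.det (Matrix.mat (Suc n) (Suc n) (\<lambda>(i, j). A i j))
    = A 0 0 * Determinant.det (Matrix.mat n n (\<lambda>(i, j). A (Suc i) (Suc j) - A (Suc i) 0 * A 0 (Suc j) / A 0 0))"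
proof -
  let ?a = "Matrix.mat 1 1 (\<lambda>_. A 0 0)" and ?b = "Matrix.mat 1 n (\<lambda>(i, j). A 0 (Suc j))"
    and ?c = "Matrix.mat n 1 (\<lambda>(i, j). A (Suc i) 0 / A 0 0)"
    and ?B = "Matrix.mat n n (\<lambda>(i, j). A (Suc i) (Suc j) - A (Suc i) 0 * A 0 (Suc j) / A 0 0)"
  let ?L = "four_block_mat (1\<^sub>m 1) (0\<^sub>m 1 n) ?c (1\<^sub>m n)" and ?R = "four_block_mat ?a ?b (0\<^sub>m n 1) ?B"
  have c: "?a \<in> carrier_mat 1 1" "?b \<in> carrier_mat 1 n" "?c \<in> carrier_mat n 1" "?B \<in> carrier_mat n n" by auto
  have "?L * ?R = four_block_mat (1\<^sub>m 1 * ?a + 0\<^sub>m 1 n * 0\<^sub>m n 1) (1\<^sub>m 1 * ?b + 0\<^sub>m 1 n * ?B)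
     (?c * ?a + 1\<^sub>m n * 0\<^sub>m n 1) (?c * ?b + 1\<^sub>m n * ?B)"
    by (rule mult_four_block_mat) (use c in auto)
  also have "\<dots> = Matrix.mat (Suc n) (Suc n) (\<lambda>(i, j). A i j)"
    using a by (intro eq_matI) (auto simp: four_block_mat_def scalar_prod_def)
  finally have "Determinant.det (Matrix.mat (Suc n) (Suc n) (\<lambda>(i, j). A i j)) = Determinant.det ?L * Determinant.det ?R"
    using det_mult[of ?L "Suc n" ?R] c by (simp add: carrier_matI)
  also have "Determinant.det ?L = 1"
    using det_four_block_mat_upper_right_zero[of "1\<^sub>m 1" 1 "0\<^sub>m 1 n" n ?c "1\<^sub>m n"] c by simp
  also have "Determinant.det ?R = A 0 0 * Determinant.det ?B"
    using det_four_block_mat_lower_left_zero[of ?a 1 ?b n "0\<^sub>m n 1" ?B] c by (simp add: det_single)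
  finally show ?thesis by simp
qed

text \<open>Induction along Schur complements: passing to the complement keeps the form nonnegative
  and can only lower the diagonal. The result bounds the correlation functions of every order by
  their diagonal, which is the source of all dominating functions below.\<close>

lemma psd_det:
  assumes "psd n A"
  shows "0 \<le> Determinant.det (Matrix.mat n n (\<lambda>(i, j). A i j))
    \<and> Determinant.det (Matrix.mat n n (\<lambda>(i, j). A i j)) \<le> (\<Prod>i<n. A i i)"
  using assms
proof (induction n arbitrary: A)
  case 0
  then show ?case by simp
next
  case (Suc n)
  have sym: "\<forall>i<Suc n. \<forall>j<Suc n. A i j = A j i" using Suc.prems by (simp add: psd_def)
  have a: "0 \<le> A 0 0" using psd_diag_nonneg[OF Suc.prems] by simp
  show ?case
  proof (cases "A 0 0 = 0")
    case True
    have row: "A 0 j = 0" if "j < Suc n" for j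
      using psd_zero_row[OF Suc.prems True] True that by (cases j) auto
    let ?M = "Matrix.mat (Suc n) (Suc n) (\<lambda>(i, j). A i j)"
    have "Determinant.det ?M = (\<Sum>p\<in>{p. p permutes {0..<Suc n}}. signof p * (\<Prod>i = 0..<Suc n. ?M $$ (i, p i)))"
      by (rule det_def') simp
    also have "\<dots> = (\<Sum>p\<in>{p. p permutes {0..<Suc n}}. 0)"
    proof (intro sum.cong refl)
      fix p assume "p \<in> {p. p permutes {0..<Suc n}}"
      then have "p 0 < Suc n" using permutes_in_image[of p "{0..<Suc n}" 0] by simp
      then have "?M $$ (0, p 0) = 0" using row by simp
      then have "(\<Prod>i = 0..<Suc n. ?M $$ (i, p i)) = 0"
        by (intro prod_zero) (auto intro!: bexI[of _ 0])
      then show "signof p * (\<Prod>i = 0..<Suc n. ?M $$ (i, p i)) = 0" by simp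
    qed
    finally have "Determinant.det ?M = 0" by simp
    moreover have "(\<Prod>i<Suc n. A i i) = 0" using True by (intro prod_zero) (auto intro!: bexI[of _ 0])
    ultimately show ?thesis by (simp only: order_refl)
  next
    case False
    then have a: "0 < A 0 0" using a by simp
    define B where "B i j = A (Suc i) (Suc j) - A (Suc i) 0 * A 0 (Suc j) / A 0 0" for i j
    have s: "A (Suc i) 0 = A 0 (Suc i)" if "i < n" for i using sym that by simp
    have B: "psd n B"
      unfolding psd_def
    proof (intro conjI allI impI)
      fix i j assume "i < n" "j < n"
      then show "B i j = B j i" using sym s by (simp add: B_def)
    next
      fix x :: "nat \<Rightarrow> real"
      define m where "m = (\<Sum>j<n. x j * A 0 (Suc j))"
      \<comment> \<open>The first coordinate minimizes the form of \<open>A\<close> in that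
        variable; the minimum is the form of the Schur complement at \<open>x\<close>.\<close>
      define y where "y i = (case i of 0 \<Rightarrow> - m / A 0 0 | Suc i \<Rightarrow> x i)" for i
      have "0 \<le> (\<Sum>i<Suc n. \<Sum>j<Suc n. y i * y j * A i j)"
        by (rule psdD[OF Suc.prems])
      also have "\<dots> = (\<Sum>i<n. \<Sum>j<n. x i * x j * A (Suc i) (Suc j)) - m * m / A 0 0"
        unfolding psd_Suc_form[OF sym] using a by (simp add: y_def m_def[symmetric] power2_eq_square field_simps)
      also have "m * m / A 0 0 = (\<Sum>i<n. \<Sum>j<n. x i * x j * (A (Suc i) 0 * A 0 (Suc j) / A 0 0))"
        unfolding m_def sum_product sum_divide_distrib by (intro sum.cong refl) (auto simp: s)
      finally show "0 \<le> (\<Sum>i<n. \<Sum>j<n. x i * x j * B i j)"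
        by (simp add: B_def right_diff_distrib sum_subtractf)
    qed
    have IH: "0 \<le> Determinant.det (Matrix.mat n n (\<lambda>(i, j). B i j))"
      "Determinant.det (Matrix.mat n n (\<lambda>(i, j). B i j)) \<le> (\<Prod>i<n. B i i)"
      using Suc.IH[OF B] by auto
    have "(\<Prod>i<n. B i i) \<le> (\<Prod>i<n. A (Suc i) (Suc i))"
    proof (intro prod_mono conjI)
      fix i assume "i \<in> {..<n}"
      then show "0 \<le> B i i" "B i i \<le> A (Suc i) (Suc i)"
        using psd_diag_nonneg[OF B] s a by (auto simp: B_def)
    qed
    with IH have "Determinant.det (Matrix.mat n n (\<lambda>(i, j). B i j)) \<le> (\<Prod>i<n. A (Suc i) (Suc i))" by simp
    then have "A 0 0 * Determinant.det (Matrix.mat n n (\<lambda>(i, j). B i j)) \<le> A 0 0 * (\<Prod>i<n. A (Suc i) (Suc i))"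
      using a by (intro mult_left_mono) auto
    moreover have "(\<Prod>i<Suc n. A i i) = A 0 0 * (\<Prod>i<n. A (Suc i) (Suc i))"
      by (rule prod.lessThan_Suc_shift)
    moreover have "Determinant.det (Matrix.mat (Suc n) (Suc n) (\<lambda>(i, j). A i j)) = A 0 0 * Determinant.det (Matrix.mat n n (\<lambda>(i, j). B i j))"
      using det_Schur_complement[of A n] a by (simp add: B_def)
    ultimately show ?thesis using IH(1) a by simp
  qed
qed

section \<open>The sine kernel and its determinants\<close>

definition sine_kernel :: "real \<Rightarrow> real \<Rightarrow> real" where
  "sine_kernel u v = sinc (u - v) / pi"

lemma sine_kernel_diag [simp]: "sine_kernel u u = 1 / pi"
  by (simp add: sine_kernel_def)

lemma sine_kernel_commute: "sine_kernel u v = sine_kernel v u"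
proof -
  have "v - u = - (u - v)" by simp
  then show ?thesis unfolding sine_kernel_def by (simp only: sinc_neg)
qed

lemma sine_kernel_shift: "sine_kernel (u - a) (v - a) = sine_kernel u v"
  by (simp add: sine_kernel_def)

lemma borel_measurable_sine_kernel [measurable (raw)]:
  "f \<in> borel_measurable M \<Longrightarrow> g \<in> borel_measurable M \<Longrightarrow> (\<lambda>x. sine_kernel (f x) (g x)) \<in> borel_measurable M"
  unfolding sine_kernel_def
  by (intro borel_measurable_divide borel_measurable_const measurable_compose[OF _ borel_measurable_sinc] borel_measurable_diff)

text \<open>Up to normalization the sine kernel is the Fourier transform of the indicator of
  \<open>{-1..1}\<close>, and its positivity comes from there.\<close>

lemma sine_kernel_fourier: "((\<lambda>s. cos ((u - v) * s)) has_integral 2 * pi * sine_kernel u v) {-1..1}"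
proof (cases "u = v")
  case True
  have "((\<lambda>s::real. 1::real) has_integral 2) {-1..1}"
    using has_integral_const_real[of "1::real" "-1" 1] by simp
  then show ?thesis using True by simp
next
  case False
  define d where "d = u - v"
  have d: "d \<noteq> 0" using False by (simp add: d_def)
  have "((\<lambda>s. cos (d * s)) has_integral (sin (d * 1) / d - sin (d * -1) / d)) {-1..1}"
    by (rule fundamental_theorem_of_calculus)
       (use d in \<open>auto intro!: derivative_eq_intros simp flip: has_real_derivative_iff_has_vector_derivative\<close>)
  moreover have "2 * pi * sine_kernel u v = sin (d * 1) / d - sin (d * -1) / d"
    using d by (simp add: sine_kernel_def flip: d_def)
  ultimately show ?thesis by (simp only: d_def)
qed

text \<open>Under the Fourier integral the quadratic form is the sum of two squares, one of a cosine
  sum and one of a sine sum.\<close>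

lemma psd_sine_kernel: "psd n (\<lambda>i j. sine_kernel (u i) (u j))"
  unfolding psd_def
proof (intro conjI allI impI)
  fix x :: "nat \<Rightarrow> real"
  have "((\<lambda>s. \<Sum>i<n. \<Sum>j<n. x i * x j * cos ((u i - u j) * s)) has_integral
      (\<Sum>i<n. \<Sum>j<n. x i * x j * (2 * pi * sine_kernel (u i) (u j)))) {-1..1}"
    by (intro has_integral_sum has_integral_mult_right sine_kernel_fourier) auto
  moreover have "0 \<le> (\<Sum>i<n. \<Sum>j<n. x i * x j * cos ((u i - u j) * s))" for s
  proof -
    have "(\<Sum>i<n. \<Sum>j<n. x i * x j * cos ((u i - u j) * s))
        = (\<Sum>i<n. x i * cos (u i * s)) * (\<Sum>j<n. x j * cos (u j * s)) + (\<Sum>i<n. x i * sin (u i * s)) * (\<Sum>j<n. x j * sin (u j * s))"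
      unfolding sum_product sum.distrib[symmetric]
      by (intro sum.cong refl) (simp add: left_diff_distrib cos_diff algebra_simps)
    then show ?thesis by simp
  qed
  ultimately have "0 \<le> (\<Sum>i<n. \<Sum>j<n. x i * x j * (2 * pi * sine_kernel (u i) (u j)))"
    by (rule has_integral_nonneg)
  also have "\<dots> = 2 * pi * (\<Sum>i<n. \<Sum>j<n. x i * x j * sine_kernel (u i) (u j))"
    unfolding sum_distrib_left by (intro sum.cong refl) simp
  finally show "0 \<le> (\<Sum>i<n. \<Sum>j<n. x i * x j * sine_kernel (u i) (u j))"
    using pi_gt_zero by (simp add: zero_le_mult_iff not_le)
qed (rule sine_kernel_commute)

definition sine_det :: "nat \<Rightarrow> (nat \<Rightarrow> real) \<Rightarrow> real" where
  "sine_det n u = Determinant.det (Matrix.mat n n (\<lambda>(i, j). sine_kernel (u i) (u j)))"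

lemma sine_det_bounds: "0 \<le> sine_det n u" "sine_det n u \<le> (1 / pi) ^ n"
  using psd_det[OF psd_sine_kernel[of n u]] by (auto simp: sine_det_def)

lemma sine_det_expand:
  "sine_det n u = (\<Sum>p\<in>{p. p permutes {0..<n}}. signof p * (\<Prod>i = 0..<n. sine_kernel (u i) (u (p i))))"
proof -
  have "sine_det n u = (\<Sum>p\<in>{p. p permutes {0..<n}}. signof p * (\<Prod>i = 0..<n. Matrix.mat n n (\<lambda>(i, j). sine_kernel (u i) (u j)) $$ (i, p i)))"
    unfolding sine_det_def by (rule det_def') simp
  also have "\<dots> = (\<Sum>p\<in>{p. p permutes {0..<n}}. signof p * (\<Prod>i = 0..<n. sine_kernel (u i) (u (p i))))"
  proof (intro sum.cong refl arg_cong2[of _ _ _ _ "(*)"] prod.cong)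
    fix p i assume "p \<in> {p. p permutes {0..<n}}" "i \<in> {0..<n}"
    then have "i < n" "p i < n" using permutes_in_image[of p "{0..<n}" i] by auto
    then show "Matrix.mat n n (\<lambda>(i, j). sine_kernel (u i) (u j)) $$ (i, p i) = sine_kernel (u i) (u (p i))" by simp
  qed
  finally show ?thesis .
qed

lemma borel_measurable_sine_det [measurable]:
  "sine_det n \<in> borel_measurable (\<Pi>\<^sub>M i\<in>{..<n}. borel)"
proof -
  have "(\<lambda>u. sine_det n u) \<in> borel_measurable (\<Pi>\<^sub>M i\<in>{..<n}. borel)"
    unfolding sine_det_expand
  proof (intro borel_measurable_sum borel_measurable_times borel_measurable_const borel_measurable_prod borel_measurable_sine_kernel)
    fix p i assume "p \<in> {p. p permutes {0..<n}}" "i \<in> {0..<n}"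
    then have "i < n" "p i < n" using permutes_in_image[of p "{0..<n}" i] by auto
    then show "(\<lambda>u. u i) \<in> borel_measurable (\<Pi>\<^sub>M i\<in>{..<n}. borel)" "(\<lambda>u. u (p i)) \<in> borel_measurable (\<Pi>\<^sub>M i\<in>{..<n}. borel)"
      by (auto intro!: measurable_component_singleton)
  qed
  then show ?thesis by simp
qed

lemma sine_det_1: "sine_det (Suc 0) u = 1 / pi"
  by (simp add: sine_det_def det_single)

lemma sine_det_2: "sine_det 2 u = (1 / pi)\<^sup>2 - (sine_kernel (u 0) (u 1))\<^sup>2"
  using det_Schur_complement[of "\<lambda>i j. sine_kernel (u i) (u j)" 1]
  by (simp add: sine_det_def power2_eq_square sine_kernel_commute[of "u (Suc 0)" "u 0"] det_single numeral_2_eq_2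
      right_diff_distrib)

text \<open>Add the bounds \<open>1\<close> for the squares of \<open>sinc d\<close> and of
  \<open>d * sinc d = sin d\<close>. The majorant is integrable with an integral independent of the
  centre.\<close>

lemma sine_kernel_square_le: "(sine_kernel u v)\<^sup>2 \<le> 2 / pi\<^sup>2 * (1 / (1 + (v - u)\<^sup>2))"
proof -
  define d where "d = u - v"
  have "(sinc d)\<^sup>2 * (1 + d\<^sup>2) \<le> 2"
  proof (cases "d = 0")
    case False
    then have "(sinc d)\<^sup>2 * d\<^sup>2 = (sin d)\<^sup>2" by (simp add: power_divide)
    moreover have "(sin d)\<^sup>2 \<le> 1" by (simp add: abs_square_le_1)
    moreover have "(sinc d)\<^sup>2 \<le> 1"
      using abs_sin_x_le_abs_x[of d] False by (simp add: abs_square_le_1)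
    ultimately show ?thesis by (simp add: distrib_left)
  qed simp
  moreover have "0 < 1 + d\<^sup>2" by (simp add: add_pos_nonneg)
  moreover define q where "q = sinc d"
  ultimately have "q\<^sup>2 \<le> 2 / (1 + d\<^sup>2)" by (simp only: pos_le_divide_eq)
  then have "q\<^sup>2 / pi\<^sup>2 \<le> 2 / (1 + d\<^sup>2) / pi\<^sup>2" by (rule divide_right_mono) simp
  moreover have "sine_kernel u v = q / pi" by (simp only: sine_kernel_def q_def d_def)
  moreover have "(v - u)\<^sup>2 = d\<^sup>2" by (simp add: d_def power2_commute)
  ultimately show ?thesis by (simp add: power_divide mult.commute)
qed

section \<open>Bessel functions of order 1/2 and -1/2, and the kernel at s = 0\<close>

lemma rGamma_half_plus_Suc:
  "rGamma (real m + 1 / 2 + 1) = rGamma (real m + 1 / 2) / (real m + 1 / 2)"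
proof -
  have "real m + 1 / 2 \<noteq> 0" by linarith
  then show ?thesis
    using rGamma_plus1[of "real m + 1 / 2"] by (metis nonzero_mult_div_cancel_left)
qed

text \<open>Legendre's duplication formula at half integers. It merges the factorial and the Gamma
  factor of the Bessel series into \<open>fact (2 * m)\<close>, so that the series of cosine and
  sine appear.\<close>

lemma rGamma_half_plus_nat:
  "rGamma (real m + 1 / 2) / fact m = 4 ^ m / (sqrt pi * fact (2 * m))"
proof (induction m)
  case 0
  have "rGamma (1 / 2 :: real) = 1 / sqrt pi"
    by (simp only: rGamma_inverse_Gamma Gamma_one_half_real inverse_eq_divide)
  then show ?case by simp
next
  case (Suc m)
  have eq: "real (Suc m) + 1 / 2 = real m + 1 / 2 + 1" by simp
  have "rGamma (real (Suc m) + 1 / 2) / fact (Suc m) = (rGamma (real m + 1 / 2) / fact m) / ((real m + 1 / 2) * real (Suc m))"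
    unfolding eq rGamma_half_plus_Suc by simp
  also have "\<dots> = 4 ^ m / (sqrt pi * fact (2 * m)) / ((real m + 1 / 2) * real (Suc m))"
    by (simp only: Suc.IH)
  also have "\<dots> = 4 ^ Suc m / (sqrt pi * fact (2 * Suc m))"
  proof -
    have "fact (2 * Suc m) = (4 :: real) * ((real m + 1 / 2) * real (Suc m)) * fact (2 * m)"
      by (simp add: algebra_simps)
    then show ?thesis by (simp only: power_Suc) simp
  qed
  finally show ?case .
qed

lemma bessel_J_minus_half:
  assumes "z > 0"
  shows "bessel_J (- 1/2) z = sqrt (2 / (pi * z)) * cos z"
proof -
  have "(-1) ^ m / fact m * rGamma (real m + - 1/2 + 1) * (z / 2) powr (2 * real m + - 1/2)
      = sqrt (2 / (pi * z)) * ((-1) ^ m / fact (2 * m) * z ^ (2 * m))" for m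
  proof -
    have "(z / 2) powr (2 * real m + - 1/2) = (z / 2) powr (real (2 * m)) * (z / 2) powr (- (1/2))"
      unfolding powr_add[symmetric] by simp
    also have "\<dots> = (z / 2) ^ (2 * m) * sqrt (2 / z)"
      using assms by (subst powr_realpow) (auto simp: powr_minus powr_half_sqrt real_sqrt_divide)
    finally have p: "(z / 2) powr (2 * real m + - 1/2) = z ^ (2 * m) / 4 ^ m * sqrt (2 / z)"
      by (simp add: power_divide power_mult)
    have "(-1) ^ m / fact m * rGamma (real m + - 1/2 + 1) = (-1) ^ m * (rGamma (real m + 1/2) / fact m)"
      by (simp add: add.commute)
    then show ?thesis
      unfolding p rGamma_half_plus_nat by (simp add: real_sqrt_divide real_sqrt_mult mult_ac)
  qed
  then have "bessel_J (- 1/2) z = (\<Sum>m. sqrt (2 / (pi * z)) * ((-1) ^ m / fact (2 * m) * z ^ (2 * m)))"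
    unfolding bessel_J_def by simp
  also have "\<dots> = sqrt (2 / (pi * z)) * cos z"
    using sums_mult[OF cos_paired] by (intro sums_unique[symmetric])
  finally show ?thesis .
qed

lemma bessel_J_half:
  assumes "z > 0"
  shows "bessel_J (1/2) z = sqrt (2 / (pi * z)) * sin z"
proof -
  have "(-1) ^ m / fact m * rGamma (real m + 1/2 + 1) * (z / 2) powr (2 * real m + 1/2)
      = sqrt (2 / (pi * z)) * ((-1) ^ m / fact (2 * m + 1) * z ^ (2 * m + 1))" for m
  proof -
    have "(z / 2) powr (2 * real m + 1/2) = (z / 2) powr (real (2 * m)) * (z / 2) powr (1/2)"
    proof -
      have "2 * real m + 1/2 = real (2 * m) + 1/2" by simp
      then show ?thesis by (simp only: powr_add)
    qed
    also have "\<dots> = (z / 2) ^ (2 * m) * sqrt (z / 2)"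
      using assms powr_realpow[of "z / 2" "2 * m"] powr_half_sqrt[of "z / 2"] by simp
    also have "sqrt (z / 2) = z * sqrt (2 / z) / 2"
    proof (rule real_sqrt_unique)
      show "(z * sqrt (2 / z) / 2)\<^sup>2 = z / 2"
        using assms by (simp add: power_mult_distrib power_divide power2_eq_square)
    qed (use assms in auto)
    finally have p: "(z / 2) powr (2 * real m + 1/2) = z ^ (2 * m) / 4 ^ m * (z * sqrt (2 / z) / 2)"
      by (simp add: power_divide power_mult)
    have "(-1) ^ m / fact m * rGamma (real m + 1/2 + 1) = (-1) ^ m * (rGamma (real m + 1/2) / fact m) / (real m + 1/2)"
      unfolding rGamma_half_plus_Suc by simp
    also have "\<dots> = (-1) ^ m * 2 * 4 ^ m / (sqrt pi * fact (2 * m + 1))"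
      unfolding rGamma_half_plus_nat by (simp add: divide_simps)
    finally show ?thesis
      unfolding p by (simp add: real_sqrt_divide real_sqrt_mult mult_ac)
  qed
  then have "bessel_J (1/2) z = (\<Sum>m. sqrt (2 / (pi * z)) * ((-1) ^ m / fact (2 * m + 1) * z ^ (2 * m + 1)))"
    unfolding bessel_J_def by simp
  also have "\<dots> = sqrt (2 / (pi * z)) * sin z"
    using sums_mult[OF sin_paired] by (intro sums_unique[symmetric])
  finally show ?thesis .
qed

lemma kernel_T_0:
  assumes "x \<noteq> 0"
  shows "kernel_T 0 x = cos (1 / x)"
proof -
  have "kernel_T 0 x = 2 powr (- 1/2) * sqrt pi * \<bar>x\<bar> powr (- 1/2) * (sqrt (2 / (pi * (1 / \<bar>x\<bar>))) * cos (1 / \<bar>x\<bar>))"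
    using bessel_J_minus_half[of "1 / \<bar>x\<bar>"] assms by (simp add: kernel_T_def Gamma_one_half_real)
  also have "2 powr (- 1/2) * sqrt pi * \<bar>x\<bar> powr (- 1/2) * sqrt (2 / (pi * (1 / \<bar>x\<bar>))) = 1"
    using assms by (simp add: powr_minus powr_half_sqrt real_sqrt_divide real_sqrt_mult field_simps)
  moreover have "cos (1 / \<bar>x\<bar>) = cos (1 / x)" by (cases "x > 0") (auto simp: abs_if)
  ultimately show ?thesis by (simp add: mult.assoc[symmetric])
qed

lemma kernel_R_0:
  assumes "x \<noteq> 0"
  shows "kernel_R 0 x = 2 * sin (1 / x)"
proof -
  have G: "Gamma (3/2 :: real) = sqrt pi / 2"
  proof -
    have "(1/2 :: real) \<notin> \<int>\<^sub>\<le>\<^sub>0" by (auto elim!: nonpos_Ints_cases)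
    then show ?thesis using Gamma_plus1[of "1/2 :: real"] by (simp add: Gamma_one_half_real)
  qed
  have p: "2 powr (3/2 :: real) = 2 * sqrt 2"
    using powr_add[of "2::real" 1 "1/2"] by (simp add: powr_half_sqrt)
  have "kernel_R 0 x = sgn x * (2 * sqrt 2) * (sqrt pi / 2) * \<bar>x\<bar> powr (- 1/2) * (sqrt (2 / (pi * (1 / \<bar>x\<bar>))) * sin (1 / \<bar>x\<bar>))"
    using bessel_J_half[of "1 / \<bar>x\<bar>"] assms by (simp add: kernel_R_def G p)
  also have "\<dots> = ((2 * sqrt 2) * (sqrt pi / 2) * \<bar>x\<bar> powr (- 1/2) * sqrt (2 / (pi * (1 / \<bar>x\<bar>)))) * (sgn x * sin (1 / \<bar>x\<bar>))"
    by (simp only: mult_ac)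
  also have "(2 * sqrt 2) * (sqrt pi / 2) * \<bar>x\<bar> powr (- 1/2) * sqrt (2 / (pi * (1 / \<bar>x\<bar>))) = 2"
    using assms by (simp add: powr_minus powr_half_sqrt real_sqrt_divide real_sqrt_mult field_simps)
  also have "sgn x * sin (1 / \<bar>x\<bar>) = sin (1 / x)" using assms by (auto simp: abs_if sgn_if)
  finally show ?thesis .
qed

text \<open>The numerator is a sine by the subtraction formula. The factors \<open>1 / x\<close> and
  \<open>1 / y\<close> are, up to sign, square roots of the Jacobian \<open>1 / x^2\<close> of the
  map \<open>u = 1 / x\<close>, so this is the sine kernel transported by inversion.\<close>

lemma kernel_K_offdiag_0:
  assumes "x \<noteq> 0" "y \<noteq> 0" "x \<noteq> y"
  shows "kernel_K_offdiag 0 x y = (1 / x) * (1 / y) * sine_kernel (1 / x) (1 / y)"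
proof -
  have "kernel_K_offdiag 0 x y = sin (1 / y - 1 / x) / (pi * (x - y))"
  proof -
    have "Gamma (2 :: real) = 1" using Gamma_fact[of 1, where 'a = real] by simp
    moreover have "cos (1 / x) * (2 * sin (1 / y)) - cos (1 / y) * (2 * sin (1 / x)) = 2 * sin (1 / y - 1 / x)"
      unfolding sin_diff by simp
    ultimately show ?thesis
      unfolding kernel_K_offdiag_def kernel_T_0[OF assms(1)] kernel_T_0[OF assms(2)] kernel_R_0[OF assms(1)] kernel_R_0[OF assms(2)]
      by simp
  qed
  moreover have "1 / x - 1 / y \<noteq> 0" using assms by (simp add: field_simps)
  moreover have "1 / x - 1 / y = (y - x) / (x * y)" using assms by (simp add: field_simps)
  moreover have "sin (1 / y - 1 / x) = - sin (1 / x - 1 / y)"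
    by (metis minus_diff_eq sin_minus)
  ultimately have *: "kernel_K_offdiag 0 x y = - sin (1 / x - 1 / y) / (pi * (x - y))"
    "sine_kernel (1 / x) (1 / y) = sin (1 / x - 1 / y) / ((y - x) / (x * y)) / pi"
    by (simp_all add: sine_kernel_def)
  show ?thesis unfolding * using assms by (simp add: divide_simps) (simp add: algebra_simps)
qed

lemma kernel_K_0:
  assumes x: "x \<noteq> 0" and y: "y \<noteq> 0"
  shows "kernel_K 0 x y = (1 / x) * (1 / y) * sine_kernel (1 / x) (1 / y)"
proof (cases "x = y")
  case True
  have "((\<lambda>u. (1 / u) * (1 / x) * sine_kernel (1 / u) (1 / x)) \<longlongrightarrow> (1 / x) * (1 / x) * sine_kernel (1 / x) (1 / x)) (at x)"
    unfolding sine_kernel_def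
    by (intro tendsto_intros isCont_tendsto_compose[OF isCont_sinc] x) auto
  moreover have "\<forall>\<^sub>F u in at x. (1 / u) * (1 / x) * sine_kernel (1 / u) (1 / x) = kernel_K_offdiag 0 u x"
  proof -
    have "\<forall>\<^sub>F u in at x. u \<in> - {0} - {x}"
      by (rule eventually_at_in_open) (use x in auto)
    then show ?thesis by eventually_elim (use x in \<open>auto simp: kernel_K_offdiag_0\<close>)
  qed
  ultimately have "((\<lambda>u. kernel_K_offdiag 0 u x) \<longlongrightarrow> (1 / x) * (1 / x) * sine_kernel (1 / x) (1 / x)) (at x)"
    by (rule Lim_transform_eventually)
  then show ?thesis using True tendsto_Lim[OF trivial_limit_at] by (simp add: kernel_K_def)
qed (use assms in \<open>simp add: kernel_K_def kernel_K_offdiag_0\<close>)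

lemma det_kernel_K:
  assumes "\<And>i. i < n \<Longrightarrow> y i \<noteq> 0"
  shows "Determinant.det (Matrix.mat n n (\<lambda>(i, j). kernel_K 0 (y i) (y j)))
    = (\<Prod>i<n. (1 / y i)\<^sup>2) * sine_det n (\<lambda>i. 1 / y i)"
proof -
  have "Determinant.det (Matrix.mat n n (\<lambda>(i, j). kernel_K 0 (y i) (y j)))
     = (\<Sum>p\<in>{p. p permutes {0..<n}}. signof p * (\<Prod>i = 0..<n. Matrix.mat n n (\<lambda>(i, j). kernel_K 0 (y i) (y j)) $$ (i, p i)))"
    by (rule det_def') simp
  also have "\<dots> = (\<Sum>p\<in>{p. p permutes {0..<n}}. (\<Prod>i<n. (1 / y i)\<^sup>2) * (signof p * (\<Prod>i = 0..<n. sine_kernel (1 / y i) (1 / y (p i)))))"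
  proof (intro sum.cong refl)
    fix p assume "p \<in> {p. p permutes {0..<n}}"
    then have p: "p permutes {0..<n}" by simp
    have "(\<Prod>i = 0..<n. Matrix.mat n n (\<lambda>(i, j). kernel_K 0 (y i) (y j)) $$ (i, p i))
        = (\<Prod>i = 0..<n. (1 / y i) * (1 / y (p i)) * sine_kernel (1 / y i) (1 / y (p i)))"
    proof (rule prod.cong[OF refl])
      fix i assume "i \<in> {0..<n}"
      then have "i < n" "p i < n" using permutes_in_image[OF p, of i] by auto
      then show "Matrix.mat n n (\<lambda>(i, j). kernel_K 0 (y i) (y j)) $$ (i, p i) = (1 / y i) * (1 / y (p i)) * sine_kernel (1 / y i) (1 / y (p i))"
        using assms by (simp add: kernel_K_0)
    qed
    also have "\<dots> = (\<Prod>i = 0..<n. 1 / y i) * (\<Prod>i = 0..<n. 1 / y (p i)) * (\<Prod>i = 0..<n. sine_kernel (1 / y i) (1 / y (p i)))"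
      by (simp only: prod.distrib)
    \<comment> \<open>A permutation only reorders the factors coming from the columns, so rows and
      columns together produce the squares.\<close>
    also have "(\<Prod>i = 0..<n. 1 / y (p i)) = (\<Prod>i = 0..<n. 1 / y i)"
      using prod.permute[OF p, of "\<lambda>i. 1 / y i"] by (simp add: o_def)
    also have "(\<Prod>i = 0..<n. 1 / y i) * (\<Prod>i = 0..<n. 1 / y i) = (\<Prod>i<n. (1 / y i)\<^sup>2)"
      by (simp add: prod.distrib[symmetric] power2_eq_square lessThan_atLeast0)
    finally show "signof p * (\<Prod>i = 0..<n. Matrix.mat n n (\<lambda>(i, j). kernel_K 0 (y i) (y j)) $$ (i, p i))
       = (\<Prod>i<n. (1 / y i)\<^sup>2) * (signof p * (\<Prod>i = 0..<n. sine_kernel (1 / y i) (1 / y (p i))))"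
      by simp
  qed
  finally show ?thesis by (simp add: sine_det_expand sum_distrib_left)
qed

subsection \<open>Inversion of the process\<close>

text \<open>The hypothesis says that \<open>T\<close> carries the measure with density
  \<open>w\<close> to Lebesgue measure on the line. It lifts to \<open>n\<close> coordinates because
  a product measure is determined by boxes. Inversion with weight \<open>1 / x^2\<close> and
  translation with weight \<open>1\<close> are the two instances.\<close>

lemma PiM_lborel_transform:
  fixes T :: "real \<Rightarrow> real" and w :: "real \<Rightarrow> ennreal" and n :: nat
  assumes T [measurable]: "T \<in> borel_measurable borel" and w [measurable]: "w \<in> borel_measurable borel"
    and inv: "\<And>A. A \<in> sets borel \<Longrightarrow> (\<integral>\<^sup>+x. w x * indicator A (T x) \<partial>lborel) = emeasure lborel A"
  shows "distr (density (\<Pi>\<^sub>M i\<in>{..<n}. lborel) (\<lambda>y. \<Prod>i<n. w (y i))) (\<Pi>\<^sub>M i\<in>{..<n}. lborel) (\<lambda>y. \<lambda>i\<in>{..<n}. T (y i))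
    = (\<Pi>\<^sub>M i\<in>{..<n}. lborel)"
proof -
  interpret product_sigma_finite "\<lambda>_::nat. lborel :: real measure" ..
  let ?P = "\<Pi>\<^sub>M i\<in>{..<n}. lborel :: real measure"
  let ?T = "\<lambda>y. \<lambda>i\<in>{..<n}. T (y i)"
  have Tm [measurable]: "?T \<in> measurable ?P ?P"
    by (rule measurable_restrict) measurable
  have wm [measurable]: "(\<lambda>y. \<Prod>i<n. w (y i)) \<in> borel_measurable ?P" by measurable
  show ?thesis
  proof (rule PiM_eqI[of "{..<n}"])
    fix A :: "nat \<Rightarrow> real set" assume A: "\<And>i. i \<in> {..<n} \<Longrightarrow> A i \<in> sets lborel"
    have S: "Pi\<^sub>E {..<n} A \<in> sets ?P" using A by (intro sets_PiM_I_finite) auto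
    have "emeasure (distr (density ?P (\<lambda>y. \<Prod>i<n. w (y i))) ?P ?T) (Pi\<^sub>E {..<n} A)
        = (\<integral>\<^sup>+y. (\<Prod>i<n. w (y i)) * indicator (?T -` Pi\<^sub>E {..<n} A \<inter> space ?P) y \<partial>?P)"
      using S by (subst emeasure_distr) (auto intro!: emeasure_density)
    also have "\<dots> = (\<integral>\<^sup>+y. (\<Prod>i<n. w (y i) * indicator (A i) (T (y i))) \<partial>?P)"
    proof (rule nn_integral_cong)
      fix y assume y: "y \<in> space ?P"
      have "indicator (?T -` Pi\<^sub>E {..<n} A \<inter> space ?P) y = (\<Prod>i<n. indicator (A i) (T (y i)) :: ennreal)"
      proof (cases "\<forall>i<n. T (y i) \<in> A i")
        case True
        then show ?thesis using y by (auto simp: indicator_def)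
      next
        case False
        then obtain i where i: "i < n" "T (y i) \<notin> A i" by auto
        then have "(\<Prod>i<n. indicator (A i) (T (y i)) :: ennreal) = 0"
          by (intro prod_zero) (auto intro!: bexI[of _ i])
        moreover have "?T y \<notin> Pi\<^sub>E {..<n} A" using i by (auto simp: PiE_iff)
        ultimately show ?thesis by simp
      qed
      then show "(\<Prod>i<n. w (y i)) * indicator (?T -` Pi\<^sub>E {..<n} A \<inter> space ?P) y = (\<Prod>i<n. w (y i) * indicator (A i) (T (y i)))"
        by (simp add: prod.distrib)
    qed
    also have "\<dots> = (\<Prod>i<n. \<integral>\<^sup>+x. w x * indicator (A i) (T x) \<partial>lborel)"
      using A by (intro product_nn_integral_prod) auto
    also have "\<dots> = (\<Prod>i<n. emeasure lborel (A i))"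
      using A by (intro prod.cong refl inv) auto
    finally show "emeasure (distr (density ?P (\<lambda>y. \<Prod>i<n. w (y i))) ?P ?T) (Pi\<^sub>E {..<n} A) = (\<Prod>i<n. emeasure lborel (A i))" .
  qed auto
qed

lemma integral_PiM_lborel_transform:
  fixes T w :: "real \<Rightarrow> real" and f :: "(nat \<Rightarrow> real) \<Rightarrow> 'b :: {banach, second_countable_topology}" and n :: nat
  assumes T [measurable]: "T \<in> borel_measurable borel" and w [measurable]: "w \<in> borel_measurable borel"
    and w0: "\<And>x. w x \<ge> 0"
    and inv: "\<And>A. A \<in> sets borel \<Longrightarrow> (\<integral>\<^sup>+x. ennreal (w x) * indicator A (T x) \<partial>lborel) = emeasure lborel A"
    and f: "f \<in> borel_measurable (\<Pi>\<^sub>M i\<in>{..<n}. lborel)"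
  shows "(\<integral>y. f y \<partial>(\<Pi>\<^sub>M i\<in>{..<n}. lborel)) = (\<integral>y. (\<Prod>i<n. w (y i)) *\<^sub>R f (\<lambda>i\<in>{..<n}. T (y i)) \<partial>(\<Pi>\<^sub>M i\<in>{..<n}. lborel))"
proof -
  let ?P = "\<Pi>\<^sub>M i\<in>{..<n}. lborel :: real measure"
  let ?T = "\<lambda>y. \<lambda>i\<in>{..<n}. T (y i)"
  have Tm [measurable]: "?T \<in> measurable ?P ?P"
    by (rule measurable_restrict) measurable
  have wm [measurable]: "(\<lambda>y. \<Prod>i<n. w (y i)) \<in> borel_measurable ?P" by measurable
  have e: "(\<lambda>y. \<Prod>i<n. ennreal (w (y i))) = (\<lambda>y. ennreal (\<Prod>i<n. w (y i)))"
    using w0 by (simp add: prod_ennreal)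
  have D: "distr (density ?P (\<lambda>y. ennreal (\<Prod>i<n. w (y i)))) ?P ?T = ?P"
    using PiM_lborel_transform[of T "\<lambda>x. ennreal (w x)" n] inv unfolding e by simp
  have "(\<integral>y. f y \<partial>?P) = (\<integral>y. f y \<partial>(distr (density ?P (\<lambda>y. ennreal (\<Prod>i<n. w (y i)))) ?P ?T))"
    unfolding D ..
  also have "\<dots> = (\<integral>y. f (?T y) \<partial>(density ?P (\<lambda>y. ennreal (\<Prod>i<n. w (y i)))))"
    by (rule integral_distr) (use f in auto)
  also have "\<dots> = (\<integral>y. (\<Prod>i<n. w (y i)) *\<^sub>R f (?T y) \<partial>?P)"
    by (rule integral_density) (use w0 f in \<open>auto intro!: prod_nonneg measurable_compose[OF Tm]\<close>)
  finally show ?thesis .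
qed

lemma nn_integral_lborel_shift:
  fixes a :: real
  assumes [measurable]: "A \<in> sets borel"
  shows "(\<integral>\<^sup>+x. ennreal 1 * indicator A (x + a) \<partial>lborel) = emeasure lborel A"
proof -
  have "(\<integral>\<^sup>+x. indicator A x \<partial>lborel) = (\<integral>\<^sup>+x. indicator A (a + 1 * x) \<partial>lborel)"
    using nn_integral_real_affine[of "indicator A" 1 a] by simp
  then show ?thesis by (simp add: add.commute)
qed

text \<open>The substitution rule is for increasing maps, so it is applied to \<open>- 1 / x\<close>
  and the sign is undone by a reflection.\<close>

lemma nn_integral_inversion_Icc:
  fixes a b :: real
  assumes A [measurable]: "A \<in> sets borel" and ab: "0 < a" "a \<le> b"
  shows "(\<integral>\<^sup>+x. ennreal ((1 / x)\<^sup>2) * indicator A (1 / x) * indicator {a..b} x \<partial>lborel) = emeasure lborel (A \<inter> {1/b..1/a})"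
proof -
  let ?f = "\<lambda>y. indicator A (- y) :: real"
  have "(\<integral>\<^sup>+x. ?f x * indicator {- 1 / a..- 1 / b} x \<partial>lborel)
      = (\<integral>\<^sup>+x. ?f (- 1 / x) * (1 / x)\<^sup>2 * indicator {a..b} x \<partial>lborel)"
    by (rule nn_integral_substitution[where g = "\<lambda>x. - 1 / x"])
       (use ab in \<open>auto intro!: derivative_eq_intros continuous_intros simp: power2_eq_square set_borel_measurable_def\<close>)
  also have "\<dots> = (\<integral>\<^sup>+x. ennreal ((1 / x)\<^sup>2) * indicator A (1 / x) * indicator {a..b} x \<partial>lborel)"
    by (intro nn_integral_cong) (auto simp: indicator_def)
  also have "(\<integral>\<^sup>+x. ?f x * indicator {- 1 / a..- 1 / b} x \<partial>lborel) = (\<integral>\<^sup>+x. indicator (A \<inter> {1/b..1/a}) (0 + -1 * x) \<partial>lborel)"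
    by (intro nn_integral_cong) (auto simp: indicator_def)
  also have "\<dots> = (\<integral>\<^sup>+x. indicator (A \<inter> {1/b..1/a}) x \<partial>lborel)"
    using nn_integral_real_affine[of "indicator (A \<inter> {1/b..1/a})" "-1" 0] by simp
  finally show ?thesis by simp
qed

lemma nn_integral_inversion_pos:
  assumes A [measurable]: "A \<in> sets (borel :: real measure)"
  shows "(\<integral>\<^sup>+x. ennreal ((1 / x)\<^sup>2) * indicator A (1 / x) * indicator {0<..} x \<partial>lborel) = emeasure lborel (A \<inter> {0<..})"
proof -
  define J where "J n = {1 / real (Suc n)..real (Suc n)}" for n
  have J: "incseq J" unfolding incseq_def J_def by (auto simp: frac_le order_trans)
  have UJ: "(\<Union>n. J n) = {0<..}"
  proof (intro equalityI subsetI)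
    fix x :: real assume "x \<in> {0<..}"
    then have x: "x > 0" by simp
    obtain n :: nat where n: "max x (1 / x) < real n" using reals_Archimedean2 by blast
    then have "1 / x \<le> real (Suc n)" "x \<le> real (Suc n)" by auto
    then have "x \<in> J n" using x by (simp add: J_def field_simps)
    then show "x \<in> (\<Union>n. J n)" by blast
  qed (auto simp: J_def order_less_le_trans[of 0 "1 / real (Suc _)"] intro: order_less_le_trans[rotated] simp del: of_nat_Suc)
  let ?g = "\<lambda>x. ennreal ((1 / x)\<^sup>2) * indicator A (1 / x)"
  have [measurable]: "J n \<in> sets borel" for n by (simp add: J_def)
  have "(\<integral>\<^sup>+x. ?g x * indicator {0<..} x \<partial>lborel) = emeasure (density lborel ?g) (\<Union>n. J n)"
    unfolding UJ by (subst emeasure_density) auto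
  also have "\<dots> = (SUP n. emeasure (density lborel ?g) (J n))"
    using J by (intro SUP_emeasure_incseq[symmetric]) auto
  also have "\<dots> = (SUP n. \<integral>\<^sup>+x. ?g x * indicator (J n) x \<partial>lborel)"
    by (intro SUP_cong refl) (auto intro!: emeasure_density)
  also have "\<dots> = (SUP n. emeasure lborel (A \<inter> J n))"
  proof (intro SUP_cong refl)
    fix n
    have "1 / real (Suc n) \<le> 1" by simp
    also have "1 \<le> real (Suc n)" by simp
    finally show "(\<integral>\<^sup>+x. ?g x * indicator (J n) x \<partial>lborel) = emeasure lborel (A \<inter> J n)"
      unfolding J_def using nn_integral_inversion_Icc[OF A, of "1 / real (Suc n)" "real (Suc n)"] by simp
  qed
  also have "\<dots> = emeasure lborel (\<Union>n. A \<inter> J n)"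
  proof (rule SUP_emeasure_incseq)
    show "incseq (\<lambda>n. A \<inter> J n)" using J unfolding incseq_def by blast
  qed auto
  also have "(\<Union>n. A \<inter> J n) = A \<inter> {0<..}" using UJ by blast
  finally show ?thesis .
qed

text \<open>The two half lines are treated separately. The origin is a null set, and with
  \<open>1 / 0 = 0\<close> the weight vanishes there anyway.\<close>

lemma nn_integral_inversion:
  assumes A [measurable]: "A \<in> sets (borel :: real measure)"
  shows "(\<integral>\<^sup>+x. ennreal ((1 / x)\<^sup>2) * indicator A (1 / x) \<partial>lborel) = emeasure lborel A"
proof -
  let ?g = "\<lambda>x. ennreal ((1 / x)\<^sup>2) * indicator A (1 / x)"
  define B where "B = {x. - x \<in> A}"
  have [measurable]: "B \<in> sets borel"
    using measurable_sets[of uminus borel borel A] by (simp add: B_def vimage_def)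
  have "(\<integral>\<^sup>+x. ?g x \<partial>lborel) = (\<integral>\<^sup>+x. ?g x * indicator {0<..} x + ?g x * indicator {..<0} x \<partial>lborel)"
    by (intro nn_integral_cong) (auto simp: indicator_def)
  also have "\<dots> = (\<integral>\<^sup>+x. ?g x * indicator {0<..} x \<partial>lborel) + (\<integral>\<^sup>+x. ?g x * indicator {..<0} x \<partial>lborel)"
    by (intro nn_integral_add) auto
  also have "(\<integral>\<^sup>+x. ?g x * indicator {..<0} x \<partial>lborel) = (\<integral>\<^sup>+x. ennreal ((1 / x)\<^sup>2) * indicator B (1 / x) * indicator {0<..} x \<partial>lborel)"
  proof -
    have "(\<integral>\<^sup>+x. ?g x * indicator {..<0} x \<partial>lborel) = (\<integral>\<^sup>+x. ?g (0 + -1 * x) * indicator {..<0} (0 + -1 * x) \<partial>lborel)"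
      using nn_integral_real_affine[of "\<lambda>x. ?g x * indicator {..<0} x" "-1" 0] by simp
    also have "\<dots> = (\<integral>\<^sup>+x. ennreal ((1 / x)\<^sup>2) * indicator B (1 / x) * indicator {0<..} x \<partial>lborel)"
      by (intro nn_integral_cong) (auto simp: indicator_def B_def)
    finally show ?thesis .
  qed
  also have "\<dots> = emeasure lborel (B \<inter> {0<..})"
    by (rule nn_integral_inversion_pos) simp
  also have "\<dots> = (\<integral>\<^sup>+x. indicator (B \<inter> {0<..}) (0 + -1 * x) \<partial>lborel)"
    using nn_integral_real_affine[of "indicator (B \<inter> {0<..})" "-1" 0] by simp
  also have "\<dots> = (\<integral>\<^sup>+x. indicator (A \<inter> {..<0}) x \<partial>lborel)"
    by (intro nn_integral_cong) (auto simp: indicator_def B_def)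
  also have "(\<integral>\<^sup>+x. ?g x * indicator {0<..} x \<partial>lborel) = (\<integral>\<^sup>+x. indicator (A \<inter> {0<..}) x \<partial>lborel)"
    using nn_integral_inversion_pos[OF A] by simp
  also have "(\<integral>\<^sup>+x. indicator (A \<inter> {0<..}) x \<partial>lborel) + (\<integral>\<^sup>+x. indicator (A \<inter> {..<0}) x \<partial>lborel)
      = (\<integral>\<^sup>+x. indicator (A \<inter> {0<..}) x + indicator (A \<inter> {..<0}) x \<partial>lborel)"
    by (intro nn_integral_add[symmetric]) auto
  also have "\<dots> = (\<integral>\<^sup>+x. indicator A x \<partial>lborel)"
  proof (rule nn_integral_cong_AE)
    have "AE x in lborel. x \<noteq> (0::real)" by (rule AE_lborel_singleton)
    then show "AE x in lborel. indicator (A \<inter> {0<..}) x + indicator (A \<inter> {..<0}) x = (indicator A x :: ennreal)"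
      by eventually_elim (auto simp: indicator_def)
  qed
  finally show ?thesis by simp
qed

section \<open>Correlation functions after inversion\<close>

lemma finite_distinct_tuples: "finite X \<Longrightarrow> finite (distinct_tuples n X)"
  unfolding distinct_tuples_def by (rule finite_subset[OF _ finite_PiE[of "{..<n}" "\<lambda>_. X"]]) auto

lemma distinct_tuples_mono: "X \<subseteq> Y \<Longrightarrow> distinct_tuples n X \<subseteq> distinct_tuples n Y"
  unfolding distinct_tuples_def by auto

text \<open>Turns the infinite sum of \<open>determinantal_process\<close> into a finite one: tuples
  that leave the support contribute \<open>0\<close>, and local finiteness leaves finitely many
  others.\<close>

lemma infsum_distinct_tuples:
  fixes F :: "(nat \<Rightarrow> real) \<Rightarrow> real"
  assumes "finite (X \<inter> K)" "\<And>y. y \<notin> {..<n} \<rightarrow>\<^sub>E K \<Longrightarrow> F y = 0"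
  shows "(\<Sum>\<^sub>\<infinity>y\<in>distinct_tuples n X. F y) = (\<Sum>y\<in>distinct_tuples n (X \<inter> K). F y)"
proof -
  have "(\<Sum>\<^sub>\<infinity>y\<in>distinct_tuples n X. F y) = (\<Sum>\<^sub>\<infinity>y\<in>distinct_tuples n (X \<inter> K). F y)"
    by (rule infsum_cong_neutral) (use assms(2) in \<open>auto simp: distinct_tuples_def PiE_iff\<close>)
  then show ?thesis using finite_distinct_tuples[OF assms(1)] by simp
qed

text \<open>Inversion exchanges \<open>shell d B\<close> with \<open>shell (1 / B) (1 / d)\<close>,
  so for positive radii such annuli serve as compact supports on both sides of it.\<close>

definition shell :: "real \<Rightarrow> real \<Rightarrow> real set" where
  "shell d B = {u. d \<le> \<bar>u\<bar> \<and> \<bar>u\<bar> \<le> B}"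

lemma compact_shell: "compact (shell d B)"
proof -
  have "shell d B = {-B..B} \<inter> {u. d \<le> \<bar>u\<bar>}" by (auto simp: shell_def)
  moreover have "closed {u::real. d \<le> \<bar>u\<bar>}" by (intro closed_Collect_le continuous_intros)
  ultimately show ?thesis by (simp add: compact_Int_closed)
qed

lemma sets_shell [measurable]: "shell d B \<in> sets borel"
  using compact_shell by (simp add: compact_imp_closed)

lemma inverse_mem_shell_iff:
  "0 < d \<Longrightarrow> 0 < B \<Longrightarrow> 1 / x \<in> shell d B \<longleftrightarrow> x \<in> shell (1 / B) (1 / d)"
  by (cases "x = 0") (auto simp: shell_def field_simps)

lemma sine_det_cong: "(\<And>i. i < n \<Longrightarrow> u i = v i) \<Longrightarrow> sine_det n u = sine_det n v"
  unfolding sine_det_def by (intro arg_cong[of _ _ Determinant.det] eq_matI) auto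

text \<open>The factor \<open>\<Prod>i<n. (1 / y i)\<^sup>2\<close> split off by
  \<open>det_kernel_K\<close> is exactly the Jacobian of coordinatewise inversion; the change of
  variables absorbs it and leaves \<open>sine_det\<close>.\<close>

lemma process_C_correlation:
  assumes C: "is_process_C 0 M C" and d: "0 < d" "0 < B"
    and F [measurable]: "F \<in> borel_measurable (\<Pi>\<^sub>M i\<in>{..<n}. borel)" and bF: "\<And>y. \<bar>F y\<bar> \<le> c"
    and supp: "\<And>y. y \<notin> {..<n} \<rightarrow>\<^sub>E shell d B \<Longrightarrow> F y = 0"
  shows "has_bochner_integral M (\<lambda>\<omega>. \<Sum>y\<in>distinct_tuples n ((\<lambda>x. 1 / x) ` C \<omega> \<inter> shell d B). F y)
           (\<integral>y. F y * sine_det n y \<partial>(\<Pi>\<^sub>M i\<in>{..<n}. lborel))"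
proof -
  let ?P = "\<Pi>\<^sub>M i\<in>{..<n}. lborel :: real measure"
  define K where "K = shell (1 / B) (1 / d)"
  define T where "T = (\<lambda>y::nat \<Rightarrow> real. \<lambda>i\<in>{..<n}. 1 / y i)"
  \<comment> \<open>The restriction also discards functions \<open>y\<close> that are not
    extensional: \<open>T\<close> ignores their values outside \<open>{..<n}\<close>, so
    \<open>F (T y)\<close> alone could be nonzero there and would not be a test function.\<close>
  define F' where "F' y = (if y \<in> {..<n} \<rightarrow>\<^sub>E K then F (T y) else 0)" for y
  have K: "compact K" "K \<subseteq> - {0}" using d by (auto simp: K_def compact_shell) (auto simp: shell_def)
  have PP: "sets ?P = sets (\<Pi>\<^sub>M i\<in>{..<n}. borel)" by (intro sets_PiM_cong) auto
  have T [measurable]: "T \<in> measurable (\<Pi>\<^sub>M i\<in>{..<n}. borel) (\<Pi>\<^sub>M i\<in>{..<n}. borel)"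
    unfolding T_def by (rule measurable_restrict) measurable
  have KE [measurable]: "({..<n} \<rightarrow>\<^sub>E K) \<in> sets (\<Pi>\<^sub>M i\<in>{..<n}. borel)"
    by (intro sets_PiM_I_finite) (auto simp: K_def)
  have F'm: "F' \<in> borel_measurable (\<Pi>\<^sub>M i\<in>{..<n}. borel)"
    unfolding F'_def[abs_def] by measurable
  have test: "test_function (- {0}) n F'"
    unfolding test_function_def
  proof (intro conjI)
    show "F' \<in> borel_measurable (\<Pi>\<^sub>M i\<in>{..<n}. borel)" by (rule F'm)
    have "0 \<le> c" using bF[of undefined] by linarith
    then show "bounded (range F')" unfolding bounded_iff using bF by (intro exI[of _ c]) (auto simp: F'_def)
    show "\<exists>K. compact K \<and> K \<subseteq> - {0} \<and> (\<forall>y. y \<notin> {..<n} \<rightarrow>\<^sub>E K \<longrightarrow> F' y = 0)"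
      using K by (intro exI[of _ K]) (auto simp: F'_def)
  qed
  have TK: "T y \<in> {..<n} \<rightarrow>\<^sub>E shell d B \<longleftrightarrow> (\<forall>i<n. y i \<in> K)" for y
    using inverse_mem_shell_iff[OF d] by (auto simp: T_def K_def PiE_iff)
  have sums: "(\<Sum>\<^sub>\<infinity>y\<in>distinct_tuples n (C \<omega>). F' y) = (\<Sum>y\<in>distinct_tuples n ((\<lambda>x. 1 / x) ` C \<omega> \<inter> shell d B). F y)"
    if \<omega>: "\<omega> \<in> space M" for \<omega>
  proof -
    have fin: "finite (C \<omega> \<inter> K)"
      using C K \<omega> by (auto simp: is_process_C_def determinantal_process_def point_configuration_def)
    have img: "1 / x \<in> (\<lambda>x. 1 / x) ` C \<omega> \<inter> shell d B" if "x \<in> C \<omega> \<inter> K" for x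
      using that inverse_mem_shell_iff[OF d, of x] by (simp add: K_def)
    have img': "1 / x \<in> C \<omega> \<inter> K" if x: "x \<in> (\<lambda>x. 1 / x) ` C \<omega> \<inter> shell d B" for x
    proof -
      obtain c where c: "c \<in> C \<omega>" "x = 1 / c" "1 / c \<in> shell d B" using x by blast
      then have "c \<in> K" using inverse_mem_shell_iff[OF d, of c] by (simp add: K_def)
      then show ?thesis using c by simp
    qed
    have "(\<Sum>\<^sub>\<infinity>y\<in>distinct_tuples n (C \<omega>). F' y) = (\<Sum>y\<in>distinct_tuples n (C \<omega> \<inter> K). F' y)"
      by (rule infsum_distinct_tuples[OF fin]) (auto simp: F'_def)
    also have "\<dots> = (\<Sum>y\<in>distinct_tuples n ((\<lambda>x. 1 / x) ` C \<omega> \<inter> shell d B). F y)"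
    proof (rule sum.reindex_bij_witness[of _ T T])
      fix y assume y: "y \<in> distinct_tuples n (C \<omega> \<inter> K)"
      then have yE: "y \<in> {..<n} \<rightarrow>\<^sub>E C \<omega> \<inter> K" "inj_on y {..<n}" by (auto simp: distinct_tuples_def)
      show "T (T y) = y" using yE(1) by (auto simp: T_def fun_eq_iff PiE_iff extensional_def)
      have "inj_on (T y) {..<n}" using yE(2) by (auto simp: T_def inj_on_def)
      then show "T y \<in> distinct_tuples n ((\<lambda>x. 1 / x) ` C \<omega> \<inter> shell d B)"
        using yE(1) img by (auto simp: distinct_tuples_def T_def PiE_iff)
      have "y \<in> {..<n} \<rightarrow>\<^sub>E K" using yE(1) by (auto simp: PiE_iff)
      then show "F (T y) = F' y" by (simp add: F'_def)
    next
      fix y assume y: "y \<in> distinct_tuples n ((\<lambda>x. 1 / x) ` C \<omega> \<inter> shell d B)"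
      then have yE: "y \<in> {..<n} \<rightarrow>\<^sub>E (\<lambda>x. 1 / x) ` C \<omega> \<inter> shell d B" "inj_on y {..<n}" by (auto simp: distinct_tuples_def)
      show "T (T y) = y" using yE(1) by (auto simp: T_def fun_eq_iff PiE_iff extensional_def)
      have "inj_on (T y) {..<n}" using yE(2) by (auto simp: T_def inj_on_def)
      then show "T y \<in> distinct_tuples n (C \<omega> \<inter> K)"
        using yE(1) img' by (auto simp: distinct_tuples_def T_def PiE_iff)
    qed
    finally show ?thesis .
  qed
  have "(LINT y:({..<n} \<rightarrow>\<^sub>E - {0})|?P. F' y * Determinant.det (Matrix.mat n n (\<lambda>(i, j). kernel_K 0 (y i) (y j))))
      = (\<integral>y. (\<Prod>i<n. (1 / y i)\<^sup>2) *\<^sub>R (F (T y) * sine_det n (T y)) \<partial>?P)"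
    unfolding set_lebesgue_integral_def
  proof (rule Bochner_Integration.integral_cong[OF refl])
    fix y assume "y \<in> space ?P"
    then have ext: "y \<in> extensional {..<n}" by (auto simp: space_PiM PiE_iff)
    show "indicator ({..<n} \<rightarrow>\<^sub>E - {0}) y *\<^sub>R (F' y * Determinant.det (Matrix.mat n n (\<lambda>(i, j). kernel_K 0 (y i) (y j))))
        = (\<Prod>i<n. (1 / y i)\<^sup>2) *\<^sub>R (F (T y) * sine_det n (T y))"
    proof (cases "\<forall>i<n. y i \<noteq> 0")
      case True
      then have 1: "y \<in> {..<n} \<rightarrow>\<^sub>E - {0}" using ext by (auto simp: PiE_iff)
      have "F' y = F (T y)"
        using supp[of "T y"] TK[of y] ext by (auto simp: F'_def PiE_iff)
      moreover have "sine_det n (\<lambda>i. 1 / y i) = sine_det n (T y)" by (rule sine_det_cong) (simp add: T_def)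
      ultimately show ?thesis using 1 True by (simp add: det_kernel_K)
    next
      case False
      then obtain i where i: "i < n" "y i = 0" by auto
      then have "(\<Prod>i<n. (1 / y i)\<^sup>2) = 0" by (intro prod_zero) (auto intro!: bexI[of _ i])
      moreover have "y \<notin> {..<n} \<rightarrow>\<^sub>E - {0}" using i by (auto simp: PiE_iff)
      ultimately show ?thesis by simp
    qed
  qed
  also have "\<dots> = (\<integral>y. F y * sine_det n y \<partial>?P)"
    unfolding T_def
  proof (rule integral_PiM_lborel_transform[symmetric])
    show "(\<lambda>y. F y * sine_det n y) \<in> borel_measurable ?P"
      by (subst measurable_cong_sets[OF PP refl]) measurable
  qed (auto intro!: nn_integral_inversion)
  finally have int: "(LINT y:({..<n} \<rightarrow>\<^sub>E - {0})|?P. F' y * Determinant.det (Matrix.mat n n (\<lambda>(i, j). kernel_K 0 (y i) (y j))))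
      = (\<integral>y. F y * sine_det n y \<partial>?P)" .
  have "has_bochner_integral M (\<lambda>\<omega>. \<Sum>\<^sub>\<infinity>y\<in>distinct_tuples n (C \<omega>). F' y) (\<integral>y. F y * sine_det n y \<partial>?P)"
    using C test unfolding is_process_C_def determinantal_process_def int[symmetric] by blast
  then show ?thesis
    by (rule has_bochner_integral_cong[THEN iffD1, rotated 3]) (auto simp: sums)
qed

lemma sum_distinct_tuples_1:
  fixes g :: "real \<Rightarrow> 'b :: comm_monoid_add"
  shows "(\<Sum>y\<in>distinct_tuples (Suc 0) X. g (y 0)) = (\<Sum>x\<in>X. g x)"
  by (rule sum.reindex_bij_witness[of _ "\<lambda>x. \<lambda>i\<in>{..<Suc 0}. x" "\<lambda>y. y 0"])
     (auto simp: distinct_tuples_def PiE_iff extensional_def fun_eq_iff inj_on_def)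

lemma integral_PiM_1:
  fixes g :: "real \<Rightarrow> 'b :: {banach, second_countable_topology}"
  assumes "g \<in> borel_measurable borel"
  shows "(\<integral>y. g (y 0) \<partial>(\<Pi>\<^sub>M i\<in>{..<Suc 0}. lborel)) = (\<integral>x. g x \<partial>lborel)"
proof -
  interpret product_sigma_finite "\<lambda>_::nat. lborel :: real measure" ..
  have "{..<Suc 0} = {0}" by auto
  then show ?thesis using product_integral_singleton[of g 0] assms by simp
qed

section \<open>The inverted process near the origin\<close>

lemma finite_Union_bounded_card:
  fixes A :: "nat \<Rightarrow> 'b set"
  assumes inc: "incseq A" and fin: "\<And>k. finite (A k)" and card: "\<And>k. card (A k) \<le> m"
  shows "finite (\<Union>k. A k)"
proof (rule ccontr)
  assume "infinite (\<Union>k. A k)"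
  then obtain F where F: "finite F" "card F = Suc m" "F \<subseteq> (\<Union>k. A k)"
    using infinite_arbitrarily_large by blast
  have "\<exists>k. F \<subseteq> A k"
    using F(1,3)
  proof (induction F)
    case (insert x F)
    then obtain k l where "F \<subseteq> A k" "x \<in> A l" by auto
    moreover have "A k \<subseteq> A (max k l)" "A l \<subseteq> A (max k l)" using inc by (auto simp: incseq_def)
    ultimately show ?case by (intro exI[of _ "max k l"]) auto
  qed auto
  then obtain k where "F \<subseteq> A k" ..
  then have "Suc m \<le> card (A k)" using card_mono[OF fin] F(2) by metis
  with card[of k] show False by simp
qed

text \<open>The interface between the given process and the probabilistic argument. Correlations are
  required on windows that contain the origin, whereas inversion by itself yields them only on
  shells that stay away from it.\<close>

locale sine_process = prob_space M for M :: "'a measure" +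
  fixes D :: "'a \<Rightarrow> real set"
  assumes finite_window: "\<omega> \<in> space M \<Longrightarrow> finite (D \<omega> \<inter> {-B..B})"
    and zero_notin: "\<omega> \<in> space M \<Longrightarrow> 0 \<notin> D \<omega>"
    and correlation: "0 < B \<Longrightarrow> F \<in> borel_measurable (\<Pi>\<^sub>M i\<in>{..<n}. borel) \<Longrightarrow> (\<And>y. \<bar>F y\<bar> \<le> c) \<Longrightarrow>
      (\<And>y. y \<notin> {..<n} \<rightarrow>\<^sub>E {-B..B} \<Longrightarrow> F y = 0) \<Longrightarrow>
      has_bochner_integral M (\<lambda>\<omega>. \<Sum>y\<in>distinct_tuples n (D \<omega> \<inter> {-B..B}). F y)
        (\<integral>y. F y * sine_det n y \<partial>(\<Pi>\<^sub>M i\<in>{..<n}. lborel))"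

lemma integrable_indicator_cube:
  fixes n :: nat
  shows "integrable (\<Pi>\<^sub>M i\<in>{..<n}. lborel) (\<lambda>y. indicator ({..<n} \<rightarrow>\<^sub>E {-B..B::real}) y * k :: real)"
proof -
  interpret product_sigma_finite "\<lambda>_::nat. lborel :: real measure" ..
  have "emeasure (\<Pi>\<^sub>M i\<in>{..<n}. lborel) ({..<n} \<rightarrow>\<^sub>E {-B..B}) = (\<Prod>i<n. emeasure lborel {-B..B})"
    by (rule emeasure_PiM) auto
  also have "\<dots> < \<infinity>" by (auto simp: emeasure_lborel_Icc_eq ennreal_power power_0_left)
  finally show ?thesis
    by (intro integrable_mult_left integrable_real_indicator) (auto intro!: sets_PiM_I_finite)
qed

lemma AE_PiM_lborel_nonzero:
  fixes n :: nat
  shows "AE y in (\<Pi>\<^sub>M i\<in>{..<n}. lborel). \<forall>i<n. y i \<noteq> (0::real)"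
proof -
  interpret product_sigma_finite "\<lambda>_::nat. lborel :: real measure" ..
  have "AE y in (\<Pi>\<^sub>M i\<in>{..<n}. lborel). y i \<noteq> (0::real)" if i: "i < n" for i
  proof (rule AE_I)
    let ?A = "\<lambda>j. if j = i then {0::real} else UNIV"
    show "{y \<in> space (\<Pi>\<^sub>M i\<in>{..<n}. lborel). \<not> y i \<noteq> (0::real)} \<subseteq> Pi\<^sub>E {..<n} ?A"
      by (auto simp: space_PiM PiE_iff extensional_def)
    have "emeasure (\<Pi>\<^sub>M i\<in>{..<n}. lborel) (Pi\<^sub>E {..<n} ?A) = (\<Prod>j<n. emeasure lborel (?A j))"
      by (rule emeasure_PiM) auto
    also have "\<dots> = 0" using i by (intro prod_zero) (auto intro!: bexI[of _ i])
    finally show "emeasure (\<Pi>\<^sub>M i\<in>{..<n}. lborel) (Pi\<^sub>E {..<n} ?A) = 0" .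
    show "Pi\<^sub>E {..<n} ?A \<in> sets (\<Pi>\<^sub>M i\<in>{..<n}. lborel)" by (rule sets_PiM_I_finite) auto
  qed
  then have "\<forall>i\<in>{..<n}. AE y in (\<Pi>\<^sub>M i\<in>{..<n}. lborel). y i \<noteq> (0::real)" by simp
  then have "AE y in (\<Pi>\<^sub>M i\<in>{..<n}. lborel). \<forall>i\<in>{..<n}. y i \<noteq> (0::real)"
    by (subst AE_ball_countable) auto
  then show ?thesis by eventually_elim auto
qed

lemma eventually_subset_shell:
  assumes "finite X" "0 \<notin> X" "X \<subseteq> {-B..B}"
  shows "eventually (\<lambda>k. X \<subseteq> shell (1 / real (Suc k)) B) sequentially"
proof -
  have "eventually (\<lambda>k. \<forall>x\<in>X. x \<in> shell (1 / real (Suc k)) B) sequentially"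
  proof (rule eventually_ball_finite[OF assms(1)], rule ballI)
    fix x assume x: "x \<in> X"
    then have "0 < \<bar>x\<bar>" using assms(2) by auto
    have "(\<lambda>k. 1 / real (Suc k)) \<longlonglongrightarrow> 0" using LIMSEQ_Suc[OF lim_1_over_n] by simp
    then have "eventually (\<lambda>k. 1 / real (Suc k) < \<bar>x\<bar>) sequentially"
      using \<open>0 < \<bar>x\<bar>\<close> by (rule order_tendstoD)
    then show "eventually (\<lambda>k. x \<in> shell (1 / real (Suc k)) B) sequentially"
      by eventually_elim (use x assms(3) in \<open>auto simp: shell_def abs_le_iff simp del: of_nat_Suc\<close>)
  qed
  then show ?thesis by eventually_elim auto
qed

lemma shell_subset: "shell d B \<subseteq> {-B..B}"
  by (auto simp: shell_def)

context
  fixes M :: "'a measure" and C :: "'a \<Rightarrow> real set"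
  assumes C: "is_process_C 0 M C"
begin

lemma process_prob_space: "prob_space M"
  and process_nonzero: "\<omega> \<in> space M \<Longrightarrow> 0 \<notin> C \<omega>"
  and process_finite: "\<omega> \<in> space M \<Longrightarrow> compact K \<Longrightarrow> K \<subseteq> - {0} \<Longrightarrow> finite (C \<omega> \<inter> K)"
  using C by (auto simp: is_process_C_def determinantal_process_def point_configuration_def compact_imp_closed)

lemma process_card:
  assumes "compact K" "K \<subseteq> - {0}"
  shows "(\<lambda>\<omega>. card (C \<omega> \<inter> K)) \<in> measurable M (count_space UNIV)"
proof -
  have "K \<in> sets borel" using assms(1) by (simp add: compact_imp_closed)
  then show ?thesis
    using C assms unfolding is_process_C_def determinantal_process_def point_configuration_def by blast
qed

text \<open>
  Local finiteness in \<open>- {0}\<close> still allows \<open>C \<omega>\<close> to be unbounded, in which case the inverted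
  configuration accumulates at \<open>0\<close>; on this null set the inverted process is set to be empty, in
  agreement with the junk value \<open>0\<close> of the infinite sums in \<open>pv_sum\<close>.
\<close>

definition process_good :: "'a set" where
  "process_good = {\<omega> \<in> space M. \<exists>m. \<forall>k. card (C \<omega> \<inter> shell 1 (real (Suc k))) \<le> m}"

definition inverse_process :: "'a \<Rightarrow> real set" where
  "inverse_process \<omega> = (if \<omega> \<in> process_good then (\<lambda>x. 1 / x) ` C \<omega> else {})"

lemma shell_1_nonzero: "shell 1 B \<subseteq> - {0}"
  by (auto simp: shell_def)

lemma card_shell_measurable [measurable]:
  "(\<lambda>\<omega>. card (C \<omega> \<inter> shell 1 (real (Suc k)))) \<in> measurable M (count_space UNIV)"
  by (rule process_card[OF compact_shell shell_1_nonzero])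

lemma sets_process_good [measurable]: "process_good \<in> sets M"
  unfolding process_good_def by measurable

lemma inverse_image_shell:
  "0 < d \<Longrightarrow> 0 < B \<Longrightarrow> (\<lambda>x. 1 / x) ` C \<omega> \<inter> shell d B = (\<lambda>x. 1 / x) ` (C \<omega> \<inter> shell (1 / B) (1 / d))"
  using inverse_mem_shell_iff[of d B] by blast

lemma inj_reciprocal: "inj_on (\<lambda>x::real. 1 / x) A"
  by (auto simp: inj_on_def)

text \<open>Inversion identifies the number of points of \<open>C\<close> in
  \<open>shell 1 (Suc k)\<close> with the number of inverted points in a subset of
  \<open>{-1..1}\<close>. With density \<open>1 / pi\<close> its expectation is at most
  \<open>2 / pi\<close> for every \<open>k\<close>, and monotone convergence makes the supremum
  finite almost surely.\<close>

lemma AE_process_good: "AE \<omega> in M. \<omega> \<in> process_good"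
proof -
  interpret prob_space M by (rule process_prob_space)
  define N where "N k \<omega> = card (C \<omega> \<inter> shell 1 (real (Suc k)))" for k \<omega>
  have Nm [measurable]: "N k \<in> measurable M (count_space UNIV)" for k
    unfolding N_def[abs_def] by measurable
  have bnd: "(\<integral>\<^sup>+\<omega>. ennreal (real (N k \<omega>)) \<partial>M) \<le> ennreal (2 / pi)" for k
  proof -
    let ?d = "1 / real (Suc k)"
    let ?F = "\<lambda>y::nat \<Rightarrow> real. indicator ({..<Suc 0} \<rightarrow>\<^sub>E shell ?d 1) y :: real"
    have SE: "({..<Suc 0} \<rightarrow>\<^sub>E shell ?d 1) \<in> sets (\<Pi>\<^sub>M i\<in>{..<Suc 0}. borel)"
      by (intro sets_PiM_I_finite) auto
    have "has_bochner_integral M (\<lambda>\<omega>. \<Sum>y\<in>distinct_tuples (Suc 0) ((\<lambda>x. 1 / x) ` C \<omega> \<inter> shell ?d 1). ?F y)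
           (\<integral>y. ?F y * sine_det (Suc 0) y \<partial>(\<Pi>\<^sub>M i\<in>{..<Suc 0}. lborel))"
      by (rule process_C_correlation[OF C, where c = 1]) (use SE in \<open>auto simp: indicator_def\<close>)
    moreover have "(\<Sum>y\<in>distinct_tuples (Suc 0) ((\<lambda>x. 1 / x) ` C \<omega> \<inter> shell ?d 1). ?F y) = real (N k \<omega>)" for \<omega>
    proof -
      have "(\<Sum>y\<in>distinct_tuples (Suc 0) ((\<lambda>x. 1 / x) ` C \<omega> \<inter> shell ?d 1). ?F y)
          = (\<Sum>y\<in>distinct_tuples (Suc 0) ((\<lambda>x. 1 / x) ` C \<omega> \<inter> shell ?d 1). 1)"
        by (intro sum.cong) (auto simp: distinct_tuples_def PiE_iff)
      also have "\<dots> = real (card ((\<lambda>x. 1 / x) ` C \<omega> \<inter> shell ?d 1))"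
        using sum_distinct_tuples_1[of "\<lambda>_. 1 :: real"] by simp
      also have "card ((\<lambda>x. 1 / x) ` C \<omega> \<inter> shell ?d 1) = N k \<omega>"
        using inverse_image_shell[of ?d 1 \<omega>] card_image[OF inj_reciprocal, of "C \<omega> \<inter> shell 1 (real (Suc k))"]
        by (simp add: N_def)
      finally show ?thesis .
    qed
    ultimately have "has_bochner_integral M (\<lambda>\<omega>. real (N k \<omega>)) (\<integral>y. ?F y * sine_det (Suc 0) y \<partial>(\<Pi>\<^sub>M i\<in>{..<Suc 0}. lborel))"
      by simp
    then have i: "integrable M (\<lambda>\<omega>. real (N k \<omega>))"
      and e: "(\<integral>\<omega>. real (N k \<omega>) \<partial>M) = (\<integral>y. ?F y * sine_det (Suc 0) y \<partial>(\<Pi>\<^sub>M i\<in>{..<Suc 0}. lborel))"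
      by (auto simp: has_bochner_integral_iff)
    have "(\<integral>y. ?F y * sine_det (Suc 0) y \<partial>(\<Pi>\<^sub>M i\<in>{..<Suc 0}. lborel)) = (\<integral>y. indicator (shell ?d 1) (y 0) * (1 / pi) \<partial>(\<Pi>\<^sub>M i\<in>{..<Suc 0}. lborel))"
      by (intro Bochner_Integration.integral_cong refl) (auto simp: sine_det_1 space_PiM PiE_iff indicator_def)
    also have "\<dots> = (\<integral>x. indicator (shell ?d 1) x * (1 / pi) \<partial>lborel)"
      by (rule integral_PiM_1) measurable
    also have "\<dots> \<le> (\<integral>x. indicator {-1..1::real} x * (1 / pi) \<partial>lborel)"
    proof (rule Bochner_Integration.integral_mono)
      have "emeasure lborel (shell ?d 1) \<le> emeasure lborel {-1..1::real}"
        by (rule emeasure_mono[OF shell_subset]) simp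
      then have "emeasure lborel (shell ?d 1) < \<infinity>" by (rule order_le_less_trans) simp
      then show "integrable lborel (\<lambda>x. indicator (shell ?d 1) x * (1 / pi))"
        by (intro integrable_mult_left integrable_real_indicator) auto
      show "integrable lborel (\<lambda>x::real. indicator {-1..1} x * (1 / pi) :: real)"
        by (intro integrable_mult_left integrable_real_indicator) auto
    qed (use shell_subset[of ?d 1] in \<open>auto simp: indicator_def\<close>)
    also have "\<dots> = 2 / pi" by simp
    finally show ?thesis
      using i by (subst nn_integral_eq_integral) (auto simp: e intro!: ennreal_leI)
  qed
  have mono: "AE \<omega> in M. ennreal (real (N k \<omega>)) \<le> ennreal (real (N (Suc k) \<omega>))" for k
  proof (rule AE_I2)
    fix \<omega> assume "\<omega> \<in> space M"
    then have "finite (C \<omega> \<inter> shell 1 (real (Suc (Suc k))))"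
      using process_finite[OF _ compact_shell shell_1_nonzero] by blast
    then have "N k \<omega> \<le> N (Suc k) \<omega>"
      unfolding N_def by (rule card_mono) (auto simp: shell_def)
    then show "ennreal (real (N k \<omega>)) \<le> ennreal (real (N (Suc k) \<omega>))" by (intro ennreal_leI) simp
  qed
  have "(\<integral>\<^sup>+\<omega>. (SUP k. ennreal (real (N k \<omega>))) \<partial>M) = (SUP k. \<integral>\<^sup>+\<omega>. ennreal (real (N k \<omega>)) \<partial>M)"
    using mono by (rule nn_integral_monotone_convergence_SUP_AE) measurable
  also have "\<dots> \<le> ennreal (2 / pi)" by (rule SUP_least) (rule bnd)
  also have "\<dots> < \<infinity>" by simp
  finally have "(\<integral>\<^sup>+\<omega>. (SUP k. ennreal (real (N k \<omega>))) \<partial>M) \<noteq> \<infinity>" by simp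
  then have "AE \<omega> in M. (SUP k. ennreal (real (N k \<omega>))) \<noteq> \<infinity>"
    by (intro nn_integral_PInf_AE) measurable
  moreover have "AE \<omega> in M. \<omega> \<in> space M" by simp
  ultimately show ?thesis
  proof eventually_elim
    case (elim \<omega>)
    then obtain r where r: "0 \<le> r" "(SUP k. ennreal (real (N k \<omega>))) = ennreal r"
      by (cases "SUP k. ennreal (real (N k \<omega>))") auto
    have "N k \<omega> \<le> nat \<lceil>r\<rceil>" for k
    proof -
      have "ennreal (real (N k \<omega>)) \<le> ennreal r" unfolding r(2)[symmetric] by (rule SUP_upper) simp
      then have "real (N k \<omega>) \<le> r" using r(1) by simp
      then show ?thesis by linarith
    qed
    then show ?case using elim by (auto simp: process_good_def N_def)
  qed
qed

text \<open>Infinitely many inverses in a bounded window could only come from points of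
  \<open>C\<close> running off to infinity, and \<open>process_good\<close> leaves finitely many
  points of modulus at least \<open>1\<close>. The remaining ones lie in a compact shell.\<close>

lemma finite_reciprocal_window:
  assumes \<omega>: "\<omega> \<in> process_good"
  shows "finite ((\<lambda>x. 1 / x) ` C \<omega> \<inter> {-B..B})"
proof -
  have sp: "\<omega> \<in> space M" using \<omega> by (simp add: process_good_def)
  obtain m where m: "card (C \<omega> \<inter> shell 1 (real (Suc k))) \<le> m" for k
    using \<omega> by (auto simp: process_good_def)
  have fin: "finite (C \<omega> \<inter> shell 1 r)" for r
    using process_finite[OF sp compact_shell shell_1_nonzero] .
  have "finite (\<Union>k. C \<omega> \<inter> shell 1 (real (Suc k)))"
    by (rule finite_Union_bounded_card[OF _ fin m]) (auto simp: incseq_def shell_def)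
  moreover have "C \<omega> \<inter> {x. 1 \<le> \<bar>x\<bar>} \<subseteq> (\<Union>k. C \<omega> \<inter> shell 1 (real (Suc k)))"
  proof
    fix x assume x: "x \<in> C \<omega> \<inter> {x. 1 \<le> \<bar>x\<bar>}"
    obtain k :: nat where "\<bar>x\<bar> < real k" using reals_Archimedean2 by blast
    then show "x \<in> (\<Union>k. C \<omega> \<inter> shell 1 (real (Suc k)))" using x by (auto simp: shell_def intro!: exI[of _ k])
  qed
  ultimately have f1: "finite (C \<omega> \<inter> {x. 1 \<le> \<bar>x\<bar>})" by (rule finite_subset[rotated])
  define b where "b = max B 1"
  have b: "b \<ge> 1" "b \<ge> B" by (auto simp: b_def)
  have "shell (1 / b) 1 \<subseteq> - {0}" using b by (auto simp: shell_def)
  then have f2: "finite (C \<omega> \<inter> shell (1 / b) 1)" using process_finite[OF sp compact_shell] by blast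
  have "(\<lambda>x. 1 / x) ` C \<omega> \<inter> {-B..B} \<subseteq> (\<lambda>x. 1 / x) ` (C \<omega> \<inter> {x. 1 \<le> \<bar>x\<bar>} \<union> C \<omega> \<inter> shell (1 / b) 1)"
  proof
    fix u assume "u \<in> (\<lambda>x. 1 / x) ` C \<omega> \<inter> {-B..B}"
    then obtain x where x: "x \<in> C \<omega>" "u = 1 / x" "\<bar>1 / x\<bar> \<le> b" using b by (auto simp: abs_le_iff)
    have "x \<noteq> 0" using x process_nonzero[OF sp] by auto
    then have "1 / b \<le> \<bar>x\<bar>" using x(3) b by (simp add: field_simps)
    then have "x \<in> C \<omega> \<inter> {x. 1 \<le> \<bar>x\<bar>} \<union> C \<omega> \<inter> shell (1 / b) 1" using x by (auto simp: shell_def)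
    then show "u \<in> (\<lambda>x. 1 / x) ` (C \<omega> \<inter> {x. 1 \<le> \<bar>x\<bar>} \<union> C \<omega> \<inter> shell (1 / b) 1)" using x(2) by blast
  qed
  then show ?thesis using f1 f2 by (meson finite_UnI finite_imageI finite_subset)
qed

lemma inverse_process_finite: "finite (inverse_process \<omega> \<inter> {-B..B})"
  using finite_reciprocal_window by (simp add: inverse_process_def)

lemma inverse_process_nonzero: "0 \<notin> inverse_process \<omega>"
  using process_nonzero by (auto simp: inverse_process_def process_good_def)

text \<open>Emptying the process on a null set keeps the expectation; that the modified sum is still
  measurable rests on the measurability of \<open>process_good\<close>.\<close>

lemma inverse_process_shell:
  assumes B: "0 < B"
    and F [measurable]: "F \<in> borel_measurable (\<Pi>\<^sub>M i\<in>{..<n}. borel)" and bF: "\<And>y. \<bar>F y\<bar> \<le> c"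
  shows "has_bochner_integral M (\<lambda>\<omega>. \<Sum>y\<in>distinct_tuples n (inverse_process \<omega> \<inter> shell (1 / real (Suc k)) B). F y)
           (\<integral>y. (indicator ({..<n} \<rightarrow>\<^sub>E shell (1 / real (Suc k)) B) y * F y) * sine_det n y \<partial>(\<Pi>\<^sub>M i\<in>{..<n}. lborel))"
proof -
  let ?S = "shell (1 / real (Suc k)) B"
  let ?F = "\<lambda>y. indicator ({..<n} \<rightarrow>\<^sub>E ?S) y * F y"
  have [measurable]: "({..<n} \<rightarrow>\<^sub>E ?S) \<in> sets (\<Pi>\<^sub>M i\<in>{..<n}. borel)"
    by (intro sets_PiM_I_finite) auto
  have h: "has_bochner_integral M (\<lambda>\<omega>. \<Sum>y\<in>distinct_tuples n ((\<lambda>x. 1 / x) ` C \<omega> \<inter> ?S). ?F y)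
     (\<integral>y. ?F y * sine_det n y \<partial>(\<Pi>\<^sub>M i\<in>{..<n}. lborel))"
  proof (rule process_C_correlation[OF C _ B, where c = c])
    show "\<bar>?F y\<bar> \<le> c" for y using bF[of y] by (auto simp: indicator_def intro: order_trans[OF abs_ge_zero])
  qed auto
  have eq: "(\<Sum>y\<in>distinct_tuples n (X \<inter> ?S). ?F y) = (\<Sum>y\<in>distinct_tuples n (X \<inter> ?S). F y)" for X
    by (intro sum.cong refl) (auto simp: distinct_tuples_def PiE_iff indicator_def)
  have m: "(\<lambda>\<omega>. \<Sum>y\<in>distinct_tuples n (inverse_process \<omega> \<inter> ?S). F y) \<in> borel_measurable M"
  proof -
    have "(\<lambda>\<omega>. if \<omega> \<in> process_good then \<Sum>y\<in>distinct_tuples n ((\<lambda>x. 1 / x) ` C \<omega> \<inter> ?S). F y else \<Sum>y\<in>distinct_tuples n {}. F y) \<in> borel_measurable M"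
      using borel_measurable_has_bochner_integral[OF h] unfolding eq by measurable
    also have "(\<lambda>\<omega>. if \<omega> \<in> process_good then \<Sum>y\<in>distinct_tuples n ((\<lambda>x. 1 / x) ` C \<omega> \<inter> ?S). F y else \<Sum>y\<in>distinct_tuples n {}. F y)
        = (\<lambda>\<omega>. \<Sum>y\<in>distinct_tuples n (inverse_process \<omega> \<inter> ?S). F y)"
      by (auto simp: inverse_process_def)
    finally show ?thesis .
  qed
  have "AE \<omega> in M. (\<Sum>y\<in>distinct_tuples n ((\<lambda>x. 1 / x) ` C \<omega> \<inter> ?S). F y) = (\<Sum>y\<in>distinct_tuples n (inverse_process \<omega> \<inter> ?S). F y)"
    using AE_process_good by eventually_elim (simp add: inverse_process_def)
  then show ?thesis
    using h m unfolding eq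
    by (subst has_bochner_integral_cong_AE[symmetric]) (auto dest: borel_measurable_has_bochner_integral)
qed

lemma tendsto_inverse_process_shell:
  "(\<lambda>k. \<Sum>y\<in>distinct_tuples n (inverse_process \<omega> \<inter> shell (1 / real (Suc k)) B). F y)
     \<longlonglongrightarrow> (\<Sum>y\<in>distinct_tuples n (inverse_process \<omega> \<inter> {-B..B}). (F y :: real))"
proof (rule tendsto_eventually)
  have "eventually (\<lambda>k. inverse_process \<omega> \<inter> {-B..B} \<subseteq> shell (1 / real (Suc k)) B) sequentially"
    by (rule eventually_subset_shell) (use inverse_process_finite inverse_process_nonzero in auto)
  then show "eventually (\<lambda>k. (\<Sum>y\<in>distinct_tuples n (inverse_process \<omega> \<inter> shell (1 / real (Suc k)) B). F y)
     = (\<Sum>y\<in>distinct_tuples n (inverse_process \<omega> \<inter> {-B..B}). F y)) sequentially"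
  proof eventually_elim
    case (elim k)
    then have "inverse_process \<omega> \<inter> shell (1 / real (Suc k)) B = inverse_process \<omega> \<inter> {-B..B}"
      using shell_subset[of "1 / real (Suc k)" B] by blast
    then show ?case by simp
  qed
qed

text \<open>Hadamard's bound \<open>(1 / pi) ^ n\<close> dominates on the cube. The shells exhaust
  the cube up to the coordinate hyperplanes, which are null sets.\<close>

lemma tendsto_shell_integral:
  assumes B: "0 < B"
    and F [measurable]: "F \<in> borel_measurable (\<Pi>\<^sub>M i\<in>{..<n}. borel)" and bF: "\<And>y. \<bar>F y\<bar> \<le> c"
    and supp: "\<And>y. y \<notin> {..<n} \<rightarrow>\<^sub>E {-B..B} \<Longrightarrow> F y = 0"
  shows "(\<lambda>k. \<integral>y. (indicator ({..<n} \<rightarrow>\<^sub>E shell (1 / real (Suc k)) B) y * F y) * sine_det n y \<partial>(\<Pi>\<^sub>M i\<in>{..<n}. lborel))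
     \<longlonglongrightarrow> (\<integral>y. F y * sine_det n y \<partial>(\<Pi>\<^sub>M i\<in>{..<n}. lborel))"
proof (rule integral_dominated_convergence)
  let ?P = "\<Pi>\<^sub>M i\<in>{..<n}. lborel :: real measure"
  have PP: "sets ?P = sets (\<Pi>\<^sub>M i\<in>{..<n}. borel)" by (intro sets_PiM_cong) auto
  have [measurable]: "({..<n} \<rightarrow>\<^sub>E shell (1 / real (Suc k)) B) \<in> sets (\<Pi>\<^sub>M i\<in>{..<n}. borel)" for k
    by (intro sets_PiM_I_finite) auto
  show "(\<lambda>y. F y * sine_det n y) \<in> borel_measurable ?P"
    by (subst measurable_cong_sets[OF PP refl]) measurable
  show "(\<lambda>y. (indicator ({..<n} \<rightarrow>\<^sub>E shell (1 / real (Suc k)) B) y * F y) * sine_det n y) \<in> borel_measurable ?P" for k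
    by (subst measurable_cong_sets[OF PP refl]) measurable
  have c: "0 \<le> c" using bF[of undefined] by linarith
  show "integrable ?P (\<lambda>y. indicator ({..<n} \<rightarrow>\<^sub>E {-B..B}) y * (c * (1 / pi) ^ n))"
    by (rule integrable_indicator_cube)
  show "AE y in ?P. norm ((indicator ({..<n} \<rightarrow>\<^sub>E shell (1 / real (Suc k)) B) y * F y) * sine_det n y)
      \<le> indicator ({..<n} \<rightarrow>\<^sub>E {-B..B}) y * (c * (1 / pi) ^ n)" for k
  proof (rule AE_I2)
    fix y
    have "\<bar>F y * sine_det n y\<bar> \<le> c * (1 / pi) ^ n"
      unfolding abs_mult using bF[of y] c sine_det_bounds[of n y] by (intro mult_mono) auto
    then show "norm ((indicator ({..<n} \<rightarrow>\<^sub>E shell (1 / real (Suc k)) B) y * F y) * sine_det n y)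
      \<le> indicator ({..<n} \<rightarrow>\<^sub>E {-B..B}) y * (c * (1 / pi) ^ n)"
      using supp[of y] c by (cases "y \<in> {..<n} \<rightarrow>\<^sub>E {-B..B}") (auto simp: indicator_def)
  qed
  show "AE y in ?P. (\<lambda>k. (indicator ({..<n} \<rightarrow>\<^sub>E shell (1 / real (Suc k)) B) y * F y) * sine_det n y) \<longlonglongrightarrow> F y * sine_det n y"
    using AE_PiM_lborel_nonzero
  proof eventually_elim
    case (elim y)
    show ?case
    proof (cases "y \<in> {..<n} \<rightarrow>\<^sub>E {-B..B}")
      case True
      have "eventually (\<lambda>k. y ` {..<n} \<subseteq> shell (1 / real (Suc k)) B) sequentially"
        by (rule eventually_subset_shell) (use elim True in auto)
      then have "eventually (\<lambda>k. (indicator ({..<n} \<rightarrow>\<^sub>E shell (1 / real (Suc k)) B) y * F y) * sine_det n y = F y * sine_det n y) sequentially"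
      proof eventually_elim
        case (elim k)
        then have "y \<in> {..<n} \<rightarrow>\<^sub>E shell (1 / real (Suc k)) B" using True by (auto simp: PiE_iff)
        then show ?case by simp
      qed
      then show ?thesis by (rule tendsto_eventually)
    qed (simp add: supp)
  qed
qed

text \<open>The shells grow to the punctured window, and \<open>0\<close> is never a point of the
  process. The number of tuples is treated first, by monotone convergence; multiplied by
  \<open>c\<close> it then dominates the sums of a general \<open>F\<close>.\<close>

lemma sine_process_inverse: "sine_process M inverse_process"
proof -
  interpret prob_space M by (rule process_prob_space)
  show ?thesis
  proof (unfold_locales)
    show "finite (inverse_process \<omega> \<inter> {-B..B})" for \<omega> B by (rule inverse_process_finite)
    show "0 \<notin> inverse_process \<omega>" for \<omega> by (rule inverse_process_nonzero)
    fix B c :: real and n :: nat and F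
    assume B: "0 < B" and F [measurable]: "F \<in> borel_measurable (\<Pi>\<^sub>M i\<in>{..<n}. borel)" and bF: "\<And>y. \<bar>F y\<bar> \<le> c"
      and supp: "\<And>y. y \<notin> {..<n} \<rightarrow>\<^sub>E {-B..B} \<Longrightarrow> F y = 0"
    let ?S = "\<lambda>k. shell (1 / real (Suc k)) B"
    let ?N = "\<lambda>\<omega>. \<Sum>y\<in>distinct_tuples n (inverse_process \<omega> \<inter> {-B..B}). 1 :: real"
    let ?one = "\<lambda>y. indicator ({..<n} \<rightarrow>\<^sub>E {-B..B}) y :: real"
    have cube [measurable]: "({..<n} \<rightarrow>\<^sub>E {-B..B}) \<in> sets (\<Pi>\<^sub>M i\<in>{..<n}. borel)"
      by (intro sets_PiM_I_finite) auto
    have one_eq: "(\<Sum>y\<in>distinct_tuples n (inverse_process \<omega> \<inter> X). ?one y) = (\<Sum>y\<in>distinct_tuples n (inverse_process \<omega> \<inter> X). 1)"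
      if "X \<subseteq> {-B..B}" for X \<omega>
      using that by (intro sum.cong refl) (auto simp: distinct_tuples_def PiE_iff indicator_def)
    note sh = inverse_process_shell[OF B F bF]
    have sh1: "has_bochner_integral M (\<lambda>\<omega>. \<Sum>y\<in>distinct_tuples n (inverse_process \<omega> \<inter> ?S k). 1 :: real)
        (\<integral>y. (indicator ({..<n} \<rightarrow>\<^sub>E ?S k) y * ?one y) * sine_det n y \<partial>(\<Pi>\<^sub>M i\<in>{..<n}. lborel))" for k
      using inverse_process_shell[OF B, of ?one n 1 k] one_eq[OF shell_subset] by (auto simp: indicator_def)
    have Nm: "?N \<in> borel_measurable M"
      by (rule borel_measurable_LIMSEQ_metric[OF _ tendsto_inverse_process_shell])
         (use sh1 in \<open>auto dest: borel_measurable_has_bochner_integral\<close>)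
    have "integrable M ?N"
    proof (rule integrable_monotone_convergence)
      show "integrable M (\<lambda>\<omega>. \<Sum>y\<in>distinct_tuples n (inverse_process \<omega> \<inter> ?S k). 1 :: real)" for k
        using sh1[of k] by (simp add: has_bochner_integral_iff)
      show "AE \<omega> in M. mono (\<lambda>k. \<Sum>y\<in>distinct_tuples n (inverse_process \<omega> \<inter> ?S k). 1 :: real)"
      proof (intro AE_I2 monoI)
        fix \<omega> and k l :: nat assume kl: "k \<le> l"
        have "?S k \<subseteq> ?S l" using frac_le[of 1 1 "real (Suc k)" "real (Suc l)"] kl by (auto simp: shell_def)
        moreover have "finite (inverse_process \<omega> \<inter> ?S l)"
          by (rule finite_subset[OF _ inverse_process_finite[of \<omega> B]]) (use shell_subset in auto)
        ultimately show "(\<Sum>y\<in>distinct_tuples n (inverse_process \<omega> \<inter> ?S k). 1 :: real) \<le> (\<Sum>y\<in>distinct_tuples n (inverse_process \<omega> \<inter> ?S l). 1)"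
          by (intro sum_mono2 finite_distinct_tuples distinct_tuples_mono) auto
      qed
      show "AE \<omega> in M. (\<lambda>k. \<Sum>y\<in>distinct_tuples n (inverse_process \<omega> \<inter> ?S k). 1 :: real) \<longlonglongrightarrow> ?N \<omega>"
        by (intro AE_I2 tendsto_inverse_process_shell)
      show "(\<lambda>k. \<integral>\<omega>. (\<Sum>y\<in>distinct_tuples n (inverse_process \<omega> \<inter> ?S k). 1 :: real) \<partial>M)
          \<longlonglongrightarrow> (\<integral>y. ?one y * sine_det n y \<partial>(\<Pi>\<^sub>M i\<in>{..<n}. lborel))"
        using tendsto_shell_integral[OF B, of ?one n 1] sh1 by (auto simp: has_bochner_integral_iff indicator_def)
    qed (rule Nm)
    then have cN: "integrable M (\<lambda>\<omega>. c * ?N \<omega>)" by (rule integrable_mult_right)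
    have bound: "AE \<omega> in M. norm (\<Sum>y\<in>distinct_tuples n (inverse_process \<omega> \<inter> ?S k). F y) \<le> c * ?N \<omega>" for k
    proof (rule AE_I2)
      fix \<omega>
      have "norm (\<Sum>y\<in>distinct_tuples n (inverse_process \<omega> \<inter> ?S k). F y) \<le> (\<Sum>y\<in>distinct_tuples n (inverse_process \<omega> \<inter> ?S k). c)"
        by (rule sum_norm_le) (use bF in auto)
      also have "\<dots> \<le> (\<Sum>y\<in>distinct_tuples n (inverse_process \<omega> \<inter> {-B..B}). c)"
        using bF[of undefined] shell_subset
        by (intro sum_mono2 finite_distinct_tuples distinct_tuples_mono inverse_process_finite) (blast | linarith)+
      finally show "norm (\<Sum>y\<in>distinct_tuples n (inverse_process \<omega> \<inter> ?S k). F y) \<le> c * ?N \<omega>"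
        by (simp add: mult.commute)
    qed
    let ?R = "\<lambda>\<omega>. \<Sum>y\<in>distinct_tuples n (inverse_process \<omega> \<inter> {-B..B}). F y"
    have Rm: "?R \<in> borel_measurable M"
      by (rule borel_measurable_LIMSEQ_metric[OF _ tendsto_inverse_process_shell])
         (use sh in \<open>auto dest: borel_measurable_has_bochner_integral\<close>)
    have Sm: "(\<lambda>\<omega>. \<Sum>y\<in>distinct_tuples n (inverse_process \<omega> \<inter> ?S k). F y) \<in> borel_measurable M" for k
      using borel_measurable_has_bochner_integral[OF sh] .
    have lim: "AE \<omega> in M. (\<lambda>k. \<Sum>y\<in>distinct_tuples n (inverse_process \<omega> \<inter> ?S k). F y) \<longlonglongrightarrow> ?R \<omega>"
      by (intro AE_I2 tendsto_inverse_process_shell)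
    have "integrable M ?R"
      by (rule integrable_dominated_convergence[OF Rm Sm cN lim bound])
    moreover have "(\<lambda>k. \<integral>\<omega>. (\<Sum>y\<in>distinct_tuples n (inverse_process \<omega> \<inter> ?S k). F y) \<partial>M) \<longlonglongrightarrow> (\<integral>\<omega>. ?R \<omega> \<partial>M)"
      by (rule integral_dominated_convergence[OF Rm Sm cN lim bound])
    moreover have "(\<lambda>k. \<integral>\<omega>. (\<Sum>y\<in>distinct_tuples n (inverse_process \<omega> \<inter> ?S k). F y) \<partial>M)
        \<longlonglongrightarrow> (\<integral>y. F y * sine_det n y \<partial>(\<Pi>\<^sub>M i\<in>{..<n}. lborel))"
      using tendsto_shell_integral[OF B F bF supp] sh by (simp add: has_bochner_integral_iff)
    ultimately show "has_bochner_integral M ?R (\<integral>y. F y * sine_det n y \<partial>(\<Pi>\<^sub>M i\<in>{..<n}. lborel))"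
      using LIMSEQ_unique by (auto simp: has_bochner_integral_iff)
  qed
qed

end

subsection \<open>Linear statistics of the sine process\<close>

lemma integral_PiM_2:
  fixes g :: "real \<Rightarrow> real \<Rightarrow> 'b :: {banach, second_countable_topology}"
  assumes "integrable (\<Pi>\<^sub>M i\<in>{..<2::nat}. lborel) (\<lambda>y. g (y 0) (y 1))"
    and "(\<lambda>(a, b). g a b) \<in> borel_measurable (borel \<Otimes>\<^sub>M borel)"
  shows "(\<integral>y. g (y 0) (y 1) \<partial>(\<Pi>\<^sub>M i\<in>{..<2::nat}. lborel)) = (\<integral>b. \<integral>a. g a b \<partial>lborel \<partial>lborel)"
    and "(\<integral>y. g (y 0) (y 1) \<partial>(\<Pi>\<^sub>M i\<in>{..<2::nat}. lborel)) = (\<integral>a. \<integral>b. g a b \<partial>lborel \<partial>lborel)"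
proof -
  interpret product_sigma_finite "\<lambda>_::nat. lborel :: real measure" ..
  have gm [measurable]: "(\<lambda>p. g (fst p) (snd p)) \<in> borel_measurable (borel \<Otimes>\<^sub>M borel)"
    using assms(2) by (simp add: split_beta')
  have gm' [measurable]: "(\<lambda>p. g (snd p) (fst p)) \<in> borel_measurable (borel \<Otimes>\<^sub>M borel)"
    using measurable_compose[OF measurable_pair_swap' gm] by (simp add: split_beta')
  have 2: "{..<2::nat} = insert 0 {1::nat}" "{..<2::nat} = insert 1 {0::nat}" by auto
  have "(\<integral>y. g (y 0) (y 1) \<partial>(\<Pi>\<^sub>M i\<in>{..<2::nat}. lborel)) = (\<integral>x. \<integral>a. g a (x 1) \<partial>lborel \<partial>(\<Pi>\<^sub>M i\<in>{1::nat}. lborel))"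
    using assms(1) unfolding 2(1) by (subst product_integral_insert) auto
  also have "\<dots> = (\<integral>b. \<integral>a. g a b \<partial>lborel \<partial>lborel)"
    by (rule product_integral_singleton) measurable
  finally show "(\<integral>y. g (y 0) (y 1) \<partial>(\<Pi>\<^sub>M i\<in>{..<2::nat}. lborel)) = (\<integral>b. \<integral>a. g a b \<partial>lborel \<partial>lborel)" .
  have "(\<integral>y. g (y 0) (y 1) \<partial>(\<Pi>\<^sub>M i\<in>{..<2::nat}. lborel)) = (\<integral>x. \<integral>b. g (x 0) b \<partial>lborel \<partial>(\<Pi>\<^sub>M i\<in>{0::nat}. lborel))"
    using assms(1) unfolding 2(2) by (subst product_integral_insert) auto
  also have "\<dots> = (\<integral>a. \<integral>b. g a b \<partial>lborel \<partial>lborel)"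
    by (rule product_integral_singleton) measurable
  finally show "(\<integral>y. g (y 0) (y 1) \<partial>(\<Pi>\<^sub>M i\<in>{..<2::nat}. lborel)) = (\<integral>a. \<integral>b. g a b \<partial>lborel \<partial>lborel)" .
qed

lemma sum_distinct_tuples_2:
  fixes f :: "real \<Rightarrow> real"
  assumes "finite X"
  shows "(\<Sum>y\<in>distinct_tuples 2 X. f (y 0) * f (y 1)) = (\<Sum>x\<in>X. f x)\<^sup>2 - (\<Sum>x\<in>X. (f x)\<^sup>2)"
proof -
  have "(\<Sum>y\<in>distinct_tuples 2 X. f (y 0) * f (y 1)) = (\<Sum>p\<in>{p \<in> X \<times> X. fst p \<noteq> snd p}. f (fst p) * f (snd p))"
  proof (rule sum.reindex_bij_witness[of _ "\<lambda>p. \<lambda>i\<in>{..<2::nat}. if i = 0 then fst p else snd p" "\<lambda>y. (y 0, y 1)"])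
    fix y assume y: "y \<in> distinct_tuples 2 X"
    have "y i = undefined" if "i \<noteq> 0" "i \<noteq> 1" for i
      using y that by (intro PiE_arb[of y "{..<2}" "\<lambda>_. X"]) (auto simp: distinct_tuples_def)
    then show "(\<lambda>i\<in>{..<2::nat}. if i = 0 then fst (y 0, y 1) else snd (y 0, y 1)) = y"
      by (intro ext) (auto simp: less_2_cases_iff)
    have "y 0 \<in> X" "y 1 \<in> X" using y by (auto simp: distinct_tuples_def PiE_iff)
    moreover have "y 0 \<noteq> y 1" using y inj_onD[of y "{..<2}" 0 1] by (auto simp: distinct_tuples_def)
    ultimately show "(y 0, y 1) \<in> {p \<in> X \<times> X. fst p \<noteq> snd p}" by simp
  next
    fix p assume "p \<in> {p \<in> X \<times> X. fst p \<noteq> snd p}"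
    then have p: "fst p \<in> X" "snd p \<in> X" "fst p \<noteq> snd p" by auto
    then show "(\<lambda>i\<in>{..<2::nat}. if i = 0 then fst p else snd p) \<in> distinct_tuples 2 X"
      by (auto simp: distinct_tuples_def inj_on_def less_2_cases_iff)
  qed auto
  also have "\<dots> = (\<Sum>p\<in>X \<times> X. f (fst p) * f (snd p)) - (\<Sum>p\<in>{p \<in> X \<times> X. fst p = snd p}. f (fst p) * f (snd p))"
  proof -
    have "X \<times> X = {p \<in> X \<times> X. fst p \<noteq> snd p} \<union> {p \<in> X \<times> X. fst p = snd p}" by auto
    moreover have "finite (X \<times> X)" using assms by simp
    ultimately have "(\<Sum>p\<in>X \<times> X. f (fst p) * f (snd p)) = (\<Sum>p\<in>{p \<in> X \<times> X. fst p \<noteq> snd p}. f (fst p) * f (snd p)) + (\<Sum>p\<in>{p \<in> X \<times> X. fst p = snd p}. f (fst p) * f (snd p))"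
      by (subst sum.union_disjoint[symmetric]) (auto intro: finite_subset)
    then show ?thesis by simp
  qed
  also have "(\<Sum>p\<in>{p \<in> X \<times> X. fst p = snd p}. f (fst p) * f (snd p)) = (\<Sum>x\<in>X. (f x)\<^sup>2)"
    by (rule sum.reindex_bij_witness[of _ "\<lambda>x. (x, x)" fst]) (auto simp: power2_eq_square)
  also have "(\<Sum>p\<in>X \<times> X. f (fst p) * f (snd p)) = (\<Sum>x\<in>X. f x)\<^sup>2"
    by (simp add: power2_eq_square sum_product sum.cartesian_product split_beta)
  finally show ?thesis .
qed

text \<open>The Cauchy majorant of the squared kernel integrates to \<open>2 / pi\<close> over the
  line, whatever the centre \<open>b\<close> and the window.\<close>

lemma integral_sine_kernel_square_le:
  fixes B b :: real
  shows "(\<integral>a. indicator {-B..B} a * (sine_kernel a b)\<^sup>2 \<partial>lborel) \<le> 2 / pi"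
proof -
  have i0: "has_bochner_integral lborel (\<lambda>x. 1 / (1 + (- b + 1 * x)\<^sup>2)) pi"
    using has_bochner_integral_inverse_square lborel_has_bochner_integral_real_affine_iff[of 1 "\<lambda>x. 1 / (1 + x\<^sup>2)" pi "- b"] by simp
  have i: "has_bochner_integral lborel (\<lambda>a. 2 / pi\<^sup>2 * (1 / (1 + (- b + 1 * a)\<^sup>2))) (2 / pi\<^sup>2 * pi)"
    using i0 by (intro has_bochner_integral_mult_right) auto
  have "(\<integral>a. indicator {-B..B} a * (sine_kernel a b)\<^sup>2 \<partial>lborel) \<le> (\<integral>a. 2 / pi\<^sup>2 * (1 / (1 + (- b + 1 * a)\<^sup>2)) \<partial>lborel)"
  proof (rule integral_mono')
    show "integrable lborel (\<lambda>a. 2 / pi\<^sup>2 * (1 / (1 + (- b + 1 * a)\<^sup>2)))" using i by (simp add: has_bochner_integral_iff)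
    fix a :: real
    show "0 \<le> 2 / pi\<^sup>2 * (1 / (1 + (- b + 1 * a)\<^sup>2))" by simp
    have "(sine_kernel a b)\<^sup>2 \<le> 2 / pi\<^sup>2 * (1 / (1 + (- b + 1 * a)\<^sup>2))"
      using sine_kernel_square_le[of b a] by (simp add: sine_kernel_commute[of b a])
    moreover have "0 \<le> 2 / pi\<^sup>2 * (1 / (1 + (- b + 1 * a)\<^sup>2))" by simp
    ultimately show "indicator {-B..B} a * (sine_kernel a b)\<^sup>2 \<le> 2 / pi\<^sup>2 * (1 / (1 + (- b + 1 * a)\<^sup>2))"
      by (cases "a \<in> {-B..B}") (simp_all del: atLeastAtMost_iff)
  qed
  also have "\<dots> = 2 / pi" using i by (simp add: has_bochner_integral_iff power2_eq_square)
  finally show ?thesis .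
qed

context sine_process
begin

definition linear_statistic :: "(real \<Rightarrow> 'b :: comm_monoid_add) \<Rightarrow> real \<Rightarrow> 'a \<Rightarrow> 'b" where
  "linear_statistic f B \<omega> = (\<Sum>u\<in>D \<omega> \<inter> {-B..B}. f u)"

lemma linear_statistic_mono:
  assumes "\<omega> \<in> space M" "A \<le> B" "\<And>u. u \<notin> {-A..A} \<Longrightarrow> f u = 0"
  shows "linear_statistic f B \<omega> = linear_statistic f A \<omega>"
  unfolding linear_statistic_def using assms finite_window[OF assms(1), of B]
  by (intro sum.mono_neutral_right) auto

lemma integrable_window:
  fixes f :: "real \<Rightarrow> 'b :: {banach, second_countable_topology}"
  assumes [measurable]: "f \<in> borel_measurable borel" and "\<And>u. norm (f u) \<le> c" "\<And>u. u \<notin> {-B..B} \<Longrightarrow> f u = 0"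
  shows "integrable lborel f"
proof (rule Bochner_Integration.integrable_bound)
  show "integrable lborel (\<lambda>u::real. indicator {-B..B} u * c)"
    by (intro integrable_mult_left integrable_real_indicator) (auto simp: emeasure_lborel_Icc_eq)
  have "0 \<le> c" using assms(2) norm_ge_zero order_trans by blast
  then show "AE u in lborel. norm (f u) \<le> norm (indicator {-B..B} u * c)"
    using assms(2,3) by (intro AE_I2) (auto simp: indicator_def)
qed measurable

lemma first_moment:
  fixes f :: "real \<Rightarrow> real"
  assumes B: "0 < B" and f [measurable]: "f \<in> borel_measurable borel" and bf: "\<And>u. \<bar>f u\<bar> \<le> c"
    and supp: "\<And>u. u \<notin> {-B..B} \<Longrightarrow> f u = 0"
  shows "has_bochner_integral M (linear_statistic f B) (1 / pi * (\<integral>u. f u \<partial>lborel))"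
proof -
  let ?F = "\<lambda>y::nat \<Rightarrow> real. indicator (extensional {..<Suc 0}) y * f (y 0)"
  have "(\<lambda>y. f (y 0)) \<in> borel_measurable (\<Pi>\<^sub>M i\<in>{..<Suc 0}. borel)" by measurable
  then have Fm: "?F \<in> borel_measurable (\<Pi>\<^sub>M i\<in>{..<Suc 0}. borel)"
    by (rule measurable_cong[THEN iffD1, rotated]) (auto simp: space_PiM PiE_iff indicator_def)
  have "has_bochner_integral M (\<lambda>\<omega>. \<Sum>y\<in>distinct_tuples (Suc 0) (D \<omega> \<inter> {-B..B}). ?F y)
      (\<integral>y. ?F y * sine_det (Suc 0) y \<partial>(\<Pi>\<^sub>M i\<in>{..<Suc 0}. lborel))"
  proof (rule correlation[OF B Fm, where c = c])
    show "\<bar>?F y\<bar> \<le> c" for y using bf[of "y 0"] bf[of 0] abs_ge_zero[of "f 0"] by (auto simp: indicator_def)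
    show "?F y = 0" if "y \<notin> {..<Suc 0} \<rightarrow>\<^sub>E {-B..B}" for y
      using that supp[of "y 0"] by (auto simp: PiE_iff indicator_def)
  qed
  also have "(\<lambda>\<omega>. \<Sum>y\<in>distinct_tuples (Suc 0) (D \<omega> \<inter> {-B..B}). ?F y) = linear_statistic f B"
  proof
    fix \<omega>
    have "(\<Sum>y\<in>distinct_tuples (Suc 0) (D \<omega> \<inter> {-B..B}). ?F y) = (\<Sum>y\<in>distinct_tuples (Suc 0) (D \<omega> \<inter> {-B..B}). f (y 0))"
      by (intro sum.cong refl) (auto simp: distinct_tuples_def PiE_iff)
    then show "(\<Sum>y\<in>distinct_tuples (Suc 0) (D \<omega> \<inter> {-B..B}). ?F y) = linear_statistic f B \<omega>"
      by (simp add: sum_distinct_tuples_1 linear_statistic_def)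
  qed
  also have "(\<integral>y. ?F y * sine_det (Suc 0) y \<partial>(\<Pi>\<^sub>M i\<in>{..<Suc 0}. lborel)) = (\<integral>y. 1 / pi * f (y 0) \<partial>(\<Pi>\<^sub>M i\<in>{..<Suc 0}. lborel))"
    by (intro Bochner_Integration.integral_cong refl) (auto simp: sine_det_1 space_PiM PiE_iff)
  also have "\<dots> = (\<integral>u. 1 / pi * f u \<partial>lborel)"
    by (rule integral_PiM_1) measurable
  also have "\<dots> = 1 / pi * (\<integral>u. f u \<partial>lborel)" by simp
  finally show ?thesis .
qed

text \<open>The diagonal of the squared sum gives \<open>1 / pi\<close> times the integral of
  \<open>f^2\<close>. The two-point function gives the square of the mean, minus the integral of
  \<open>f (y 0) * f (y 1)\<close> against the squared kernel. By the inequality between a product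
  and the mean of squares, and by the bound \<open>2 / pi\<close> for the squared kernel, this
  correction is at most \<open>2 / pi\<close> times the integral of \<open>f^2\<close>; hence
  \<open>3 / pi\<close>.\<close>

lemma second_moment:
  fixes f :: "real \<Rightarrow> real"
  assumes B: "0 < B" and f [measurable]: "f \<in> borel_measurable borel" and bf: "\<And>u. \<bar>f u\<bar> \<le> c"
    and supp: "\<And>u. u \<notin> {-B..B} \<Longrightarrow> f u = 0"
  shows "integrable M (\<lambda>\<omega>. (linear_statistic f B \<omega>)\<^sup>2)"
    and "(\<integral>\<omega>. (linear_statistic f B \<omega>)\<^sup>2 \<partial>M) \<le> 3 / pi * (\<integral>u. (f u)\<^sup>2 \<partial>lborel) + (1 / pi * (\<integral>u. f u \<partial>lborel))\<^sup>2"
proof -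
  let ?P = "\<Pi>\<^sub>M i\<in>{..<2::nat}. lborel :: real measure"
  have PP: "sets ?P = sets (\<Pi>\<^sub>M i\<in>{..<2::nat}. borel)" by (intro sets_PiM_cong) auto
  have c: "0 \<le> c" using bf[of 0] abs_ge_zero[of "f 0"] by linarith
  let ?F = "\<lambda>y::nat \<Rightarrow> real. indicator (extensional {..<2::nat}) y * (f (y 0) * f (y 1))"
  have cm [measurable]: "(\<lambda>y. y 0) \<in> borel_measurable (\<Pi>\<^sub>M i\<in>{..<2::nat}. borel :: real measure)"
      "(\<lambda>y. y 1) \<in> borel_measurable (\<Pi>\<^sub>M i\<in>{..<2::nat}. borel :: real measure)"
    by (auto intro!: measurable_component_singleton)
  have fm: "(\<lambda>y. f (y 0) * f (y 1)) \<in> borel_measurable (\<Pi>\<^sub>M i\<in>{..<2::nat}. borel)"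
    by (intro borel_measurable_times measurable_compose[OF _ f] cm)
  then have Fm: "?F \<in> borel_measurable (\<Pi>\<^sub>M i\<in>{..<2::nat}. borel)"
    by (rule measurable_cong[THEN iffD1, rotated]) (auto simp: space_PiM PiE_iff indicator_def)
  have ffc: "\<bar>f a * f b\<bar> \<le> c * c" for a b unfolding abs_mult using bf c by (intro mult_mono) auto
  have h2: "has_bochner_integral M (\<lambda>\<omega>. \<Sum>y\<in>distinct_tuples 2 (D \<omega> \<inter> {-B..B}). ?F y) (\<integral>y. ?F y * sine_det 2 y \<partial>?P)"
  proof (rule correlation[OF B Fm, where c = "c * c"])
    show "\<bar>?F y\<bar> \<le> c * c" for y using ffc[of "y 0" "y 1"] c by (auto simp: indicator_def)
    show "?F y = 0" if "y \<notin> {..<2::nat} \<rightarrow>\<^sub>E {-B..B}" for y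
      using that supp[of "y 0"] supp[of "y 1"] by (auto simp: PiE_iff indicator_def less_2_cases_iff)
  qed
  have h1: "has_bochner_integral M (linear_statistic (\<lambda>u. (f u)\<^sup>2) B) (1 / pi * (\<integral>u. (f u)\<^sup>2 \<partial>lborel))"
  proof (rule first_moment[OF B, where c = "c * c"])
    show "\<bar>(f u)\<^sup>2\<bar> \<le> c * c" for u using ffc[of u u] by (simp add: power2_eq_square)
  qed (use supp in auto)
  have eq: "(linear_statistic f B \<omega>)\<^sup>2 = (\<Sum>y\<in>distinct_tuples 2 (D \<omega> \<inter> {-B..B}). ?F y) + linear_statistic (\<lambda>u. (f u)\<^sup>2) B \<omega>"
    if "\<omega> \<in> space M" for \<omega>
  proof -
    have "(\<Sum>y\<in>distinct_tuples 2 (D \<omega> \<inter> {-B..B}). ?F y) = (\<Sum>y\<in>distinct_tuples 2 (D \<omega> \<inter> {-B..B}). f (y 0) * f (y 1))"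
      by (intro sum.cong refl) (auto simp: distinct_tuples_def PiE_iff)
    then show ?thesis
      using sum_distinct_tuples_2[OF finite_window[OF that]] by (simp add: linear_statistic_def)
  qed
  have h: "has_bochner_integral M (\<lambda>\<omega>. (linear_statistic f B \<omega>)\<^sup>2) ((\<integral>y. ?F y * sine_det 2 y \<partial>?P) + 1 / pi * (\<integral>u. (f u)\<^sup>2 \<partial>lborel))"
    using has_bochner_integral_add[OF h2 h1] by (rule has_bochner_integral_cong[THEN iffD1, rotated 3]) (auto simp: eq)
  show "integrable M (\<lambda>\<omega>. (linear_statistic f B \<omega>)\<^sup>2)" using h by (simp add: has_bochner_integral_iff)
  let ?I = "\<lambda>u. indicator {-B..B} u :: real"
  have bnd: "integrable ?P g" if gm: "g \<in> borel_measurable (\<Pi>\<^sub>M i\<in>{..<2::nat}. borel)" and gb: "\<And>y. \<bar>g y\<bar> \<le> k"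
     and gs: "\<And>y. y 0 \<notin> {-B..B} \<or> y 1 \<notin> {-B..B} \<Longrightarrow> g y = 0" for g :: "(nat \<Rightarrow> real) \<Rightarrow> real" and k
  proof (rule Bochner_Integration.integrable_bound[OF integrable_indicator_cube[of 2 B k]])
    show "g \<in> borel_measurable ?P" using gm by (subst measurable_cong_sets[OF PP refl])
    show "AE y in ?P. norm (g y) \<le> norm (indicator ({..<2::nat} \<rightarrow>\<^sub>E {-B..B}) y * k)"
    proof (rule AE_I2)
      fix y assume y: "y \<in> space ?P"
      have k: "0 \<le> k" using gb[of y] by linarith
      show "norm (g y) \<le> norm (indicator ({..<2::nat} \<rightarrow>\<^sub>E {-B..B}) y * k)"
      proof (cases "y \<in> {..<2::nat} \<rightarrow>\<^sub>E {-B..B}")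
        case False
        then have "g y = 0" using y gs[of y] by (auto simp: space_PiM PiE_iff less_2_cases_iff)
        then show ?thesis by simp
      qed (use gb k in auto)
    qed
  qed
  have s1: "(sine_kernel a b)\<^sup>2 \<le> 1" for a b
  proof -
    have "(sine_kernel a b)\<^sup>2 \<le> 2 / pi\<^sup>2 * (1 / (1 + (b - a)\<^sup>2))" by (rule sine_kernel_square_le)
    also have "\<dots> \<le> 2 / pi\<^sup>2 * 1" by (intro mult_left_mono) (auto simp: divide_le_eq_1 add_pos_nonneg)
    also have "2 \<le> pi\<^sup>2" using power_mono[of 2 pi 2] pi_ge_two by simp
    then have "2 / pi\<^sup>2 * 1 \<le> 1" by simp
    finally show ?thesis .
  qed
  have i0: "integrable ?P (\<lambda>y. f (y 0) * f (y 1))"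
    by (rule bnd[OF fm ffc]) (use supp in auto)
  have i1: "integrable ?P (\<lambda>y. (f (y 0))\<^sup>2 * ?I (y 1) * (sine_kernel (y 0) (y 1))\<^sup>2)"
  proof (rule bnd)
    show "(\<lambda>y. (f (y 0))\<^sup>2 * ?I (y 1) * (sine_kernel (y 0) (y 1))\<^sup>2) \<in> borel_measurable (\<Pi>\<^sub>M i\<in>{..<2::nat}. borel)"
      by (intro borel_measurable_times borel_measurable_power borel_measurable_sine_kernel measurable_compose[OF _ f] measurable_compose[OF cm(2)] cm) auto
    show "\<bar>(f (y 0))\<^sup>2 * ?I (y 1) * (sine_kernel (y 0) (y 1))\<^sup>2\<bar> \<le> c * c * 1 * 1" for y
      unfolding abs_mult using c ffc[of "y 0" "y 0"] s1[of "y 0" "y 1"]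
      by (intro mult_mono) (auto simp: power2_eq_square indicator_def)
  qed (use supp in auto)
  have i2: "integrable ?P (\<lambda>y. (f (y 1))\<^sup>2 * ?I (y 0) * (sine_kernel (y 0) (y 1))\<^sup>2)"
  proof (rule bnd)
    show "(\<lambda>y. (f (y 1))\<^sup>2 * ?I (y 0) * (sine_kernel (y 0) (y 1))\<^sup>2) \<in> borel_measurable (\<Pi>\<^sub>M i\<in>{..<2::nat}. borel)"
      by (intro borel_measurable_times borel_measurable_power borel_measurable_sine_kernel measurable_compose[OF _ f] measurable_compose[OF cm(1)] cm) auto
    show "\<bar>(f (y 1))\<^sup>2 * ?I (y 0) * (sine_kernel (y 0) (y 1))\<^sup>2\<bar> \<le> c * c * 1 * 1" for y
      unfolding abs_mult using c ffc[of "y 1" "y 1"] s1[of "y 0" "y 1"]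
      by (intro mult_mono) (auto simp: power2_eq_square indicator_def)
  qed (use supp in auto)
  have i3: "integrable ?P (\<lambda>y. f (y 0) * f (y 1) * (sine_kernel (y 0) (y 1))\<^sup>2)"
  proof (rule bnd)
    show "(\<lambda>y. f (y 0) * f (y 1) * (sine_kernel (y 0) (y 1))\<^sup>2) \<in> borel_measurable (\<Pi>\<^sub>M i\<in>{..<2::nat}. borel)"
      by (intro borel_measurable_times borel_measurable_power borel_measurable_sine_kernel measurable_compose[OF _ f] cm)
    show "\<bar>f (y 0) * f (y 1) * (sine_kernel (y 0) (y 1))\<^sup>2\<bar> \<le> c * c * 1" for y
      unfolding abs_mult[of "f (y 0) * f (y 1)"] using c ffc[of "y 0" "y 1"] s1[of "y 0" "y 1"]
      by (intro mult_mono) auto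
  qed (use supp in auto)
  have fi: "integrable lborel (\<lambda>u. (f u)\<^sup>2)"
  proof (rule integrable_window[where c = "c * c" and B = B])
    show "norm ((f u)\<^sup>2) \<le> c * c" for u using ffc[of u u] by (simp add: power2_eq_square)
  qed (use supp in auto)
  have v0: "(\<integral>y. f (y 0) * f (y 1) \<partial>?P) = (\<integral>u. f u \<partial>lborel)\<^sup>2"
    using integral_PiM_2(1)[where g = "\<lambda>a b. f a * f b", OF i0] by (simp add: power2_eq_square split_beta')
  have v1: "(\<integral>y. (f (y 0))\<^sup>2 * ?I (y 1) * (sine_kernel (y 0) (y 1))\<^sup>2 \<partial>?P) \<le> 2 / pi * (\<integral>u. (f u)\<^sup>2 \<partial>lborel)"
  proof -
    have "(\<integral>y. (f (y 0))\<^sup>2 * ?I (y 1) * (sine_kernel (y 0) (y 1))\<^sup>2 \<partial>?P)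
        = (\<integral>a. \<integral>b. (f a)\<^sup>2 * ?I b * (sine_kernel a b)\<^sup>2 \<partial>lborel \<partial>lborel)"
      using integral_PiM_2(2)[where g = "\<lambda>a b. (f a)\<^sup>2 * ?I b * (sine_kernel a b)\<^sup>2", OF i1] by (simp add: split_beta')
    also have "\<dots> = (\<integral>a. (f a)\<^sup>2 * (\<integral>b. ?I b * (sine_kernel b a)\<^sup>2 \<partial>lborel) \<partial>lborel)"
      unfolding integral_mult_right_zero[symmetric]
      by (intro Bochner_Integration.integral_cong refl) (metis mult.assoc sine_kernel_commute)
    also have "\<dots> \<le> (\<integral>a. (f a)\<^sup>2 * (2 / pi) \<partial>lborel)"
      using fi by (intro integral_mono' integrable_mult_left mult_left_mono integral_sine_kernel_square_le) auto
    finally show ?thesis by (simp add: mult.commute)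
  qed
  have v2: "(\<integral>y. (f (y 1))\<^sup>2 * ?I (y 0) * (sine_kernel (y 0) (y 1))\<^sup>2 \<partial>?P) \<le> 2 / pi * (\<integral>u. (f u)\<^sup>2 \<partial>lborel)"
  proof -
    have "(\<integral>y. (f (y 1))\<^sup>2 * ?I (y 0) * (sine_kernel (y 0) (y 1))\<^sup>2 \<partial>?P)
        = (\<integral>b. \<integral>a. (f b)\<^sup>2 * ?I a * (sine_kernel a b)\<^sup>2 \<partial>lborel \<partial>lborel)"
      using integral_PiM_2(1)[where g = "\<lambda>a b. (f b)\<^sup>2 * ?I a * (sine_kernel a b)\<^sup>2", OF i2] by (simp add: split_beta')
    also have "\<dots> = (\<integral>b. (f b)\<^sup>2 * (\<integral>a. ?I a * (sine_kernel a b)\<^sup>2 \<partial>lborel) \<partial>lborel)"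
      by (simp add: mult.assoc)
    also have "\<dots> \<le> (\<integral>a. (f a)\<^sup>2 * (2 / pi) \<partial>lborel)"
      using fi by (intro integral_mono' integrable_mult_left mult_left_mono integral_sine_kernel_square_le) auto
    finally show ?thesis by (simp add: mult.commute)
  qed
  have "- (\<integral>y. f (y 0) * f (y 1) * (sine_kernel (y 0) (y 1))\<^sup>2 \<partial>?P)
      \<le> (\<integral>y. 1 / 2 * ((f (y 0))\<^sup>2 * ?I (y 1) * (sine_kernel (y 0) (y 1))\<^sup>2 + (f (y 1))\<^sup>2 * ?I (y 0) * (sine_kernel (y 0) (y 1))\<^sup>2) \<partial>?P)"
    unfolding Bochner_Integration.integral_minus[symmetric]
  proof (rule Bochner_Integration.integral_mono)
    show "integrable ?P (\<lambda>y. - (f (y 0) * f (y 1) * (sine_kernel (y 0) (y 1))\<^sup>2))" using i3 by simp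
    show "integrable ?P (\<lambda>y. 1 / 2 * ((f (y 0))\<^sup>2 * ?I (y 1) * (sine_kernel (y 0) (y 1))\<^sup>2 + (f (y 1))\<^sup>2 * ?I (y 0) * (sine_kernel (y 0) (y 1))\<^sup>2))"
      using i1 i2 by (intro integrable_mult_right Bochner_Integration.integrable_add)
    fix y
    \<comment> \<open>The indicators confine the majorant to the square window; outside it one of
      the factors on the left vanishes.\<close>
    have "- (f (y 0) * f (y 1)) \<le> 1 / 2 * ((f (y 0))\<^sup>2 * ?I (y 1) + (f (y 1))\<^sup>2 * ?I (y 0))"
    proof (cases "y 0 \<in> {-B..B} \<and> y 1 \<in> {-B..B}")
      case True
      have "0 \<le> (f (y 0) + f (y 1))\<^sup>2" by simp
      then show ?thesis using True by (simp add: power2_sum)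
    next
      case False
      then have "f (y 0) * f (y 1) = 0" using supp by auto
      then show ?thesis by (simp only: minus_zero) (auto simp: indicator_def)
    qed
    from mult_right_mono[OF this, of "(sine_kernel (y 0) (y 1))\<^sup>2"]
    show "- (f (y 0) * f (y 1) * (sine_kernel (y 0) (y 1))\<^sup>2) \<le> 1 / 2 * ((f (y 0))\<^sup>2 * ?I (y 1) * (sine_kernel (y 0) (y 1))\<^sup>2 + (f (y 1))\<^sup>2 * ?I (y 0) * (sine_kernel (y 0) (y 1))\<^sup>2)"
      by (simp add: algebra_simps)
  qed
  also have "\<dots> = 1 / 2 * ((\<integral>y. (f (y 0))\<^sup>2 * ?I (y 1) * (sine_kernel (y 0) (y 1))\<^sup>2 \<partial>?P) + (\<integral>y. (f (y 1))\<^sup>2 * ?I (y 0) * (sine_kernel (y 0) (y 1))\<^sup>2 \<partial>?P))"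
    using i1 i2 by simp
  also have "\<dots> \<le> 1 / 2 * (2 / pi * (\<integral>u. (f u)\<^sup>2 \<partial>lborel) + 2 / pi * (\<integral>u. (f u)\<^sup>2 \<partial>lborel))"
    using v1 v2 by (intro mult_left_mono add_mono) auto
  finally have v3: "- (\<integral>y. f (y 0) * f (y 1) * (sine_kernel (y 0) (y 1))\<^sup>2 \<partial>?P) \<le> 2 / pi * (\<integral>u. (f u)\<^sup>2 \<partial>lborel)" by simp
  have "(\<integral>y. ?F y * sine_det 2 y \<partial>?P) = (\<integral>y. (1 / pi)\<^sup>2 * (f (y 0) * f (y 1)) - f (y 0) * f (y 1) * (sine_kernel (y 0) (y 1))\<^sup>2 \<partial>?P)"
    by (intro Bochner_Integration.integral_cong refl) (auto simp: sine_det_2 space_PiM PiE_iff algebra_simps)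
  also have "\<dots> = (1 / pi)\<^sup>2 * (\<integral>u. f u \<partial>lborel)\<^sup>2 - (\<integral>y. f (y 0) * f (y 1) * (sine_kernel (y 0) (y 1))\<^sup>2 \<partial>?P)"
    using i0 i3 by (simp add: v0[unfolded One_nat_def])
  finally have "(\<integral>y. ?F y * sine_det 2 y \<partial>?P) \<le> 2 / pi * (\<integral>u. (f u)\<^sup>2 \<partial>lborel) + (1 / pi * (\<integral>u. f u \<partial>lborel))\<^sup>2"
    using v3 by (simp add: power_mult_distrib power_divide)
  then show "(\<integral>\<omega>. (linear_statistic f B \<omega>)\<^sup>2 \<partial>M) \<le> 3 / pi * (\<integral>u. (f u)\<^sup>2 \<partial>lborel) + (1 / pi * (\<integral>u. f u \<partial>lborel))\<^sup>2"
    using h by (simp add: has_bochner_integral_iff add_divide_distrib)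
qed

text \<open>The variance is at most \<open>3 / pi\<close> times the integral of \<open>f^2\<close>,
  and \<open>3 < pi\<close> absorbs the constant. The mean absolute deviation is the quantity
  wanted, because exponentials will be compared through a Lipschitz bound.\<close>

lemma linear_statistic_deviation:
  fixes f :: "real \<Rightarrow> real"
  assumes B: "0 < B" and f [measurable]: "f \<in> borel_measurable borel" and bf: "\<And>u. \<bar>f u\<bar> \<le> c"
    and supp: "\<And>u. u \<notin> {-B..B} \<Longrightarrow> f u = 0"
  shows "integrable M (\<lambda>\<omega>. \<bar>linear_statistic f B \<omega> - 1 / pi * (\<integral>u. f u \<partial>lborel)\<bar>)"
    and "(\<integral>\<omega>. \<bar>linear_statistic f B \<omega> - 1 / pi * (\<integral>u. f u \<partial>lborel)\<bar> \<partial>M) \<le> sqrt (\<integral>u. (f u)\<^sup>2 \<partial>lborel)"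
proof -
  define m where "m = 1 / pi * (\<integral>u. f u \<partial>lborel)"
  let ?S = "linear_statistic f B"
  have h1: "integrable M ?S" "expectation ?S = m"
    using first_moment[OF assms] by (auto simp: has_bochner_integral_iff m_def)
  have h2: "integrable M (\<lambda>\<omega>. (?S \<omega>)\<^sup>2)" by (rule second_moment(1)[OF assms])
  show "integrable M (\<lambda>\<omega>. \<bar>?S \<omega> - 1 / pi * (\<integral>u. f u \<partial>lborel)\<bar>)"
    using h1 by (intro integrable_abs Bochner_Integration.integrable_diff) auto
  define W where "W \<omega> = \<bar>?S \<omega> - m\<bar>" for \<omega>
  have W: "integrable M W" unfolding W_def[abs_def] using h1 by simp
  have W2: "(W \<omega>)\<^sup>2 = (?S \<omega>)\<^sup>2 - 2 * m * ?S \<omega> + m\<^sup>2" for \<omega>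
    by (simp add: W_def power2_diff)
  have W2i: "integrable M (\<lambda>\<omega>. (W \<omega>)\<^sup>2)" unfolding W2 using h1 h2 by simp
  \<comment> \<open>Nonnegativity of the variance of \<open>W\<close> itself takes the place of the
    Cauchy-Schwarz inequality.\<close>
  have "(expectation W)\<^sup>2 \<le> expectation (\<lambda>\<omega>. (W \<omega>)\<^sup>2)"
    using variance_eq[OF W W2i] variance_positive[of W] by linarith
  also have "\<dots> = expectation (\<lambda>\<omega>. (?S \<omega>)\<^sup>2) - m\<^sup>2"
    unfolding W2 using h1 h2 by (simp add: prob_space power2_eq_square)
  also have "\<dots> \<le> 3 / pi * (\<integral>u. (f u)\<^sup>2 \<partial>lborel)"
    using second_moment(2)[OF assms] by (simp add: m_def)
  also have "\<dots> \<le> 1 * (\<integral>u. (f u)\<^sup>2 \<partial>lborel)"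
    using pi_gt3 by (intro mult_right_mono) auto
  finally have "(expectation W)\<^sup>2 \<le> (\<integral>u. (f u)\<^sup>2 \<partial>lborel)" by simp
  then show "(\<integral>\<omega>. \<bar>?S \<omega> - 1 / pi * (\<integral>u. f u \<partial>lborel)\<bar> \<partial>M) \<le> sqrt (\<integral>u. (f u)\<^sup>2 \<partial>lborel)"
    unfolding m_def[symmetric] W_def[symmetric] by (rule real_le_rsqrt)
qed

text \<open>Real and imaginary part are estimated separately, which is where the factor
  \<open>2\<close> comes from.\<close>

lemma linear_statistic_deviation_complex:
  fixes f :: "real \<Rightarrow> complex"
  assumes B: "0 < B" and f [measurable]: "f \<in> borel_measurable borel" and bf: "\<And>u. norm (f u) \<le> c"
    and supp: "\<And>u. u \<notin> {-B..B} \<Longrightarrow> f u = 0"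
  shows "linear_statistic f B \<in> borel_measurable M"
    and "integrable M (\<lambda>\<omega>. norm (linear_statistic f B \<omega> - 1 / of_real pi * (\<integral>u. f u \<partial>lborel)))"
    and "(\<integral>\<omega>. norm (linear_statistic f B \<omega> - 1 / of_real pi * (\<integral>u. f u \<partial>lborel)) \<partial>M) \<le> 2 * sqrt (\<integral>u. (norm (f u))\<^sup>2 \<partial>lborel)"
proof -
  let ?m = "1 / of_real pi * (\<integral>u. f u \<partial>lborel)"
  let ?S = "linear_statistic f B"
  have fi: "integrable lborel f" by (rule integrable_window[OF f bf supp])
  have n2: "integrable lborel (\<lambda>u. (norm (f u))\<^sup>2)"
  proof (rule integrable_window[where c = "c * c" and B = B])
    show "norm ((norm (f u))\<^sup>2) \<le> c * c" for u
      using mult_mono[OF bf[of u] bf[of u]] norm_ge_zero[of "f u"] bf[of u] by (auto simp: power2_eq_square)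
  qed (use supp in auto)
  have Re: "Re (?S \<omega>) = linear_statistic (\<lambda>u. Re (f u)) B \<omega>" and Im: "Im (?S \<omega>) = linear_statistic (\<lambda>u. Im (f u)) B \<omega>" for \<omega>
    by (simp_all add: linear_statistic_def)
  have bRe: "\<bar>Re (f u)\<bar> \<le> c" and bIm: "\<bar>Im (f u)\<bar> \<le> c" for u
    using abs_Re_le_cmod[of "f u"] abs_Im_le_cmod[of "f u"] bf[of u] by linarith+
  have rm [measurable]: "(\<lambda>u. Re (f u)) \<in> borel_measurable borel" "(\<lambda>u. Im (f u)) \<in> borel_measurable borel" by measurable
  have sR: "Re (f u) = 0" and sI: "Im (f u) = 0" if "u \<notin> {-B..B}" for u using supp[OF that] by auto
  note dR = linear_statistic_deviation[OF B rm(1) bRe sR] and dI = linear_statistic_deviation[OF B rm(2) bIm sI]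
  have mR: "Re ?m = 1 / pi * (\<integral>u. Re (f u) \<partial>lborel)" and mI: "Im ?m = 1 / pi * (\<integral>u. Im (f u) \<partial>lborel)"
    using fi by (simp_all add: Re_divide_of_real Im_divide_of_real)
  show Sm: "?S \<in> borel_measurable M"
  proof -
    have "(\<lambda>\<omega>. Re (?S \<omega>)) \<in> borel_measurable M" "(\<lambda>\<omega>. Im (?S \<omega>)) \<in> borel_measurable M"
      unfolding Re Im
      using first_moment[OF B rm(1) bRe sR] first_moment[OF B rm(2) bIm sI]
      by (auto intro: borel_measurable_has_bochner_integral)
    then show ?thesis by (simp add: borel_measurable_complex_iff)
  qed
  have bnd: "norm (?S \<omega> - ?m) \<le> \<bar>linear_statistic (\<lambda>u. Re (f u)) B \<omega> - 1 / pi * (\<integral>u. Re (f u) \<partial>lborel)\<bar> + \<bar>linear_statistic (\<lambda>u. Im (f u)) B \<omega> - 1 / pi * (\<integral>u. Im (f u) \<partial>lborel)\<bar>" for \<omega>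
    using cmod_le[of "?S \<omega> - ?m"] unfolding minus_complex.simps Re Im mR mI .
  show int: "integrable M (\<lambda>\<omega>. norm (?S \<omega> - ?m))"
  proof (rule Bochner_Integration.integrable_bound[OF Bochner_Integration.integrable_add[OF dR(1) dI(1)]])
    show "(\<lambda>\<omega>. norm (?S \<omega> - ?m)) \<in> borel_measurable M" using Sm by measurable
  qed (use bnd in auto)
  have "(\<integral>\<omega>. norm (?S \<omega> - ?m) \<partial>M) \<le> (\<integral>\<omega>. \<bar>linear_statistic (\<lambda>u. Re (f u)) B \<omega> - 1 / pi * (\<integral>u. Re (f u) \<partial>lborel)\<bar> + \<bar>linear_statistic (\<lambda>u. Im (f u)) B \<omega> - 1 / pi * (\<integral>u. Im (f u) \<partial>lborel)\<bar> \<partial>M)"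
    by (rule Bochner_Integration.integral_mono[OF int Bochner_Integration.integrable_add[OF dR(1) dI(1)] bnd])
  also have "\<dots> \<le> sqrt (\<integral>u. (Re (f u))\<^sup>2 \<partial>lborel) + sqrt (\<integral>u. (Im (f u))\<^sup>2 \<partial>lborel)"
    using dR dI by simp
  also have "\<dots> \<le> sqrt (\<integral>u. (norm (f u))\<^sup>2 \<partial>lborel) + sqrt (\<integral>u. (norm (f u))\<^sup>2 \<partial>lborel)"
    using n2 by (intro add_mono real_sqrt_le_mono integral_mono') (auto simp: cmod_power2)
  finally show "(\<integral>\<omega>. norm (?S \<omega> - ?m) \<partial>M) \<le> 2 * sqrt (\<integral>u. (norm (f u))\<^sup>2 \<partial>lborel)" by simp
qed

end

section \<open>Fredholm expansion and translation invariance\<close>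

lemma card_distinct_tuples:
  assumes "finite Y" "card Y = n"
  shows "card (distinct_tuples n Y) = fact n"
proof -
  have "card {y \<in> {..<n} \<rightarrow>\<^sub>E Y. inj_on y {..<n}} = card Y ^ (card {..<n} - card {..<n}) * prod ((-) (card Y)) {0..<card {..<n}}"
    by (rule card_inj_on_subset_funcset) (use assms in auto)
  also have "\<dots> = (\<Prod>i = 0..<n. n - i)" using assms by simp
  also have "\<dots> = fact n" by (rule fact_prod_rev[symmetric, where 'a = nat, simplified])
  finally show ?thesis by (simp add: distinct_tuples_def)
qed

lemma distinct_tuples_image:
  assumes y: "y \<in> distinct_tuples n X" and X: "finite X"
  shows "card (y ` {..<n}) = n" "y ` {..<n} \<subseteq> X" "finite (y ` {..<n})"
  using y card_image[of y "{..<n}"] by (auto simp: distinct_tuples_def)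

lemma sum_distinct_tuples_prod:
  fixes g :: "real \<Rightarrow> complex"
  assumes X: "finite X"
  shows "(\<Sum>y\<in>distinct_tuples n X. \<Prod>i<n. g (y i)) = fact n * (\<Sum>Y\<in>{Y. Y \<subseteq> X \<and> card Y = n}. \<Prod>x\<in>Y. g x)"
proof -
  let ?P = "{Y. Y \<subseteq> X \<and> card Y = n}"
  have fP: "finite ?P" by (rule finite_subset[of _ "Pow X"]) (use X in auto)
  have "(\<Sum>y\<in>distinct_tuples n X. \<Prod>i<n. g (y i)) = (\<Sum>Y\<in>?P. \<Sum>y\<in>{y \<in> distinct_tuples n X. y ` {..<n} = Y}. \<Prod>i<n. g (y i))"
    by (rule sum.group[symmetric, OF finite_distinct_tuples[OF X] fP]) (use distinct_tuples_image X in blast)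
  also have "\<dots> = (\<Sum>Y\<in>?P. fact n * (\<Prod>x\<in>Y. g x))"
  proof (rule sum.cong[OF refl])
    fix Y assume "Y \<in> ?P"
    then have Y: "Y \<subseteq> X" "card Y = n" "finite Y" using X finite_subset by auto
    have "{y \<in> distinct_tuples n X. y ` {..<n} = Y} = distinct_tuples n Y"
    proof (intro equalityI subsetI)
      fix y assume "y \<in> distinct_tuples n Y"
      then have "card (y ` {..<n}) = card Y" "y ` {..<n} \<subseteq> Y" using distinct_tuples_image Y by auto
      then have "y ` {..<n} = Y" using Y(3) card_subset_eq by blast
      then show "y \<in> {y \<in> distinct_tuples n X. y ` {..<n} = Y}"
        using \<open>y \<in> distinct_tuples n Y\<close> distinct_tuples_mono[OF Y(1)] by auto
    qed (auto simp: distinct_tuples_def PiE_iff)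
    then have "(\<Sum>y\<in>{y \<in> distinct_tuples n X. y ` {..<n} = Y}. \<Prod>i<n. g (y i)) = (\<Sum>y\<in>distinct_tuples n Y. \<Prod>i<n. g (y i))" by simp
    also have "\<dots> = (\<Sum>y\<in>distinct_tuples n Y. \<Prod>x\<in>Y. g x)"
    proof (rule sum.cong[OF refl])
      fix y assume y: "y \<in> distinct_tuples n Y"
      then have "card (y ` {..<n}) = card Y" "y ` {..<n} \<subseteq> Y" using distinct_tuples_image Y by auto
      then have im: "y ` {..<n} = Y" using Y(3) card_subset_eq by blast
      have "inj_on y {..<n}" using y by (simp add: distinct_tuples_def)
      then have "(\<Prod>x\<in>y ` {..<n}. g x) = (\<Prod>i<n. g (y i))" by (simp add: prod.reindex)
      then show "(\<Prod>i<n. g (y i)) = (\<Prod>x\<in>Y. g x)" by (simp add: im)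
    qed
    also have "\<dots> = fact n * (\<Prod>x\<in>Y. g x)" using card_distinct_tuples[OF Y(3,2)] by simp
    finally show "(\<Sum>y\<in>{y \<in> distinct_tuples n X. y ` {..<n} = Y}. \<Prod>i<n. g (y i)) = fact n * (\<Prod>x\<in>Y. g x)" .
  qed
  finally show ?thesis by (simp add: sum_distrib_left)
qed

text \<open>Expanding the product over subsets and grouping these by size gives elementary symmetric
  sums, each set of size \<open>n\<close> being counted by its \<open>fact n\<close> enumerations.
  For a finite configuration the series stops at the number of points.\<close>

lemma prod_one_plus_sums:
  fixes g :: "real \<Rightarrow> complex"
  assumes X: "finite X"
  shows "(\<lambda>n. (\<Sum>y\<in>distinct_tuples n X. \<Prod>i<n. g (y i)) / fact n) sums (\<Prod>x\<in>X. 1 + g x)"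
proof -
  let ?t = "\<lambda>n. \<Sum>Y\<in>{Y. Y \<subseteq> X \<and> card Y = n}. \<Prod>x\<in>Y. g x"
  have t: "(\<Sum>y\<in>distinct_tuples n X. \<Prod>i<n. g (y i)) / fact n = ?t n" for n
    using sum_distinct_tuples_prod[OF X, of g n] by simp
  have "?t sums (\<Sum>n\<in>{..card X}. ?t n)"
  proof (rule sums_finite)
    fix n assume "n \<notin> {..card X}"
    then have e: "{Y. Y \<subseteq> X \<and> card Y = n} = {}" using card_mono[OF X] by auto
    show "?t n = 0" unfolding e by simp
  qed simp
  also have "(\<Sum>n\<in>{..card X}. ?t n) = (\<Sum>n\<in>{..card X}. \<Sum>Y\<in>{Y \<in> Pow X. card Y = n}. \<Prod>x\<in>Y. g x)" by (simp add: Pow_def)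
  also have "\<dots> = (\<Sum>Y\<in>Pow X. \<Prod>x\<in>Y. g x)"
    by (rule sum.group) (use X card_mono[OF X] in auto)
  also have "\<dots> = (\<Prod>x\<in>X. g x + 1)" by (subst prod_add[OF X]) simp
  finally show ?thesis unfolding t by (simp add: add.commute)
qed

context sine_process
begin

lemma correlation_complex:
  fixes F :: "(nat \<Rightarrow> real) \<Rightarrow> complex"
  assumes B: "0 < B" and F [measurable]: "F \<in> borel_measurable (\<Pi>\<^sub>M i\<in>{..<n}. borel)" and bF: "\<And>y. norm (F y) \<le> c"
    and supp: "\<And>y. y \<notin> {..<n} \<rightarrow>\<^sub>E {-B..B} \<Longrightarrow> F y = 0"
  shows "has_bochner_integral M (\<lambda>\<omega>. \<Sum>y\<in>distinct_tuples n (D \<omega> \<inter> {-B..B}). F y)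
      (\<integral>y. F y * of_real (sine_det n y) \<partial>(\<Pi>\<^sub>M i\<in>{..<n}. lborel))"
proof -
  let ?P = "\<Pi>\<^sub>M i\<in>{..<n}. lborel :: real measure"
  have PP: "sets ?P = sets (\<Pi>\<^sub>M i\<in>{..<n}. borel)" by (intro sets_PiM_cong) auto
  have b: "\<bar>Re (F y)\<bar> \<le> c" "\<bar>Im (F y)\<bar> \<le> c" for y
    using abs_Re_le_cmod[of "F y"] abs_Im_le_cmod[of "F y"] bF[of y] by linarith+
  have s: "Re (F y) = 0" "Im (F y) = 0" if "y \<notin> {..<n} \<rightarrow>\<^sub>E {-B..B}" for y using supp[OF that] by auto
  have hR: "has_bochner_integral M (\<lambda>\<omega>. \<Sum>y\<in>distinct_tuples n (D \<omega> \<inter> {-B..B}). Re (F y)) (\<integral>y. Re (F y) * sine_det n y \<partial>?P)"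
    by (rule correlation[OF B _ b(1) s(1)]) measurable
  have hI: "has_bochner_integral M (\<lambda>\<omega>. \<Sum>y\<in>distinct_tuples n (D \<omega> \<inter> {-B..B}). Im (F y)) (\<integral>y. Im (F y) * sine_det n y \<partial>?P)"
    by (rule correlation[OF B _ b(2) s(2)]) measurable
  have int: "integrable ?P (\<lambda>y. F y * of_real (sine_det n y))"
  proof (rule Bochner_Integration.integrable_bound[OF integrable_indicator_cube[of n B "c * (1 / pi) ^ n"]])
    show "(\<lambda>y. F y * of_real (sine_det n y)) \<in> borel_measurable ?P"
      by (subst measurable_cong_sets[OF PP refl]) measurable
    show "AE y in ?P. norm (F y * of_real (sine_det n y)) \<le> norm (indicator ({..<n} \<rightarrow>\<^sub>E {-B..B}) y * (c * (1 / pi) ^ n))"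
    proof (rule AE_I2)
      fix y
      have c: "0 \<le> c" using bF[of y] norm_ge_zero[of "F y"] by linarith
      have "norm (F y * of_real (sine_det n y)) \<le> c * (1 / pi) ^ n"
        unfolding norm_mult norm_of_real using bF[of y] c sine_det_bounds[of n y] by (intro mult_mono) auto
      then show "norm (F y * of_real (sine_det n y)) \<le> norm (indicator ({..<n} \<rightarrow>\<^sub>E {-B..B}) y * (c * (1 / pi) ^ n))"
        using supp[of y] c by (cases "y \<in> {..<n} \<rightarrow>\<^sub>E {-B..B}") auto
    qed
  qed
  have "has_bochner_integral M (\<lambda>\<omega>. of_real (\<Sum>y\<in>distinct_tuples n (D \<omega> \<inter> {-B..B}). Re (F y)) + \<i> * of_real (\<Sum>y\<in>distinct_tuples n (D \<omega> \<inter> {-B..B}). Im (F y)))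
     (of_real (\<integral>y. Re (F y) * sine_det n y \<partial>?P) + \<i> * of_real (\<integral>y. Im (F y) * sine_det n y \<partial>?P))"
    by (intro has_bochner_integral_add has_bochner_integral_mult_right has_bochner_integral_of_real hR hI)
  also have "(\<lambda>\<omega>. of_real (\<Sum>y\<in>distinct_tuples n (D \<omega> \<inter> {-B..B}). Re (F y)) + \<i> * of_real (\<Sum>y\<in>distinct_tuples n (D \<omega> \<inter> {-B..B}). Im (F y)))
      = (\<lambda>\<omega>. \<Sum>y\<in>distinct_tuples n (D \<omega> \<inter> {-B..B}). F y)"
    by (rule ext) (simp add: complex_eq_iff)
  also have "of_real (\<integral>y. Re (F y) * sine_det n y \<partial>?P) + \<i> * of_real (\<integral>y. Im (F y) * sine_det n y \<partial>?P) = (\<integral>y. F y * of_real (sine_det n y) \<partial>?P)"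
  proof -
    have "Re (\<integral>y. F y * of_real (sine_det n y) \<partial>?P) = (\<integral>y. Re (F y) * sine_det n y \<partial>?P)"
      "Im (\<integral>y. F y * of_real (sine_det n y) \<partial>?P) = (\<integral>y. Im (F y) * sine_det n y \<partial>?P)"
      using int by (simp_all flip: integral_Re integral_Im)
    then show ?thesis by (simp add: complex_eq_iff)
  qed
  finally show ?thesis .
qed

text \<open>
  The Fredholm expansion of \<open>E (\<Prod>u. 1 + g u)\<close> transfers the translation invariance of the kernel to
  linear statistics without identifying the law of the shifted process.
\<close>

definition fredholm_term :: "(real \<Rightarrow> complex) \<Rightarrow> nat \<Rightarrow> complex" where
  "fredholm_term g n = (\<integral>y. (\<Prod>i<n. g (y i)) * of_real (sine_det n y) \<partial>(\<Pi>\<^sub>M i\<in>{..<n}. lborel))"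

text \<open>Translating every coordinate by \<open>a\<close> undoes the shift in \<open>g\<close>,
  and the determinant is unchanged because the kernel depends on differences only.\<close>

lemma fredholm_term_shift:
  assumes g [measurable]: "g \<in> borel_measurable borel"
  shows "fredholm_term (\<lambda>u. g (u - a)) n = fredholm_term g n"
proof -
  let ?P = "\<Pi>\<^sub>M i\<in>{..<n}. lborel :: real measure"
  have PP: "sets ?P = sets (\<Pi>\<^sub>M i\<in>{..<n}. borel)" by (intro sets_PiM_cong) auto
  have "fredholm_term (\<lambda>u. g (u - a)) n = (\<integral>y. (\<Prod>i<n. 1) *\<^sub>R ((\<Prod>i<n. g ((\<lambda>i\<in>{..<n}. y i + a) i - a)) * of_real (sine_det n (\<lambda>i\<in>{..<n}. y i + a))) \<partial>?P)"
    unfolding fredholm_term_def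
  proof (rule integral_PiM_lborel_transform[where w = "\<lambda>_. 1"])
    have "(\<lambda>y. y i) \<in> borel_measurable (\<Pi>\<^sub>M i\<in>{..<n}. borel)" if "i \<in> {..<n}" for i
      using that by (intro measurable_component_singleton)
    then have "(\<lambda>y. \<Prod>i<n. g (y i - a)) \<in> borel_measurable (\<Pi>\<^sub>M i\<in>{..<n}. borel)"
      by (intro borel_measurable_prod measurable_compose[OF _ g] borel_measurable_diff borel_measurable_const)
    then have "(\<lambda>y. (\<Prod>i<n. g (y i - a)) * of_real (sine_det n y)) \<in> borel_measurable (\<Pi>\<^sub>M i\<in>{..<n}. borel)"
      by measurable
    then show "(\<lambda>y. (\<Prod>i<n. g (y i - a)) * of_real (sine_det n y)) \<in> borel_measurable ?P"
      by (subst measurable_cong_sets[OF PP refl])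
  qed (use nn_integral_lborel_shift in auto)
  also have "\<dots> = fredholm_term g n"
    unfolding fredholm_term_def
  proof (rule Bochner_Integration.integral_cong[OF refl])
    fix y :: "nat \<Rightarrow> real"
    have "sine_det n (\<lambda>i\<in>{..<n}. y i + a) = sine_det n (\<lambda>i. y i + a)" by (rule sine_det_cong) simp
    also have "\<dots> = sine_det n y"
      using sine_kernel_shift[where a = "- a"] by (simp add: sine_det_def)
    finally show "(\<Prod>i<n. 1) *\<^sub>R ((\<Prod>i<n. g ((\<lambda>i\<in>{..<n}. y i + a) i - a)) * of_real (sine_det n (\<lambda>i\<in>{..<n}. y i + a))) = (\<Prod>i<n. g (y i)) * of_real (sine_det n y)"
      by simp
  qed
  finally show ?thesis .
qed

text \<open>Expectation and expansion may be exchanged: by Hadamard's inequality the expected number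
  of \<open>n\<close>-tuples in the window is at most \<open>(2 * B / pi) ^ n\<close>, and the
  factor \<open>c ^ n / fact n\<close> makes these bounds summable.\<close>

lemma expectation_prod_one_plus:
  assumes B: "0 < B" and g [measurable]: "g \<in> borel_measurable borel" and bg: "\<And>u. norm (g u) \<le> c"
    and supp: "\<And>u. u \<notin> {-B..B} \<Longrightarrow> g u = 0"
  shows "(\<lambda>n. fredholm_term g n / fact n) sums (\<integral>\<omega>. (\<Prod>u\<in>D \<omega> \<inter> {-B..B}. 1 + g u) \<partial>M)"
    and "(\<lambda>\<omega>. \<Prod>u\<in>D \<omega> \<inter> {-B..B}. 1 + g u) \<in> borel_measurable M"
proof -
  have c: "0 \<le> c" using bg[of 0] norm_ge_zero[of "g 0"] by linarith
  let ?P = "\<lambda>n. \<Pi>\<^sub>M i\<in>{..<n::nat}. lborel :: real measure"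
  have PP: "sets (?P n) = sets (\<Pi>\<^sub>M i\<in>{..<n}. borel)" for n by (intro sets_PiM_cong) auto
  let ?C = "\<lambda>n. {..<n::nat} \<rightarrow>\<^sub>E {-B..B}"
  have Cs: "?C n \<in> sets (\<Pi>\<^sub>M i\<in>{..<n}. borel)" for n by (intro sets_PiM_I_finite) auto
  define G where "G n y = indicator (?C n) y * (\<Prod>i<n. g (y i))" for n and y :: "nat \<Rightarrow> real"
  define s where "s n \<omega> = (\<Sum>y\<in>distinct_tuples n (D \<omega> \<inter> {-B..B}). \<Prod>i<n. g (y i)) / fact n" for n \<omega>
  define N where "N n \<omega> = real (card (distinct_tuples n (D \<omega> \<inter> {-B..B})))" for n \<omega>
  have pm: "(\<lambda>y. \<Prod>i<n. g (y i)) \<in> borel_measurable (\<Pi>\<^sub>M i\<in>{..<n}. borel)" for n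
  proof -
    have "(\<lambda>y. y i) \<in> borel_measurable (\<Pi>\<^sub>M i\<in>{..<n}. borel)" if "i \<in> {..<n}" for i
      using that by (intro measurable_component_singleton)
    then show ?thesis by (intro borel_measurable_prod measurable_compose[OF _ g])
  qed
  have Gm: "G n \<in> borel_measurable (\<Pi>\<^sub>M i\<in>{..<n}. borel)" for n
    unfolding G_def[abs_def] by (intro borel_measurable_times pm borel_measurable_indicator Cs)
  have pb: "norm (\<Prod>i<n. g (y i)) \<le> c ^ n" for n and y :: "nat \<Rightarrow> real"
    using prod_mono[of "{..<n}" "\<lambda>i. norm (g (y i))" "\<lambda>_. c"] bg by (simp add: prod_norm[symmetric])
  have hG: "has_bochner_integral M (\<lambda>\<omega>. \<Sum>y\<in>distinct_tuples n (D \<omega> \<inter> {-B..B}). G n y) (\<integral>y. G n y * of_real (sine_det n y) \<partial>?P n)" for n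
  proof (rule correlation_complex[OF B Gm, where c = "c ^ n"])
    show "norm (G n y) \<le> c ^ n" for y using pb[of y n] c by (auto simp: G_def indicator_def)
  qed (simp add: G_def)
  have "(\<integral>y. G n y * of_real (sine_det n y) \<partial>?P n) = fredholm_term g n" for n
    unfolding fredholm_term_def
  proof (rule Bochner_Integration.integral_cong[OF refl])
    fix y assume "y \<in> space (?P n)"
    then have "y \<in> extensional {..<n}" by (auto simp: space_PiM PiE_iff)
    then have "G n y = (\<Prod>i<n. g (y i))"
    proof (cases "y \<in> ?C n")
      case False
      then obtain i where "i < n" "y i \<notin> {-B..B}" using \<open>y \<in> extensional {..<n}\<close> by (auto simp: PiE_iff)
      then have "(\<Prod>i<n. g (y i)) = 0" using supp by (intro prod_zero) auto
      then show ?thesis by (simp add: G_def)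
    qed (simp add: G_def)
    then show "G n y * of_real (sine_det n y) = (\<Prod>i<n. g (y i)) * of_real (sine_det n y)" by simp
  qed
  moreover have "(\<Sum>y\<in>distinct_tuples n (D \<omega> \<inter> {-B..B}). G n y) / fact n = s n \<omega>" for n \<omega>
    unfolding s_def by (intro arg_cong2[of _ _ _ _ "(/)"] sum.cong refl) (auto simp: G_def distinct_tuples_def PiE_iff indicator_def)
  ultimately have hs: "has_bochner_integral M (s n) (fredholm_term g n / fact n)" for n
    using has_bochner_integral_divide_zero[OF hG[of n], of "fact n"] by simp
  have hN: "has_bochner_integral M (N n) (\<integral>y. indicator (?C n) y * sine_det n y \<partial>?P n)" for n
  proof -
    have "has_bochner_integral M (\<lambda>\<omega>. \<Sum>y\<in>distinct_tuples n (D \<omega> \<inter> {-B..B}). indicator (?C n) y :: real) (\<integral>y. indicator (?C n) y * sine_det n y \<partial>?P n)"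
      by (rule correlation[OF B, where c = 1]) (use Cs in \<open>auto simp: indicator_def\<close>)
    also have "(\<lambda>\<omega>. \<Sum>y\<in>distinct_tuples n (D \<omega> \<inter> {-B..B}). indicator (?C n) y :: real) = (\<lambda>\<omega>. \<Sum>y\<in>distinct_tuples n (D \<omega> \<inter> {-B..B}). 1 :: real)"
      by (intro ext sum.cong refl) (auto simp: distinct_tuples_def PiE_iff indicator_def)
    finally show ?thesis by (simp add: N_def[abs_def])
  qed
  have Nb: "(\<integral>\<omega>. N n \<omega> \<partial>M) \<le> (2 * B / pi) ^ n" for n
  proof -
    interpret product_sigma_finite "\<lambda>_::nat. lborel :: real measure" ..
    have "(\<integral>y. indicator (?C n) y * sine_det n y \<partial>?P n) \<le> (\<integral>y. indicator (?C n) y * (1 / pi) ^ n \<partial>?P n)"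
      using sine_det_bounds
      by (intro integral_mono' integrable_indicator_cube) (auto simp: indicator_def)
    also have "\<dots> = measure (?P n) (?C n) * (1 / pi) ^ n"
      using Cs[of n] unfolding PP[symmetric] by simp
    also have "measure (?P n) (?C n) = (2 * B) ^ n"
    proof -
      have "emeasure (?P n) (?C n) = (\<Prod>i<n. emeasure lborel {-B..B})" by (rule emeasure_PiM) auto
      also have "\<dots> = ennreal ((2 * B) ^ n)" using B by (simp add: ennreal_power)
      finally show ?thesis using B by (simp add: measure_def)
    qed
    finally show ?thesis using hN[of n] by (simp add: has_bochner_integral_iff power_mult_distrib power_divide)
  qed
  have nb: "norm (s n \<omega>) \<le> c ^ n / fact n * N n \<omega>" for n \<omega>
  proof -
    have "norm (\<Sum>y\<in>distinct_tuples n (D \<omega> \<inter> {-B..B}). \<Prod>i<n. g (y i)) \<le> (\<Sum>y\<in>distinct_tuples n (D \<omega> \<inter> {-B..B}). c ^ n)"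
      by (intro sum_norm_le pb)
    then show ?thesis by (simp add: s_def N_def norm_divide field_simps)
  qed
  have sN: "integrable M (\<lambda>\<omega>. c ^ n / fact n * N n \<omega>)" for n
    using hN by (intro integrable_mult_right) (simp add: has_bochner_integral_iff)
  have ns: "(\<integral>\<omega>. norm (s n \<omega>) \<partial>M) \<le> (c * (2 * B / pi)) ^ n / fact n" for n
  proof -
    have "(\<integral>\<omega>. norm (s n \<omega>) \<partial>M) \<le> (\<integral>\<omega>. c ^ n / fact n * N n \<omega> \<partial>M)"
      using hs[of n] nb by (intro Bochner_Integration.integral_mono sN) (auto simp: has_bochner_integral_iff)
    also have "\<dots> = c ^ n / fact n * (\<integral>\<omega>. N n \<omega> \<partial>M)" by (rule integral_mult_right_zero)
    also have "\<dots> \<le> c ^ n / fact n * (2 * B / pi) ^ n" using Nb[of n] c by (intro mult_left_mono) auto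
    finally show ?thesis by (simp only: power_mult_distrib times_divide_eq_left)
  qed
  have sum1: "summable (\<lambda>n. (c * (2 * B / pi)) ^ n / fact n)"
    using summable_exp_generic[of "c * (2 * B / pi)"] by (simp add: divide_inverse mult.commute)
  have sumI: "summable (\<lambda>n. \<integral>\<omega>. norm (s n \<omega>) \<partial>M)"
    by (rule summable_comparison_test'[OF sum1, of 0]) (use ns in simp)
  have sint: "integrable M (s n)" for n using hs[of n] by (simp add: has_bochner_integral_iff)
  have ptw: "(\<lambda>n. s n \<omega>) sums (\<Prod>u\<in>D \<omega> \<inter> {-B..B}. 1 + g u)" if "\<omega> \<in> space M" for \<omega>
    unfolding s_def by (rule prod_one_plus_sums[OF finite_window[OF that]])
  have sumptw: "AE \<omega> in M. summable (\<lambda>n. norm (s n \<omega>))"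
  proof (rule AE_I2)
    fix \<omega> assume \<omega>: "\<omega> \<in> space M"
    have fin: "finite (D \<omega> \<inter> {-B..B})" by (rule finite_window[OF \<omega>])
    have "s n \<omega> = 0" if "n \<notin> {..card (D \<omega> \<inter> {-B..B})}" for n
    proof -
      have e: "{Y. Y \<subseteq> D \<omega> \<inter> {-B..B} \<and> card Y = n} = {}" using card_mono[OF fin] that by auto
      show ?thesis unfolding s_def sum_distinct_tuples_prod[OF fin] e by simp
    qed
    then show "summable (\<lambda>n. norm (s n \<omega>))" by (intro summable_finite[of "{..card (D \<omega> \<inter> {-B..B})}"]) auto
  qed
  have "(\<lambda>n. \<integral>\<omega>. s n \<omega> \<partial>M) sums (\<integral>\<omega>. (\<Sum>n. s n \<omega>) \<partial>M)"
    by (rule sums_integral[OF sint sumptw sumI])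
  also have "(\<integral>\<omega>. (\<Sum>n. s n \<omega>) \<partial>M) = (\<integral>\<omega>. (\<Prod>u\<in>D \<omega> \<inter> {-B..B}. 1 + g u) \<partial>M)"
    using ptw by (intro Bochner_Integration.integral_cong refl) (simp add: sums_iff)
  also have "(\<lambda>n. \<integral>\<omega>. s n \<omega> \<partial>M) = (\<lambda>n. fredholm_term g n / fact n)"
    using hs by (simp add: has_bochner_integral_iff)
  finally show "(\<lambda>n. fredholm_term g n / fact n) sums (\<integral>\<omega>. (\<Prod>u\<in>D \<omega> \<inter> {-B..B}. 1 + g u) \<partial>M)" .
  show "(\<lambda>\<omega>. \<Prod>u\<in>D \<omega> \<inter> {-B..B}. 1 + g u) \<in> borel_measurable M"
  proof (rule borel_measurable_LIMSEQ_metric)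
    show "(\<lambda>\<omega>. \<Sum>k<n. s k \<omega>) \<in> borel_measurable M" for n
      using sint by (intro borel_measurable_sum) auto
    show "(\<lambda>n. \<Sum>k<n. s k \<omega>) \<longlonglongrightarrow> (\<Prod>u\<in>D \<omega> \<inter> {-B..B}. 1 + g u)" if "\<omega> \<in> space M" for \<omega>
      using ptw[OF that] by (simp add: sums_def)
  qed
qed

lemma norm_exp_upper_half_plane: "Im z \<ge> 0 \<Longrightarrow> norm (exp (\<i> * z)) \<le> 1"
  by simp

lemma exp_linear_statistic:
  assumes "\<omega> \<in> space M"
  shows "exp (\<i> * linear_statistic f B \<omega>) = (\<Prod>u\<in>D \<omega> \<inter> {-B..B}. 1 + (exp (\<i> * f u) - 1))"
  using finite_window[OF assms, of B] by (simp add: linear_statistic_def sum_distrib_left exp_sum)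

text \<open>The exponential is a product of factors \<open>1 + g u\<close> with
  \<open>g u = exp (\<i> * f u) - 1\<close>, bounded by \<open>2\<close> because \<open>f\<close>
  takes values in the closed upper half plane. Both \<open>f\<close> and its translate have to fit
  into the one window over which the products run.\<close>

lemma exp_linear_statistic_shift:
  fixes f :: "real \<Rightarrow> complex"
  assumes B: "0 < B" and f [measurable]: "f \<in> borel_measurable borel" and Im: "\<And>u. Im (f u) \<ge> 0"
    and supp: "\<And>u. u \<notin> {-B..B} \<Longrightarrow> f u = 0" and supp': "\<And>u. u \<notin> {-B..B} \<Longrightarrow> f (u - a) = 0"
  shows "(\<integral>\<omega>. exp (\<i> * linear_statistic (\<lambda>u. f (u - a)) B \<omega>) \<partial>M) = (\<integral>\<omega>. exp (\<i> * linear_statistic f B \<omega>) \<partial>M)"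
proof -
  define g where "g u = exp (\<i> * f u) - 1" for u
  have gm [measurable]: "g \<in> borel_measurable borel" unfolding g_def[abs_def] by measurable
  have gb: "norm (g u) \<le> 2" for u
  proof -
    have "norm (g u) \<le> norm (exp (\<i> * f u)) + norm (1 :: complex)" unfolding g_def by (rule norm_triangle_ineq4)
    then show ?thesis using norm_exp_upper_half_plane[OF Im[of u]] by (simp only: norm_one)
  qed
  have sg: "g u = 0" if "u \<notin> {-B..B}" for u using supp[OF that] by (simp add: g_def)
  have sg': "g (u - a) = 0" if "u \<notin> {-B..B}" for u using supp'[OF that] by (simp add: g_def)
  have "(\<lambda>n. fredholm_term (\<lambda>u. g (u - a)) n / fact n) sums (\<integral>\<omega>. (\<Prod>u\<in>D \<omega> \<inter> {-B..B}. 1 + g (u - a)) \<partial>M)"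
    by (rule expectation_prod_one_plus(1)[OF B _ gb sg']) measurable
  moreover have "(\<lambda>n. fredholm_term g n / fact n) sums (\<integral>\<omega>. (\<Prod>u\<in>D \<omega> \<inter> {-B..B}. 1 + g u) \<partial>M)"
    by (rule expectation_prod_one_plus(1)[OF B gm gb sg])
  ultimately have "(\<integral>\<omega>. (\<Prod>u\<in>D \<omega> \<inter> {-B..B}. 1 + g (u - a)) \<partial>M) = (\<integral>\<omega>. (\<Prod>u\<in>D \<omega> \<inter> {-B..B}. 1 + g u) \<partial>M)"
    unfolding fredholm_term_shift[OF gm] by (rule sums_unique2)
  then show ?thesis
    by (simp add: exp_linear_statistic g_def cong: Bochner_Integration.integral_cong)
qed

end

text \<open>The derivative of \<open>exp (\<i> * (of_real t * z))\<close> has modulus at most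
  \<open>t\<close> on the closed upper half plane, which is convex. This turns closeness in mean of
  two such sums into closeness of their characteristic functions.\<close>

lemma norm_exp_diff_upper_half_plane:
  fixes z w :: complex
  assumes "Im z \<ge> 0" "Im w \<ge> 0" "t \<ge> 0"
  shows "norm (exp (\<i> * (of_real t * z)) - exp (\<i> * (of_real t * w))) \<le> t * norm (z - w)"
proof (rule field_differentiable_bound[where S = "{z. Im z \<ge> 0}"])
  show "convex {z. Im z \<ge> 0}" by (rule convex_halfspace_Im_ge)
  show "((\<lambda>z. exp (\<i> * (of_real t * z))) has_field_derivative exp (\<i> * (of_real t * z)) * (\<i> * of_real t)) (at z within {z. Im z \<ge> 0})" for z
    by (auto intro!: derivative_eq_intros)
  show "norm (exp (\<i> * (of_real t * z)) * (\<i> * of_real t)) \<le> t" if "z \<in> {z. Im z \<ge> 0}" for z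
    using that assms(3) by (simp add: norm_mult mult_left_le_one_le)
qed (use assms in auto)

lemma (in prob_space) expectation_exp_diff_le:
  fixes U V :: "'a \<Rightarrow> complex"
  assumes [measurable]: "U \<in> borel_measurable M" "V \<in> borel_measurable M"
    and U: "\<And>\<omega>. \<omega> \<in> space M \<Longrightarrow> Im (U \<omega>) \<ge> 0" and V: "\<And>\<omega>. \<omega> \<in> space M \<Longrightarrow> Im (V \<omega>) \<ge> 0" and t: "t \<ge> 0"
    and int: "integrable M (\<lambda>\<omega>. norm (U \<omega> - V \<omega>))"
  shows "norm ((\<integral>\<omega>. exp (\<i> * (of_real t * U \<omega>)) \<partial>M) - (\<integral>\<omega>. exp (\<i> * (of_real t * V \<omega>)) \<partial>M)) \<le> t * (\<integral>\<omega>. norm (U \<omega> - V \<omega>) \<partial>M)"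
proof -
  have iU: "integrable M (\<lambda>\<omega>. exp (\<i> * (of_real t * U \<omega>)))"
    by (rule integrable_const_bound[where B = 1]) (use U t in auto)
  have iV: "integrable M (\<lambda>\<omega>. exp (\<i> * (of_real t * V \<omega>)))"
    by (rule integrable_const_bound[where B = 1]) (use V t in auto)
  have "norm ((\<integral>\<omega>. exp (\<i> * (of_real t * U \<omega>)) \<partial>M) - (\<integral>\<omega>. exp (\<i> * (of_real t * V \<omega>)) \<partial>M))
      = norm (\<integral>\<omega>. exp (\<i> * (of_real t * U \<omega>)) - exp (\<i> * (of_real t * V \<omega>)) \<partial>M)"
    using iU iV by simp
  also have "\<dots> \<le> (\<integral>\<omega>. norm (exp (\<i> * (of_real t * U \<omega>)) - exp (\<i> * (of_real t * V \<omega>))) \<partial>M)"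
    by (rule integral_norm_bound)
  also have "\<dots> \<le> (\<integral>\<omega>. t * norm (U \<omega> - V \<omega>) \<partial>M)"
    by (rule Bochner_Integration.integral_mono[OF integrable_norm[OF Bochner_Integration.integrable_diff[OF iU iV]] integrable_mult_right[OF int] norm_exp_diff_upper_half_plane[OF U V t]])
  finally show ?thesis by simp
qed

subsection \<open>Stieltjes transforms of the sine process\<close>

definition stieltjes :: "complex \<Rightarrow> real \<Rightarrow> complex" where
  "stieltjes z u = 1 / (of_real u - z)"

lemma borel_measurable_stieltjes [measurable]: "stieltjes z \<in> borel_measurable borel"
  unfolding stieltjes_def by measurable

lemma Im_stieltjes: "Im z > 0 \<Longrightarrow> Im (stieltjes z u) \<ge> 0"
  by (simp add: stieltjes_def Im_divide divide_nonneg_nonneg)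

lemma norm_stieltjes_le: "Im z > 0 \<Longrightarrow> norm (stieltjes z u) \<le> 1 / Im z"
  using abs_Im_le_cmod[of "of_real u - z"] by (auto simp: stieltjes_def norm_divide intro!: divide_left_mono mult_pos_pos)

lemma stieltjes_shift: "stieltjes (of_real a + z) u = stieltjes z (u - a)"
  by (simp add: stieltjes_def algebra_simps)

lemma norm_stieltjes_square: "(norm (stieltjes (of_real a + \<i> * of_real c) u))\<^sup>2 = 1 / ((u - a)\<^sup>2 + c\<^sup>2)"
  by (simp add: stieltjes_def norm_divide power_divide cmod_power2)

text \<open>The vertical sides of the rectangle have length at most \<open>\<eta>\<close> each.\<close>

lemma rectangle_bound:
  fixes Q :: "complex \<Rightarrow> complex"
  assumes hol: "Q holomorphic_on {z. Im z > 0}" and bnd: "\<And>z. Im z > 0 \<Longrightarrow> norm (Q z) \<le> 1"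
    and e: "0 < \<epsilon>" "\<epsilon> \<le> \<eta>" and L: "0 < L"
  shows "norm ((LINT a:{0..L}|lborel. Q (of_real a + \<i> * of_real \<epsilon>)) - (LINT a:{0..L}|lborel. Q (of_real a + \<i> * of_real \<eta>))) \<le> 2 * \<eta>"
proof -
  let ?S = "{z. Im z > 0}"
  have S: "open ?S" "convex ?S" by (auto simp: open_halfspace_Im_gt convex_halfspace_Im_gt)
  define h where "h y a = Q (of_real a + \<i> * of_real y)" for y a :: real
  let ?p = "\<lambda>x y. of_real x + \<i> * of_real y :: complex"
  have hor: "contour_integral (linepath (?p 0 y) (?p L y)) Q = (LINT a:{0..L}|lborel. h y a)"
      "Q contour_integrable_on (linepath (?p 0 y) (?p L y))" if y: "y > 0" for y
  proof -
    have seg: "closed_segment (?p 0 y) (?p L y) \<subseteq> ?S" using y by (intro closed_segment_subset S) auto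
    have cont: "continuous_on (closed_segment (?p 0 y) (?p L y)) Q"
      using hol seg by (intro holomorphic_on_imp_continuous_on) (rule holomorphic_on_subset)
    then show "Q contour_integrable_on (linepath (?p 0 y) (?p L y))" by (rule contour_integrable_continuous_linepath)
    have ch: "continuous_on {0..L} (h y)"
      unfolding h_def[abs_def] by (rule continuous_on_compose2[OF holomorphic_on_imp_continuous_on[OF hol]]) (use y in \<open>auto intro!: continuous_intros\<close>)
    have shift: "contour_integral (linepath (?p 0 y) (?p L y)) Q = contour_integral (linepath (of_real 0) (of_real L)) (\<lambda>z. Q (z + \<i> * of_real y))"
      unfolding contour_integral_integral
      by (intro integral_cong) (auto simp: linepath_def algebra_simps)
    also have "\<dots> = integral {0..L} (h y)"
      using L by (subst contour_integral_linepath_Reals_eq) (auto simp: h_def[abs_def])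
    also have "\<dots> = (LINT a:{0..L}|lborel. h y a)"
      using ch by (intro set_borel_integral_eq_integral(2)[symmetric] borel_integrable_atLeastAtMost')
    finally show "contour_integral (linepath (?p 0 y) (?p L y)) Q = (LINT a:{0..L}|lborel. h y a)" .
  qed
  have ver: "norm (contour_integral (linepath (?p x \<epsilon>) (?p x \<eta>)) Q) \<le> \<eta>"
      "Q contour_integrable_on (linepath (?p x \<epsilon>) (?p x \<eta>))" for x
  proof -
    have seg: "closed_segment (?p x \<epsilon>) (?p x \<eta>) \<subseteq> ?S" using e by (intro closed_segment_subset S) auto
    have cont: "continuous_on (closed_segment (?p x \<epsilon>) (?p x \<eta>)) Q"
      using hol seg by (intro holomorphic_on_imp_continuous_on) (rule holomorphic_on_subset)
    then show i: "Q contour_integrable_on (linepath (?p x \<epsilon>) (?p x \<eta>))" by (rule contour_integrable_continuous_linepath)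
    have "norm (contour_integral (linepath (?p x \<epsilon>) (?p x \<eta>)) Q) \<le> 1 * norm (?p x \<eta> - ?p x \<epsilon>)"
      by (rule contour_integral_bound_linepath[OF i]) (use seg bnd in auto)
    also have "?p x \<eta> - ?p x \<epsilon> = \<i> * of_real (\<eta> - \<epsilon>)" by (simp add: algebra_simps)
    also have "norm \<dots> = \<eta> - \<epsilon>" using e by (simp only: norm_mult norm_ii norm_of_real) simp
    finally show "norm (contour_integral (linepath (?p x \<epsilon>) (?p x \<eta>)) Q) \<le> \<eta>" using e by simp
  qed
  have ep: "\<eta> > 0" using e by simp
  let ?g = "linepath (?p 0 \<epsilon>) (?p L \<epsilon>) +++ linepath (?p L \<epsilon>) (?p L \<eta>) +++ linepath (?p L \<eta>) (?p 0 \<eta>) +++ linepath (?p 0 \<eta>) (?p 0 \<epsilon>)"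
  have rev: "(Q has_contour_integral - contour_integral (linepath a b) Q) (linepath b a)"
    if "Q contour_integrable_on (linepath a b)" for a b
    using has_contour_integral_reversepath[OF valid_path_linepath has_contour_integral_integral[OF that]] by simp
  have "(Q has_contour_integral (contour_integral (linepath (?p 0 \<epsilon>) (?p L \<epsilon>)) Q + (contour_integral (linepath (?p L \<epsilon>) (?p L \<eta>)) Q
      + (- contour_integral (linepath (?p 0 \<eta>) (?p L \<eta>)) Q + - contour_integral (linepath (?p 0 \<epsilon>) (?p 0 \<eta>)) Q)))) ?g"
    by (intro has_contour_integral_join has_contour_integral_integral hor(2) ver(2) rev e ep valid_path_join valid_path_linepath) auto
  moreover have "(Q has_contour_integral 0) ?g"
  proof (rule Cauchy_theorem_convex_simple[OF hol S(2)])
    show "path_image ?g \<subseteq> ?S"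
    proof -
      have seg: "closed_segment a b \<subseteq> ?S" if "Im a > 0" "Im b > 0" for a b
        using that by (intro closed_segment_subset S) auto
      show ?thesis
        using e ep by (simp add: path_image_join seg)
    qed
  qed (auto intro!: valid_path_join)
  ultimately have "contour_integral (linepath (?p 0 \<epsilon>) (?p L \<epsilon>)) Q + (contour_integral (linepath (?p L \<epsilon>) (?p L \<eta>)) Q
      + (- contour_integral (linepath (?p 0 \<eta>) (?p L \<eta>)) Q + - contour_integral (linepath (?p 0 \<epsilon>) (?p 0 \<eta>)) Q)) = 0"
    by (rule has_contour_integral_unique)
  then have "(LINT a:{0..L}|lborel. h \<epsilon> a) - (LINT a:{0..L}|lborel. h \<eta> a)
      = contour_integral (linepath (?p 0 \<epsilon>) (?p 0 \<eta>)) Q - contour_integral (linepath (?p L \<epsilon>) (?p L \<eta>)) Q"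
    unfolding hor(1)[OF e(1), symmetric] hor(1)[OF ep, symmetric] by (simp add: algebra_simps add_eq_0_iff)
  also have "norm \<dots> \<le> \<eta> + \<eta>"
    by (rule order_trans[OF norm_triangle_ineq4 add_mono[OF ver(1) ver(1)]])
  finally show ?thesis by (simp add: h_def)
qed

text \<open>The integral of \<open>1 / (u - z)\<close> over \<open>{-B..B}\<close> at
  \<open>z = a + \<i> * c\<close>, from the primitive with real part
  \<open>ln \<bar>u - z\<bar>\<close> and imaginary part \<open>arctan ((u - a) / c)\<close>. As
  \<open>B\<close> grows it tends to \<open>\<i> * pi\<close>; multiplied by the density
  \<open>1 / pi\<close> this is \<open>\<i>\<close>, the point at which the sums
  concentrate.\<close>

definition window_mean :: "real \<Rightarrow> real \<Rightarrow> real \<Rightarrow> complex" where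
  "window_mean c a B = Complex (1/2 * (ln ((B - a)\<^sup>2 + c\<^sup>2) - ln ((B + a)\<^sup>2 + c\<^sup>2))) (arctan ((B - a) / c) + arctan ((B + a) / c))"

lemma has_bochner_integral_stieltjes_window:
  assumes c: "0 < c" and B: "0 \<le> B"
  shows "has_bochner_integral lborel (\<lambda>u. indicator {-B..B} u *\<^sub>R stieltjes (of_real a + \<i> * of_real c) u) (window_mean c a B)"
proof -
  define F where "F u = Complex (1/2 * ln ((u - a)\<^sup>2 + c\<^sup>2)) (arctan ((u - a) / c))" for u
  let ?f = "stieltjes (of_real a + \<i> * of_real c)"
  have pos: "0 < (u - a)\<^sup>2 + c\<^sup>2" for u using c by (simp add: add_nonneg_pos)
  have f: "?f u = Complex ((u - a) / ((u - a)\<^sup>2 + c\<^sup>2)) (c / ((u - a)\<^sup>2 + c\<^sup>2))" for u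
    by (simp add: stieltjes_def complex_eq_iff Re_divide Im_divide)
  have dln: "((\<lambda>u. 1/2 * ln ((u - a)\<^sup>2 + c\<^sup>2)) has_real_derivative (u - a) / ((u - a)\<^sup>2 + c\<^sup>2)) (at u within S)" for u S
    using pos[of u] by (auto intro!: derivative_eq_intros simp: divide_simps) (simp_all add: algebra_simps power2_eq_square)
  have datan: "((\<lambda>u. arctan ((u - a) / c)) has_real_derivative c / ((u - a)\<^sup>2 + c\<^sup>2)) (at u within S)" for u S
  proof -
    have "((\<lambda>u. arctan ((u - a) / c)) has_real_derivative inverse (1 + ((u - a) / c)\<^sup>2) * (1 / c)) (at u within S)"
      by (rule DERIV_chain2[OF DERIV_arctan]) (use c in \<open>auto intro!: derivative_eq_intros\<close>)
    moreover have "inverse (1 + ((u - a) / c)\<^sup>2) * (1 / c) = c / ((u - a)\<^sup>2 + c\<^sup>2)"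
    proof -
      have "1 + ((u - a) / c)\<^sup>2 = ((u - a)\<^sup>2 + c\<^sup>2) / c\<^sup>2" using c by (simp add: power_divide add_divide_distrib)
      then show ?thesis using c pos[of u] by (simp add: power2_eq_square)
    qed
    ultimately show ?thesis by simp
  qed
  have "(F has_vector_derivative ?f u) (at u within {-B..B})" for u
    unfolding F_def f has_vector_derivative_complex_iff
    using dln datan by simp
  then have "has_bochner_integral lborel (\<lambda>u. indicator {-B..B} u *\<^sub>R ?f u) (F B - F (- B))"
    using B c by (intro has_bochner_integral_FTC_Icc) (auto simp: stieltjes_def complex_eq_iff intro!: continuous_intros)
  moreover have "F B - F (- B) = window_mean c a B"
  proof -
    have "(- B - a)\<^sup>2 = (B + a)\<^sup>2" by (simp add: power2_eq_square algebra_simps)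
    moreover have "arctan ((- B - a) / c) = - arctan ((B + a) / c)"
      by (metis arctan_minus minus_divide_left minus_add_distrib diff_conv_add_uminus)
    ultimately show ?thesis by (simp add: F_def window_mean_def complex_eq_iff right_diff_distrib)
  qed
  ultimately show ?thesis by simp
qed

text \<open>By \<open>norm_stieltjes_square\<close> this is the squared L2 norm that controls the
  fluctuations of the sum at height \<open>c\<close>; its decay is the reason for concentration high
  above the real line.\<close>

lemma has_bochner_integral_norm_stieltjes:
  assumes c: "0 < c"
  shows "has_bochner_integral lborel (\<lambda>u. 1 / ((u - a)\<^sup>2 + c\<^sup>2)) (pi / c)"
proof -
  have "has_bochner_integral lborel (\<lambda>u. 1 / (1 + (- a / c + 1 / c * u)\<^sup>2)) (pi /\<^sub>R \<bar>1 / c\<bar>)"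
    using has_bochner_integral_inverse_square lborel_has_bochner_integral_real_affine_iff[of "1 / c" "\<lambda>x. 1 / (1 + x\<^sup>2)" pi "- a / c"] c by simp
  then have "has_bochner_integral lborel (\<lambda>u. 1 / c\<^sup>2 * (1 / (1 + (- a / c + 1 / c * u)\<^sup>2))) (1 / c\<^sup>2 * (pi /\<^sub>R \<bar>1 / c\<bar>))"
    by (intro has_bochner_integral_mult_right)
  moreover have "1 / c\<^sup>2 * (1 / (1 + (- a / c + 1 / c * u)\<^sup>2)) = 1 / ((u - a)\<^sup>2 + c\<^sup>2)" for u
  proof -
    have "- a / c + 1 / c * u = (u - a) / c" by (simp add: diff_divide_distrib)
    moreover have "c\<^sup>2 * (1 + ((u - a) / c)\<^sup>2) = (u - a)\<^sup>2 + c\<^sup>2" using c by (simp add: power_divide distrib_left)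
    ultimately show ?thesis by (metis divide_divide_eq_left' mult_1 times_divide_times_eq)
  qed
  moreover have "1 / c\<^sup>2 * (pi /\<^sub>R \<bar>1 / c\<bar>) = pi / c" using c by (simp add: power2_eq_square)
  ultimately show ?thesis by simp
qed

text \<open>
  Deviations of the real and imaginary part of \<open>window_mean\<close> from their values \<open>0\<close> and \<open>\<pi>\<close> for an
  infinite window.
\<close>

definition log_defect :: "real \<Rightarrow> real \<Rightarrow> real \<Rightarrow> real" where
  "log_defect c L B = ln ((B + L)\<^sup>2 + c\<^sup>2) - ln ((B - L)\<^sup>2 + c\<^sup>2)"

definition arctan_defect :: "real \<Rightarrow> real" where
  "arctan_defect x = pi - 2 * arctan x"

lemma Re_window_mean:
  assumes c: "0 < c" and a: "0 \<le> a" "a \<le> L" "L < B"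
  shows "\<bar>Re (window_mean c a B)\<bar> \<le> log_defect c L B"
proof -
  have p: "0 < x\<^sup>2 + c\<^sup>2" for x using c by (simp add: add_nonneg_pos)
  have sq: "(B - L)\<^sup>2 \<le> (B - a)\<^sup>2" "(B - a)\<^sup>2 \<le> (B + a)\<^sup>2" "(B + a)\<^sup>2 \<le> (B + L)\<^sup>2"
    using a by (auto intro!: power_mono)
  have "ln ((B - L)\<^sup>2 + c\<^sup>2) \<le> ln ((B - a)\<^sup>2 + c\<^sup>2)" "ln ((B - a)\<^sup>2 + c\<^sup>2) \<le> ln ((B + a)\<^sup>2 + c\<^sup>2)" "ln ((B + a)\<^sup>2 + c\<^sup>2) \<le> ln ((B + L)\<^sup>2 + c\<^sup>2)"
    using sq p by (simp_all add: ln_le_cancel_iff)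
  then show ?thesis by (simp add: window_mean_def log_defect_def)
qed

text \<open>The imaginary part is the angle under which the window is seen from \<open>z\<close>. It
  is at most \<open>pi\<close>, and the ends of the window, at horizontal distance at least
  \<open>B - L\<close>, bound what is missing.\<close>

lemma Im_window_mean:
  assumes c: "0 < c" and a: "0 \<le> a" "a \<le> L" "L < B"
  shows "Im (window_mean c a B) \<le> pi" "pi - Im (window_mean c a B) \<le> arctan_defect ((B - L) / c)"
proof -
  show "Im (window_mean c a B) \<le> pi"
    using arctan_ubound[of "(B - a) / c"] arctan_ubound[of "(B + a) / c"] by (simp add: window_mean_def)
  have "arctan ((B - L) / c) \<le> arctan ((B - a) / c)" "arctan ((B - L) / c) \<le> arctan ((B + a) / c)"
    using a c by (auto intro!: arctan_monotone' divide_right_mono)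
  then show "pi - Im (window_mean c a B) \<le> arctan_defect ((B - L) / c)"
    by (simp add: window_mean_def arctan_defect_def)
qed

lemma window_mean_0: "window_mean c 0 A = Complex 0 (2 * arctan (A / c))"
  by (simp add: window_mean_def)

section \<open>Truncated sums: concentration and recentring\<close>

context sine_process
begin

definition truncated_sum :: "complex \<Rightarrow> real \<Rightarrow> 'a \<Rightarrow> complex" where
  "truncated_sum z B = linear_statistic (stieltjes z) B"

text \<open>The cut-off integrand has bounded support, as the moment bounds demand, and the sum does
  not change.\<close>

lemma truncated_sum_window:
  "truncated_sum z B = linear_statistic (\<lambda>u. indicator {-B..B} u *\<^sub>R stieltjes z u) B"
  unfolding truncated_sum_def linear_statistic_def by (intro ext sum.cong refl) auto

lemma Im_truncated_sum: "Im z > 0 \<Longrightarrow> Im (truncated_sum z B \<omega>) \<ge> 0"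
  unfolding truncated_sum_def linear_statistic_def by (simp add: sum_nonneg Im_stieltjes)

lemma norm_windowed_stieltjes: "Im z > 0 \<Longrightarrow> norm (indicator {-B..B} u *\<^sub>R stieltjes z u) \<le> 1 / Im z"
  using norm_stieltjes_le[of z u] by (auto simp: indicator_def)

lemma measurable_truncated_sum [measurable]:
  assumes "0 < B" "Im z > 0"
  shows "truncated_sum z B \<in> borel_measurable M"
  unfolding truncated_sum_window
  by (rule linear_statistic_deviation_complex(1)[OF assms(1) _ norm_windowed_stieltjes[OF assms(2)]]) auto

text \<open>The two defects bound the distance of the expectation from \<open>\<i>\<close>, and
  \<open>2 * sqrt (pi / \<eta>)\<close> bounds the deviation from the expectation; at
  \<open>\<i>\<close> itself the exponential is \<open>exp (- t)\<close>. The estimate is uniform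
  for \<open>a\<close> in \<open>{0..L}\<close>, so it survives averaging over a horizontal
  side.\<close>

lemma truncated_sum_near_i:
  assumes c: "0 < \<eta>" and a: "0 \<le> a" "a \<le> L" "L < B" and t: "0 \<le> t"
  shows "norm ((\<integral>\<omega>. exp (\<i> * (of_real t * truncated_sum (of_real a + \<i> * of_real \<eta>) B \<omega>)) \<partial>M) - exp (- of_real t))
      \<le> t * (log_defect \<eta> L B + arctan_defect ((B - L) / \<eta>) + 2 * sqrt (pi / \<eta>))"
proof -
  let ?z = "of_real a + \<i> * of_real \<eta> :: complex"
  let ?f = "\<lambda>u. indicator {-B..B} u *\<^sub>R stieltjes ?z u"
  have B: "0 < B" using a by simp
  have z: "Im ?z > 0" using c by simp
  have fm: "?f \<in> borel_measurable borel" by measurable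
  have supp: "?f u = 0" if "u \<notin> {-B..B}" for u using that by simp
  note dev = linear_statistic_deviation_complex[OF B fm norm_windowed_stieltjes[OF z] supp, folded truncated_sum_window]
  have m: "(\<integral>u. ?f u \<partial>lborel) = window_mean \<eta> a B"
    using has_bochner_integral_stieltjes_window[OF c less_imp_le[OF B]] by (simp add: has_bochner_integral_iff)
  let ?m = "1 / of_real pi * window_mean \<eta> a B"
  have "(\<integral>u. (norm (?f u))\<^sup>2 \<partial>lborel) \<le> (\<integral>u. 1 / ((u - a)\<^sup>2 + \<eta>\<^sup>2) \<partial>lborel)"
  proof (rule integral_mono')
    show "integrable lborel (\<lambda>u. 1 / ((u - a)\<^sup>2 + \<eta>\<^sup>2))"
      using has_bochner_integral_norm_stieltjes[OF c] by (simp add: has_bochner_integral_iff)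
    show "(norm (?f u))\<^sup>2 \<le> 1 / ((u - a)\<^sup>2 + \<eta>\<^sup>2)" for u
      using norm_stieltjes_square[of a \<eta> u] by (auto simp: indicator_def)
  qed auto
  also have "\<dots> = pi / \<eta>" using has_bochner_integral_norm_stieltjes[OF c] by (simp add: has_bochner_integral_iff)
  finally have n2: "sqrt (\<integral>u. (norm (?f u))\<^sup>2 \<partial>lborel) \<le> sqrt (pi / \<eta>)" by (rule real_sqrt_le_mono)
  have mi: "norm (?m - \<i>) \<le> log_defect \<eta> L B + arctan_defect ((B - L) / \<eta>)"
  proof -
    have "norm (?m - \<i>) \<le> \<bar>Re (?m - \<i>)\<bar> + \<bar>Im (?m - \<i>)\<bar>" by (rule cmod_le)
    also have "Re (?m - \<i>) = Re (window_mean \<eta> a B) / pi" by (simp add: Re_divide_of_real)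
    also have "Im (?m - \<i>) = - ((pi - Im (window_mean \<eta> a B)) / pi)" by (simp add: Im_divide_of_real diff_divide_distrib)
    also have "\<bar>Re (window_mean \<eta> a B) / pi\<bar> \<le> \<bar>Re (window_mean \<eta> a B)\<bar>"
      using pi_ge_two by (simp add: abs_divide divide_le_eq mult_le_cancel_left1)
    also have "\<bar>Re (window_mean \<eta> a B)\<bar> \<le> log_defect \<eta> L B" by (rule Re_window_mean[OF c a])
    also have "\<bar>- ((pi - Im (window_mean \<eta> a B)) / pi)\<bar> \<le> pi - Im (window_mean \<eta> a B)"
      using Im_window_mean(1)[OF c a] pi_ge_two by (simp add: divide_le_eq mult_le_cancel_left1)
    also have "\<dots> \<le> arctan_defect ((B - L) / \<eta>)" by (rule Im_window_mean(2)[OF c a])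
    finally show ?thesis by simp
  qed
  let ?U = "truncated_sum ?z B"
  have int: "integrable M (\<lambda>\<omega>. norm (?U \<omega> - \<i>))"
  proof (rule Bochner_Integration.integrable_bound)
    show "integrable M (\<lambda>\<omega>. norm (?U \<omega> - ?m) + norm (?m - \<i>))" using dev(2) by (simp add: m)
    have "norm (?U \<omega> - \<i>) \<le> norm (?U \<omega> - ?m) + norm (?m - \<i>)" for \<omega>
      using norm_triangle_ineq[of "?U \<omega> - ?m" "?m - \<i>"] by simp
    then show "AE \<omega> in M. norm (norm (?U \<omega> - \<i>)) \<le> norm (norm (?U \<omega> - ?m) + norm (?m - \<i>))" by simp
    show "(\<lambda>\<omega>. norm (?U \<omega> - \<i>)) \<in> borel_measurable M" using dev(1) by measurable
  qed
  have "(\<integral>\<omega>. norm (?U \<omega> - \<i>) \<partial>M) \<le> (\<integral>\<omega>. norm (?U \<omega> - ?m) + norm (?m - \<i>) \<partial>M)"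
  proof (rule Bochner_Integration.integral_mono[OF int])
    show "integrable M (\<lambda>\<omega>. norm (?U \<omega> - ?m) + norm (?m - \<i>))" using dev(2) by (simp add: m)
    show "norm (?U \<omega> - \<i>) \<le> norm (?U \<omega> - ?m) + norm (?m - \<i>)" for \<omega>
      using norm_triangle_ineq[of "?U \<omega> - ?m" "?m - \<i>"] by simp
  qed
  also have "\<dots> = (\<integral>\<omega>. norm (?U \<omega> - ?m) \<partial>M) + norm (?m - \<i>)"
    using dev(2) by (simp add: m prob_space)
  also have "\<dots> \<le> 2 * sqrt (pi / \<eta>) + (log_defect \<eta> L B + arctan_defect ((B - L) / \<eta>))"
    using dev(3) n2 mi unfolding m by linarith
  finally have E: "(\<integral>\<omega>. norm (?U \<omega> - \<i>) \<partial>M) \<le> log_defect \<eta> L B + arctan_defect ((B - L) / \<eta>) + 2 * sqrt (pi / \<eta>)" by simp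
  have "norm ((\<integral>\<omega>. exp (\<i> * (of_real t * ?U \<omega>)) \<partial>M) - (\<integral>\<omega>. exp (\<i> * (of_real t * \<i>)) \<partial>M)) \<le> t * (\<integral>\<omega>. norm (?U \<omega> - \<i>) \<partial>M)"
    using dev(1) Im_truncated_sum[OF z] by (intro expectation_exp_diff_le[OF _ _ _ _ t int]) auto
  also have "\<dots> \<le> t * (log_defect \<eta> L B + arctan_defect ((B - L) / \<eta>) + 2 * sqrt (pi / \<eta>))"
    using E t by (rule mult_left_mono)
  also have "(\<integral>\<omega>. exp (\<i> * (of_real t * \<i>)) \<partial>M) = (exp (- of_real t) :: complex)"
  proof -
    have "\<i> * (of_real t * \<i>) = - complex_of_real t" by (simp add: complex_eq_iff)
    then show ?thesis by (simp add: prob_space)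
  qed
  finally show ?thesis .
qed

text \<open>Relates the small window of radius \<open>A\<close> about the origin to the large window
  \<open>{-B..B}\<close> that is common to all \<open>a\<close>. Translation by \<open>a\<close> is
  exact and carries the small window to \<open>{a-A..a+A}\<close>. The remainder \<open>g\<close>
  lives at distance at least \<open>A\<close> from \<open>a\<close>, so its squared L2 norm is at
  most \<open>2 * pi / A\<close>, however small \<open>\<epsilon>\<close> is.\<close>

lemma truncated_sum_recenter:
  assumes e: "0 < \<epsilon>" and A: "0 < A" and a: "0 \<le> a" "a \<le> L" "A + L \<le> B" and t: "0 \<le> t"
  shows "norm ((\<integral>\<omega>. exp (\<i> * (of_real t * truncated_sum (\<i> * of_real \<epsilon>) A \<omega>)) \<partial>M) - (\<integral>\<omega>. exp (\<i> * (of_real t * truncated_sum (of_real a + \<i> * of_real \<epsilon>) B \<omega>)) \<partial>M))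
      \<le> t * (log_defect \<epsilon> L B + arctan_defect (A / \<epsilon>) + 2 * sqrt (2 * pi / A))"
proof -
  let ?w = "\<i> * of_real \<epsilon> :: complex" and ?z = "of_real a + \<i> * of_real \<epsilon> :: complex"
  have B: "0 < B" "L < B" "a < B" using a A by auto
  have z: "Im ?z > 0" "Im ?w > 0" using e by auto
  define f where "f u = indicator {-A..A} u *\<^sub>R stieltjes ?w u" for u
  have fm [measurable]: "f \<in> borel_measurable borel" unfolding f_def[abs_def] by measurable
  have fz: "f (u - a) = indicator {a-A..a+A} u *\<^sub>R stieltjes ?z u" for u
    by (auto simp: f_def stieltjes_shift indicator_def)
  have Imf: "Im (f u) \<ge> 0" for u using Im_stieltjes[OF z(2)] by (simp add: f_def)
  have f0: "f u = 0" if "u \<notin> {-B..B}" for u using that a A by (auto simp: f_def indicator_def)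
  have fA0: "f u = 0" if "u \<notin> {-A..A}" for u using that by (simp add: f_def)
  have f0': "f (u - a) = 0" if "u \<notin> {-B..B}" for u using that a A unfolding fz by (auto simp: indicator_def)
  have fb: "norm (f u) \<le> 1 / \<epsilon>" for u using norm_windowed_stieltjes[OF z(2), of A u] by (simp add: f_def)
  let ?V = "\<lambda>\<omega>. linear_statistic (\<lambda>u. f (u - a)) B \<omega>"
  have shift: "(\<integral>\<omega>. exp (\<i> * (of_real t * truncated_sum ?w A \<omega>)) \<partial>M) = (\<integral>\<omega>. exp (\<i> * (of_real t * ?V \<omega>)) \<partial>M)"
  proof -
    have lin: "of_real t * linear_statistic q B \<omega> = linear_statistic (\<lambda>u. of_real t * q u) B \<omega>" for q :: "real \<Rightarrow> complex" and \<omega>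
      by (simp add: linear_statistic_def sum_distrib_left)
    have "(\<integral>\<omega>. exp (\<i> * (of_real t * truncated_sum ?w A \<omega>)) \<partial>M) = (\<integral>\<omega>. exp (\<i> * (of_real t * linear_statistic f B \<omega>)) \<partial>M)"
    proof (intro Bochner_Integration.integral_cong refl)
      fix \<omega> assume "\<omega> \<in> space M"
      then have "linear_statistic f B \<omega> = linear_statistic f A \<omega>"
        using a A by (intro linear_statistic_mono fA0) auto
      then show "exp (\<i> * (of_real t * truncated_sum ?w A \<omega>)) = exp (\<i> * (of_real t * linear_statistic f B \<omega>))"
        by (simp add: truncated_sum_window f_def[abs_def])
    qed
    also have "\<dots> = (\<integral>\<omega>. exp (\<i> * linear_statistic (\<lambda>u. of_real t * f u) B \<omega>) \<partial>M)" by (simp add: lin)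
    also have "\<dots> = (\<integral>\<omega>. exp (\<i> * linear_statistic (\<lambda>u. of_real t * f (u - a)) B \<omega>) \<partial>M)"
      by (rule exp_linear_statistic_shift[OF B(1), of "\<lambda>u. of_real t * f u", symmetric]) (use Imf t f0 f0' in auto)
    finally show ?thesis by (simp add: lin)
  qed
  define g where "g u = (indicator {-B..B} u - indicator {a-A..a+A} u) *\<^sub>R stieltjes ?z u" for u
  have gm [measurable]: "g \<in> borel_measurable borel" unfolding g_def[abs_def] by measurable
  have g0: "g u = 0" if "u \<notin> {-B..B}" for u using that a A by (auto simp: g_def indicator_def)
  have sub: "{a-A..a+A} \<subseteq> {-B..B}" using a A by auto
  have gb: "norm (g u) \<le> 1 / \<epsilon>" for u
    using norm_stieltjes_le[OF z(1), of u] sub e by (auto simp: g_def indicator_def)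
  have diff: "truncated_sum ?z B \<omega> - ?V \<omega> = linear_statistic g B \<omega>" for \<omega>
    unfolding truncated_sum_window fz linear_statistic_def sum_subtractf[symmetric]
    by (intro sum.cong refl) (simp add: g_def scaleR_diff_left)
  note dev = linear_statistic_deviation_complex[OF B(1) gm gb g0]
  have mg: "(\<integral>u. g u \<partial>lborel) = window_mean \<epsilon> a B - window_mean \<epsilon> 0 A"
  proof -
    have 1: "has_bochner_integral lborel (\<lambda>u. indicator {-B..B} u *\<^sub>R stieltjes ?z u) (window_mean \<epsilon> a B)"
      by (rule has_bochner_integral_stieltjes_window[OF e less_imp_le[OF B(1)]])
    have "has_bochner_integral lborel f (window_mean \<epsilon> 0 A)"
      using has_bochner_integral_stieltjes_window[OF e less_imp_le[OF A], of 0] by (simp add: f_def[abs_def])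
    then have "has_bochner_integral lborel (\<lambda>u. f (- a + 1 * u)) (window_mean \<epsilon> 0 A)"
      using lborel_has_bochner_integral_real_affine_iff[of 1 f "window_mean \<epsilon> 0 A" "- a"] by simp
    then have 2: "has_bochner_integral lborel (\<lambda>u. indicator {a-A..a+A} u *\<^sub>R stieltjes ?z u) (window_mean \<epsilon> 0 A)"
      unfolding fz[symmetric] by simp
    show ?thesis
      using has_bochner_integral_diff[OF 1 2] by (simp add: has_bochner_integral_iff g_def[abs_def] scaleR_diff_left)
  qed
  have "(\<integral>u. (norm (g u))\<^sup>2 \<partial>lborel) \<le> (\<integral>u. 2 * (1 / ((u - a)\<^sup>2 + A\<^sup>2)) \<partial>lborel)"
  proof (rule integral_mono')
    show "integrable lborel (\<lambda>u. 2 * (1 / ((u - a)\<^sup>2 + A\<^sup>2)))"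
      using has_bochner_integral_norm_stieltjes[OF A] by (intro integrable_mult_right) (simp add: has_bochner_integral_iff)
    show "(norm (g u))\<^sup>2 \<le> 2 * (1 / ((u - a)\<^sup>2 + A\<^sup>2))" for u
    proof (cases "u \<in> {-B..B} \<and> u \<notin> {a-A..a+A}")
      case True
      then have "A \<le> \<bar>u - a\<bar>" by auto
      then have sq: "A\<^sup>2 \<le> (u - a)\<^sup>2" using A power_mono[of A "\<bar>u - a\<bar>" 2] by simp
      have "(norm (g u))\<^sup>2 = 1 / ((u - a)\<^sup>2 + \<epsilon>\<^sup>2)"
        using True norm_stieltjes_square[of a \<epsilon> u] by (simp add: g_def)
      \<comment> \<open>Since \<open>A \<le> \<bar>u - a\<bar>\<close>, replacing
        \<open>\<epsilon>\<close> by \<open>A\<close> costs a factor \<open>2\<close>; this removes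
        the dependence on the height.\<close>
      also have "\<dots> \<le> 2 / ((u - a)\<^sup>2 + A\<^sup>2)"
      proof -
        have p: "0 < A\<^sup>2" using A by simp
        have twice: "x + y \<le> 2 * (x + z)" if "y \<le> x" "0 \<le> z" for x y z :: real using that by simp
        have "(u - a)\<^sup>2 + A\<^sup>2 \<le> 2 * ((u - a)\<^sup>2 + \<epsilon>\<^sup>2)" by (rule twice[OF sq zero_le_power2])
        moreover have "0 < (u - a)\<^sup>2 + A\<^sup>2" "0 < (u - a)\<^sup>2 + \<epsilon>\<^sup>2" using p sq zero_le_power2[of \<epsilon>] by linarith+
        ultimately show ?thesis by (simp add: divide_simps)
      qed
      finally show ?thesis by simp
    next
      case False
      then have "g u = 0" using sub by (auto simp: g_def indicator_def)
      then show ?thesis by simp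
    qed
  qed auto
  also have "\<dots> = 2 * pi / A"
    using has_bochner_integral_mult_right[OF has_bochner_integral_norm_stieltjes[OF A, of a], of 2]
    by (simp only: has_bochner_integral_iff times_divide_eq_right)
  finally have n2: "sqrt (\<integral>u. (norm (g u))\<^sup>2 \<partial>lborel) \<le> sqrt (2 * pi / A)" by (rule real_sqrt_le_mono)
  let ?m = "1 / of_real pi * (\<integral>u. g u \<partial>lborel)"
  have mn: "norm ?m \<le> log_defect \<epsilon> L B + arctan_defect (A / \<epsilon>)"
  proof -
    let ?d = "window_mean \<epsilon> a B - window_mean \<epsilon> 0 A"
    have "norm ?m = norm ?d / pi" by (simp add: mg norm_divide)
    also have "\<dots> \<le> norm ?d" using pi_ge_two by (simp add: divide_le_eq mult_le_cancel_left1)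
    also have "\<dots> \<le> \<bar>Re ?d\<bar> + \<bar>Im ?d\<bar>" by (rule cmod_le)
    also have "\<bar>Re ?d\<bar> \<le> log_defect \<epsilon> L B" using Re_window_mean[OF e a(1,2) B(2)] by (simp add: window_mean_0)
    also have "\<bar>Im ?d\<bar> \<le> arctan_defect (A / \<epsilon>)"
    proof -
      have "arctan (A / \<epsilon>) \<le> arctan ((B - L) / \<epsilon>)" using a e by (intro arctan_monotone' divide_right_mono) auto
      then have "2 * arctan (A / \<epsilon>) \<le> Im (window_mean \<epsilon> a B)"
        using Im_window_mean(2)[OF e a(1,2) B(2)] by (simp add: arctan_defect_def)
      then show ?thesis using Im_window_mean(1)[OF e a(1,2) B(2)] by (simp add: window_mean_0 arctan_defect_def)
    qed
    finally show ?thesis by simp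
  qed
  have tri: "norm (linear_statistic g B \<omega>) \<le> norm (linear_statistic g B \<omega> - ?m) + norm ?m" for \<omega>
    using norm_triangle_ineq[of "linear_statistic g B \<omega> - ?m" ?m] by simp
  have gi: "integrable M (\<lambda>\<omega>. norm (linear_statistic g B \<omega> - ?m) + norm ?m)" using dev(2) by simp
  have int: "integrable M (\<lambda>\<omega>. norm (linear_statistic g B \<omega>))"
    by (rule Bochner_Integration.integrable_bound[OF gi]) (use dev(1) tri in auto)
  have "(\<integral>\<omega>. norm (linear_statistic g B \<omega>) \<partial>M) \<le> (\<integral>\<omega>. norm (linear_statistic g B \<omega> - ?m) + norm ?m \<partial>M)"
    by (rule Bochner_Integration.integral_mono[OF int gi tri])
  also have "\<dots> = (\<integral>\<omega>. norm (linear_statistic g B \<omega> - ?m) \<partial>M) + norm ?m" using dev(2) by (simp add: prob_space)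
  also have "\<dots> \<le> 2 * sqrt (2 * pi / A) + (log_defect \<epsilon> L B + arctan_defect (A / \<epsilon>))"
    using dev(3) n2 mn by linarith
  finally have E: "(\<integral>\<omega>. norm (linear_statistic g B \<omega>) \<partial>M) \<le> log_defect \<epsilon> L B + arctan_defect (A / \<epsilon>) + 2 * sqrt (2 * pi / A)" by simp
  have nd: "norm (?V \<omega> - truncated_sum ?z B \<omega>) = norm (linear_statistic g B \<omega>)" for \<omega>
    using diff[of \<omega>] by (metis norm_minus_commute)
  have Vm: "?V \<in> borel_measurable M"
    by (rule linear_statistic_deviation_complex(1)[OF B(1) _ fb f0']) measurable
  have ImV: "Im (?V \<omega>) \<ge> 0" for \<omega> unfolding linear_statistic_def by (simp add: sum_nonneg Imf)
  have "norm ((\<integral>\<omega>. exp (\<i> * (of_real t * ?V \<omega>)) \<partial>M) - (\<integral>\<omega>. exp (\<i> * (of_real t * truncated_sum ?z B \<omega>)) \<partial>M)) \<le> t * (\<integral>\<omega>. norm (?V \<omega> - truncated_sum ?z B \<omega>) \<partial>M)"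
    by (rule expectation_exp_diff_le[OF Vm measurable_truncated_sum[OF B(1) z(1)] ImV Im_truncated_sum[OF z(1)] t]) (use int in \<open>simp add: nd\<close>)
  also have "\<dots> \<le> t * (log_defect \<epsilon> L B + arctan_defect (A / \<epsilon>) + 2 * sqrt (2 * pi / A))"
    unfolding nd using E t by (rule mult_left_mono)
  finally show ?thesis unfolding shift .
qed

end

section \<open>Comparison of the averages over two horizontal lines\<close>

lemma average_bound:
  fixes f :: "real \<Rightarrow> complex"
  assumes L: "0 \<le> L" and f: "set_integrable lborel {0..L} f" and bnd: "\<And>a. 0 \<le> a \<Longrightarrow> a \<le> L \<Longrightarrow> norm (f a - c) \<le> d"
  shows "norm ((LINT a:{0..L}|lborel. f a) - of_real L * c) \<le> L * d"
proof -
  have fin: "emeasure lborel {0..L} < \<infinity>" using L by simp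
  have c: "set_integrable lborel {0..L} (\<lambda>a. c)" "set_integrable lborel {0..L} (\<lambda>a. d)"
    unfolding set_integrable_def using fin by (auto intro!: integrable_real_mult_indicator)
  have "(LINT a:{0..L}|lborel. f a) - of_real L * c = (LINT a:{0..L}|lborel. f a - c)"
    using L f c by (simp add: set_integral_const scaleR_conv_of_real)
  also have "norm \<dots> \<le> (LINT a:{0..L}|lborel. norm (f a - c))"
    using f c by (intro set_integral_norm_bound) auto
  also have "\<dots> \<le> (LINT a:{0..L}|lborel. d)"
    using f c bnd by (intro set_integral_mono set_integrable_norm) auto
  also have "\<dots> = L * d" using L by (simp add: set_integral_const)
  finally show ?thesis .
qed

context sine_process
begin

definition char_sum :: "real \<Rightarrow> real \<Rightarrow> complex \<Rightarrow> complex" where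
  "char_sum t B z = (\<integral>\<omega>. exp (\<i> * (of_real t * truncated_sum z B \<omega>)) \<partial>M)"

lemma holomorphic_truncated_sum: "(\<lambda>z. truncated_sum z B \<omega>) holomorphic_on {z. Im z > 0}"
  unfolding truncated_sum_def linear_statistic_def stieltjes_def
  by (auto intro!: holomorphic_intros)

lemma norm_exp_truncated_sum: "t \<ge> 0 \<Longrightarrow> Im z > 0 \<Longrightarrow> norm (exp (\<i> * (of_real t * truncated_sum z B \<omega>))) \<le> 1"
  using Im_truncated_sum[of z B \<omega>] by simp

text \<open>
  \<open>L\<close> is the length of the rectangle, \<open>\<eta>\<close> the height of its upper side, and \<open>B\<close> a window so large
  that its edges do not matter; later \<open>\<eta> = n\<close>, \<open>L = n\<^sup>2\<close>, \<open>B = n ^ 4\<close>.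
\<close>

lemma char_sum_bound:
  assumes e: "0 < \<epsilon>" "\<epsilon> \<le> \<eta>" and L: "0 < L" and A: "0 < A" "A + L \<le> B" and t: "0 \<le> t"
  shows "norm (char_sum t A (\<i> * of_real \<epsilon>) - exp (- of_real t))
    \<le> t * (log_defect \<epsilon> L B + arctan_defect (A / \<epsilon>) + 2 * sqrt (2 * pi / A)) + 2 * \<eta> / L
      + t * (log_defect \<eta> L B + arctan_defect ((B - L) / \<eta>) + 2 * sqrt (pi / \<eta>))"
    (is "norm (?c - ?e) \<le> ?d1 + _ + ?d2")
proof -
  have B: "0 < B" "L < B" and eta: "0 < \<eta>" using A L e by auto
  define f where "f y a \<omega> = exp (\<i> * (of_real t * truncated_sum (of_real a + \<i> * of_real y) B \<omega>))" for y a \<omega>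
  define J where "J y \<omega> = (LINT a:{0..L}|lborel. f y a \<omega>)" for y \<omega>
  define I where "I y = (LINT a:{0..L}|lborel. char_sum t B (of_real a + \<i> * of_real y))" for y
  have fm: "f y a \<in> borel_measurable M" if "y > 0" for y a
  proof -
    have [measurable]: "truncated_sum (of_real a + \<i> * of_real y) B \<in> borel_measurable M"
      by (rule measurable_truncated_sum[OF B(1)]) (use that in simp)
    show ?thesis unfolding f_def by measurable
  qed
  have fc: "continuous_on UNIV (\<lambda>a. f y a \<omega>)" if "y > 0" for y \<omega>
  proof -
    have "continuous_on UNIV (\<lambda>a. truncated_sum (of_real a + \<i> * of_real y) B \<omega>)"
      by (rule continuous_on_compose2[OF holomorphic_on_imp_continuous_on[OF holomorphic_truncated_sum]])
        (use that in \<open>auto intro!: continuous_intros\<close>)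
    then show ?thesis unfolding f_def by (intro continuous_intros)
  qed
  have fb: "norm (f y a \<omega>) \<le> 1" if "y > 0" for y a \<omega>
    unfolding f_def by (rule norm_exp_truncated_sum[OF t]) (use that in simp)
  have fch: "(\<integral>\<omega>. f y a \<omega> \<partial>M) = char_sum t B (of_real a + \<i> * of_real y)" for y a
    by (simp add: f_def char_sum_def)
  have IJ: "(\<integral>\<omega>. J y \<omega> \<partial>M) = I y" and Jm: "J y \<in> borel_measurable M"
    and ci: "set_integrable lborel {0..L} (\<lambda>a. char_sum t B (of_real a + \<i> * of_real y))" if y: "y > 0" for y
    using Fubini_bounded_Caratheodory[OF prob_space_axioms, where f = "f y" and B = 1 and L = L, OF fm[OF y] fc[OF y] fb[OF y]]
    by (simp_all add: J_def[abs_def] I_def fch)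
  have Jb: "norm (J y \<omega>) \<le> L" if y: "y > 0" for y \<omega>
  proof -
    have "set_integrable lborel {0..L} (\<lambda>a. f y a \<omega>)"
      by (rule borel_integrable_atLeastAtMost') (rule continuous_on_subset[OF fc[OF y]], simp)
    from average_bound[OF less_imp_le[OF L] this, of 0 1] fb[OF y] show ?thesis by (simp add: J_def)
  qed
  have Ji: "integrable M (J y)" if y: "y > 0" for y
    by (rule integrable_const_bound[where B = L]) (use Jb[OF y] Jm[OF y] in auto)
  \<comment> \<open>Cauchy's theorem is applied to every configuration separately, and its bound is
    integrated afterwards.\<close>
  have "norm (I \<epsilon> - I \<eta>) = norm (\<integral>\<omega>. J \<epsilon> \<omega> - J \<eta> \<omega> \<partial>M)"
    using Ji[OF e(1)] Ji[OF eta] by (simp add: IJ e eta)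
  also have "\<dots> \<le> (\<integral>\<omega>. norm (J \<epsilon> \<omega> - J \<eta> \<omega>) \<partial>M)" by (rule integral_norm_bound)
  also have "\<dots> \<le> (\<integral>\<omega>. 2 * \<eta> \<partial>M)"
  proof (rule Bochner_Integration.integral_mono)
    show "integrable M (\<lambda>\<omega>. norm (J \<epsilon> \<omega> - J \<eta> \<omega>))"
      by (rule integrable_norm[OF Bochner_Integration.integrable_diff[OF Ji[OF e(1)] Ji[OF eta]]])
    show "norm (J \<epsilon> \<omega> - J \<eta> \<omega>) \<le> 2 * \<eta>" for \<omega>
      unfolding J_def f_def
    proof (rule rectangle_bound[OF _ _ e L, of "\<lambda>z. exp (\<i> * (of_real t * truncated_sum z B \<omega>))"])
      show "(\<lambda>z. exp (\<i> * (of_real t * truncated_sum z B \<omega>))) holomorphic_on {z. Im z > 0}"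
        by (intro holomorphic_intros holomorphic_truncated_sum)
    qed (rule norm_exp_truncated_sum[OF t])
  qed simp
  finally have 1: "norm (I \<epsilon> - I \<eta>) \<le> 2 * \<eta>" by (simp add: prob_space)
  have 2: "norm (I \<epsilon> - of_real L * ?c) \<le> L * ?d1"
    unfolding I_def
  proof (rule average_bound[OF less_imp_le[OF L] ci[OF e(1)]])
    show "norm (char_sum t B (of_real a + \<i> * of_real \<epsilon>) - ?c) \<le> ?d1" if "0 \<le> a" "a \<le> L" for a
      using truncated_sum_recenter[OF e(1) A(1) that A(2) t] by (simp add: char_sum_def norm_minus_commute)
  qed
  have 3: "norm (I \<eta> - of_real L * ?e) \<le> L * ?d2"
    unfolding I_def
  proof (rule average_bound[OF less_imp_le[OF L] ci[OF eta]])
    show "norm (char_sum t B (of_real a + \<i> * of_real \<eta>) - ?e) \<le> ?d2" if "0 \<le> a" "a \<le> L" for a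
      using truncated_sum_near_i[OF eta that B(2) t] by (simp add: char_sum_def)
  qed
  have "L * norm (?c - ?e) = norm (of_real L * ?c - of_real L * ?e)"
    using L by (simp add: norm_mult flip: right_diff_distrib)
  \<comment> \<open>Three errors: the vertical sides, the recentring at height
    \<open>\<epsilon>\<close> and the concentration at height \<open>\<eta>\<close>. The last two
    scale with \<open>L\<close>, the first does not, so division by \<open>L\<close> makes it
    negligible.\<close>
  also have "of_real L * ?c - of_real L * ?e = (I \<epsilon> - I \<eta>) - (I \<epsilon> - of_real L * ?c) + (I \<eta> - of_real L * ?e)" by simp
  also have "norm \<dots> \<le> norm (I \<epsilon> - I \<eta>) + norm (I \<epsilon> - of_real L * ?c) + norm (I \<eta> - of_real L * ?e)"
    by (meson add_mono norm_triangle_ineq4 norm_triangle_ineq order_refl order_trans)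
  also have "\<dots> \<le> 2 * \<eta> + L * ?d1 + L * ?d2" using 1 2 3 by linarith
  also have "\<dots> = L * (?d1 + 2 * \<eta> / L + ?d2)" using L by (simp add: distrib_left)
  finally show ?thesis using L by (simp only: mult_le_cancel_left_pos)
qed

text \<open>Limit in \<open>n\<close> with \<open>A\<close> and \<open>\<epsilon>\<close> fixed. The
  height \<open>n\<close> kills the fluctuations, the ratio of \<open>n\<close> to
  \<open>n^2\<close> the vertical sides, and the window \<open>n ^ 4\<close>, wide compared with
  both, the defects at its edges. What remains comes from the small window.\<close>

lemma char_sum_imaginary_axis_bound:
  assumes e: "0 < \<epsilon>" and A: "0 < A" and t: "0 \<le> t"
  shows "norm (char_sum t A (\<i> * of_real \<epsilon>) - exp (- of_real t)) \<le> t * (arctan_defect (A / \<epsilon>) + 2 * sqrt (2 * pi / A))"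
proof (rule tendsto_lowerbound)
  let ?b = "\<lambda>n::nat. t * (log_defect \<epsilon> ((real n)\<^sup>2) (real n ^ 4) + arctan_defect (A / \<epsilon>) + 2 * sqrt (2 * pi / A)) + 2 * real n / (real n)\<^sup>2
      + t * (log_defect (real n) ((real n)\<^sup>2) (real n ^ 4) + arctan_defect ((real n ^ 4 - (real n)\<^sup>2) / real n) + 2 * sqrt (pi / real n))"
  have l1: "(\<lambda>n::nat. log_defect \<epsilon> ((real n)\<^sup>2) (real n ^ 4)) \<longlonglongrightarrow> 0"
    unfolding log_defect_def using e by real_asymp
  have l2: "(\<lambda>n::nat. 2 * real n / (real n)\<^sup>2) \<longlonglongrightarrow> 0" by real_asymp
  have l3: "(\<lambda>n::nat. log_defect (real n) ((real n)\<^sup>2) (real n ^ 4)) \<longlonglongrightarrow> 0"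
    unfolding log_defect_def by real_asymp
  have l4: "(\<lambda>n::nat. arctan_defect ((real n ^ 4 - (real n)\<^sup>2) / real n)) \<longlonglongrightarrow> 0"
    unfolding arctan_defect_def by real_asymp
  have l5: "(\<lambda>n::nat. 2 * sqrt (pi / real n)) \<longlonglongrightarrow> 0"
    by real_asymp
  have "?b \<longlonglongrightarrow> t * (0 + arctan_defect (A / \<epsilon>) + 2 * sqrt (2 * pi / A)) + 0 + t * (0 + 0 + 0)"
    by (intro tendsto_intros l1 l2 l3 l4 l5)
  then show "?b \<longlonglongrightarrow> t * (arctan_defect (A / \<epsilon>) + 2 * sqrt (2 * pi / A))" by simp
  have "\<forall>\<^sub>F n::nat in sequentially. \<epsilon> \<le> real n" by real_asymp
  moreover have "\<forall>\<^sub>F n::nat in sequentially. A + (real n)\<^sup>2 \<le> real n ^ 4" by real_asymp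
  moreover have "\<forall>\<^sub>F n::nat in sequentially. 0 < n" by (rule eventually_gt_at_top)
  ultimately show "\<forall>\<^sub>F n in sequentially. norm (char_sum t A (\<i> * of_real \<epsilon>) - exp (- of_real t)) \<le> ?b n"
  proof eventually_elim
    case (elim n)
    show ?case by (rule char_sum_bound[OF e elim(1) _ A elim(2) t]) (use elim in simp)
  qed
qed simp

section \<open>Descent to the real axis\<close>

definition reciprocal_sum :: "real \<Rightarrow> 'a \<Rightarrow> real" where
  "reciprocal_sum A \<omega> = (\<Sum>u\<in>D \<omega> \<inter> {-A..A}. 1 / u)"

lemma truncated_sum_tendsto_reciprocal_sum:
  assumes w: "\<omega> \<in> space M"
  shows "(\<lambda>n. truncated_sum (\<i> * of_real (1 / real (Suc n))) A \<omega>) \<longlonglongrightarrow> of_real (reciprocal_sum A \<omega>)"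
proof -
  have e: "(\<lambda>n. complex_of_real (1 / real (Suc n))) \<longlonglongrightarrow> 0"
    using tendsto_of_real[OF LIMSEQ_inverse_real_of_nat, where 'a = complex] by (simp only: inverse_eq_divide of_real_0)
  have "(\<lambda>n. 1 / (of_real u - \<i> * of_real (1 / real (Suc n)))) \<longlonglongrightarrow> 1 / (of_real u - \<i> * 0 :: complex)" if "u \<in> D \<omega> \<inter> {-A..A}" for u
    using that zero_notin[OF w] by (intro tendsto_intros e) auto
  from tendsto_sum[of "D \<omega> \<inter> {-A..A}", OF this]
  show ?thesis unfolding truncated_sum_def linear_statistic_def stieltjes_def reciprocal_sum_def by simp
qed

lemma measurable_reciprocal_sum [measurable]:
  assumes "0 < A"
  shows "reciprocal_sum A \<in> borel_measurable M"
proof -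
  have "(\<lambda>\<omega>. complex_of_real (reciprocal_sum A \<omega>)) \<in> borel_measurable M"
    by (rule borel_measurable_LIMSEQ_metric[OF _ truncated_sum_tendsto_reciprocal_sum])
      (rule measurable_truncated_sum[OF assms], auto)
  then have "(\<lambda>\<omega>. Re (complex_of_real (reciprocal_sum A \<omega>))) \<in> borel_measurable M" by measurable
  then show ?thesis by simp
qed

text \<open>Heights \<open>1 / Suc n\<close> tend to \<open>0\<close> with \<open>A\<close> fixed.
  The angle deficit of the small window then disappears, and the surviving error, due to the points
  outside the window, vanishes as \<open>A\<close> grows.\<close>

lemma char_reciprocal_sum_bound:
  assumes A: "0 < A" and t: "0 \<le> t"
  shows "norm ((\<integral>\<omega>. exp (\<i> * of_real (t * reciprocal_sum A \<omega>)) \<partial>M) - exp (- of_real t)) \<le> t * (2 * sqrt (2 * pi / A))"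
proof (rule tendsto_le[OF sequentially_bot])
  let ?z = "\<lambda>n. \<i> * complex_of_real (1 / real (Suc n))"
  have m: "truncated_sum (?z n) A \<in> borel_measurable M" for n
    by (rule measurable_truncated_sum[OF A]) simp
  have "(\<lambda>n. char_sum t A (?z n)) \<longlonglongrightarrow> (\<integral>\<omega>. exp (\<i> * (of_real t * of_real (reciprocal_sum A \<omega>))) \<partial>M)"
    unfolding char_sum_def
  proof (rule integral_dominated_convergence[where w = "\<lambda>_. 1"])
    show "(\<lambda>\<omega>. exp (\<i> * (of_real t * of_real (reciprocal_sum A \<omega>)))) \<in> borel_measurable M"
      using measurable_reciprocal_sum[OF A] by measurable
    show "(\<lambda>\<omega>. exp (\<i> * (of_real t * truncated_sum (?z n) A \<omega>))) \<in> borel_measurable M" for n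
      using m[of n] by measurable
    show "AE \<omega> in M. (\<lambda>n. exp (\<i> * (of_real t * truncated_sum (?z n) A \<omega>))) \<longlonglongrightarrow> exp (\<i> * (of_real t * of_real (reciprocal_sum A \<omega>)))"
      by (rule AE_I2) (intro tendsto_intros truncated_sum_tendsto_reciprocal_sum)
    show "AE \<omega> in M. norm (exp (\<i> * (of_real t * truncated_sum (?z n) A \<omega>))) \<le> 1" for n
      by (rule AE_I2) (rule norm_exp_truncated_sum[OF t], simp)
  qed simp
  then have "(\<lambda>n. norm (char_sum t A (?z n) - exp (- of_real t))) \<longlonglongrightarrow> norm ((\<integral>\<omega>. exp (\<i> * (of_real t * of_real (reciprocal_sum A \<omega>))) \<partial>M) - exp (- of_real t))"
    by (intro tendsto_intros)
  then show "(\<lambda>n. norm (char_sum t A (?z n) - exp (- of_real t))) \<longlonglongrightarrow> norm ((\<integral>\<omega>. exp (\<i> * of_real (t * reciprocal_sum A \<omega>)) \<partial>M) - exp (- of_real t))"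
    by simp
  have "(\<lambda>n. arctan_defect (A / (1 / real (Suc n)))) \<longlonglongrightarrow> 0"
    unfolding arctan_defect_def using A by real_asymp
  then have "(\<lambda>n. t * (arctan_defect (A / (1 / real (Suc n))) + 2 * sqrt (2 * pi / A))) \<longlonglongrightarrow> t * (0 + 2 * sqrt (2 * pi / A))"
    by (intro tendsto_intros)
  then show "(\<lambda>n. t * (arctan_defect (A / (1 / real (Suc n))) + 2 * sqrt (2 * pi / A))) \<longlonglongrightarrow> t * (2 * sqrt (2 * pi / A))" by simp
  show "\<forall>\<^sub>F n in sequentially. norm (char_sum t A (?z n) - exp (- of_real t)) \<le> t * (arctan_defect (A / (1 / real (Suc n))) + 2 * sqrt (2 * pi / A))"
    by (intro always_eventually allI char_sum_imaginary_axis_bound[OF _ A t]) simp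
qed

end

subsection \<open>The principal value\<close>

lemma lborel_integral_odd:
  fixes f :: "real \<Rightarrow> real"
  assumes "\<And>u. f (- u) = - f u"
  shows "(\<integral>u. f u \<partial>lborel) = 0"
  using lborel_integral_real_affine[of "-1" f 0] assms by simp

lemma integral_window_square_le:
  fixes f :: "real \<Rightarrow> real"
  assumes [measurable]: "f \<in> borel_measurable borel" and ab: "0 < a" "a \<le> b"
    and f: "\<And>u. \<bar>f u\<bar> \<le> (if a \<le> \<bar>u\<bar> \<and> \<bar>u\<bar> \<le> b then 1 / a else 0)"
  shows "(\<integral>u. (f u)\<^sup>2 \<partial>lborel) \<le> 2 * (b - a) / a\<^sup>2"
proof -
  let ?g = "\<lambda>u. 1 / a\<^sup>2 * indicator {-b..-a} u + 1 / a\<^sup>2 * indicator {a..b} u :: real"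
  have ind: "integrable lborel (\<lambda>u. 1 / a\<^sup>2 * indicator {-b..-a} u :: real)" "integrable lborel (\<lambda>u. 1 / a\<^sup>2 * indicator {a..b} u :: real)"
    using ab by (auto intro!: integrable_mult_right integrable_real_indicator)
  have "(\<integral>u. (f u)\<^sup>2 \<partial>lborel) \<le> (\<integral>u. ?g u \<partial>lborel)"
  proof (rule integral_mono')
    show "integrable lborel ?g" by (rule Bochner_Integration.integrable_add[OF ind])
    show "(f u)\<^sup>2 \<le> ?g u" for u
    proof (cases "a \<le> \<bar>u\<bar> \<and> \<bar>u\<bar> \<le> b")
      case True
      then have "\<bar>f u\<bar> \<le> 1 / a" using f[of u] by simp
      then have "\<bar>f u\<bar>\<^sup>2 \<le> (1 / a)\<^sup>2" by (rule power_mono) simp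
      then have "(f u)\<^sup>2 \<le> 1 / a\<^sup>2" by (simp add: power_divide)
      moreover have "u \<in> {-b..-a} \<or> u \<in> {a..b}" using True by auto
      moreover have "0 \<le> 1 / a\<^sup>2" by simp
      ultimately show ?thesis using ab by (auto simp: indicator_def)
    next
      case False
      then have "\<bar>f u\<bar> \<le> 0" using f[of u] by (simp split: if_splits)
      then show ?thesis using ab by simp
    qed
    show "0 \<le> ?g u" for u by simp
  qed
  also have "\<dots> = (\<integral>u. 1 / a\<^sup>2 * indicator {-b..-a} u \<partial>lborel) + (\<integral>u. 1 / a\<^sup>2 * indicator {a..b} u \<partial>lborel)"
    by (rule Bochner_Integration.integral_add[OF ind])
  also have "\<dots> = 2 * (b - a) / a\<^sup>2"
    using ab by (simp add: measure_def)
  finally show ?thesis .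
qed

section \<open>Almost sure convergence along windows of radius m^2\<close>

context sine_process
begin

text \<open>The window is open because the cut-off \<open>\<bar>x\<bar> > 1 / m^2\<close> of the
  principal value is strict, and inversion turns it into \<open>\<bar>u\<bar> < m^2\<close>.\<close>

definition partial_sum :: "nat \<Rightarrow> 'a \<Rightarrow> real" where
  "partial_sum m \<omega> = (\<Sum>u\<in>D \<omega> \<inter> {- (real m)\<^sup>2<..<(real m)\<^sup>2}. 1 / u)"

lemma finite_open_window: "\<omega> \<in> space M \<Longrightarrow> finite (D \<omega> \<inter> {-B<..<B})"
  by (rule finite_subset[OF _ finite_window[of \<omega> B]]) auto

text \<open>An odd function has integral \<open>0\<close>, so the deviation bound estimates the
  statistic itself. The square of \<open>f\<close> is at most \<open>1 / a^2\<close> on two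
  intervals of length \<open>b - a\<close>.\<close>

lemma expectation_odd_statistic:
  assumes ab: "0 < a" "a \<le> b" and f [measurable]: "f \<in> borel_measurable borel"
    and f_bound: "\<And>u. \<bar>f u\<bar> \<le> (if a \<le> \<bar>u\<bar> \<and> \<bar>u\<bar> \<le> b then 1 / a else 0)"
    and odd: "\<And>u. f (- u) = - f u"
  shows "linear_statistic f b \<in> borel_measurable M" "integrable M (\<lambda>\<omega>. \<bar>linear_statistic f b \<omega>\<bar>)"
    "(\<integral>\<omega>. \<bar>linear_statistic f b \<omega>\<bar> \<partial>M) \<le> sqrt (2 * (b - a) / a\<^sup>2)"
proof -
  have b: "0 < b" using ab by simp
  have bnd: "\<bar>f u\<bar> \<le> 1 / a" for u
    using order_trans[OF f_bound[of u]] ab by simp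
  have supp: "f u = 0" if "u \<notin> {-b..b}" for u
    using f_bound[of u] that by (auto split: if_splits)
  note dev = linear_statistic_deviation[OF b f bnd supp]
  note fm = first_moment[OF b f bnd supp]
  show "linear_statistic f b \<in> borel_measurable M"
    using fm by (auto simp: has_bochner_integral_iff)
  have "(\<integral>u. f u \<partial>lborel) = 0" by (rule lborel_integral_odd) (rule odd)
  then show "integrable M (\<lambda>\<omega>. \<bar>linear_statistic f b \<omega>\<bar>)"
    "(\<integral>\<omega>. \<bar>linear_statistic f b \<omega>\<bar> \<partial>M) \<le> sqrt (2 * (b - a) / a\<^sup>2)"
    using dev order_trans[OF dev(2) real_sqrt_le_mono[OF integral_window_square_le[OF f ab f_bound]]] by simp_all
qed

text \<open>Half open, to match the difference of two consecutive open windows.\<close>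

definition annulus_reciprocal :: "nat \<Rightarrow> real \<Rightarrow> real" where
  "annulus_reciprocal m u = (if (real m)\<^sup>2 \<le> \<bar>u\<bar> \<and> \<bar>u\<bar> < (real (Suc m))\<^sup>2 then 1 / u else 0)"

definition boundary_reciprocal :: "nat \<Rightarrow> real \<Rightarrow> real" where
  "boundary_reciprocal m u = (if \<bar>u\<bar> = (real m)\<^sup>2 then 1 / u else 0)"

lemma partial_sum_Suc:
  assumes w: "\<omega> \<in> space M"
  shows "partial_sum (Suc m) \<omega> - partial_sum m \<omega> = linear_statistic (annulus_reciprocal m) ((real (Suc m))\<^sup>2) \<omega>"
proof -
  let ?b = "(real (Suc m))\<^sup>2" and ?a = "(real m)\<^sup>2"
  let ?S = "D \<omega> \<inter> {-?b<..<?b}" and ?T = "D \<omega> \<inter> {-?a<..<?a}"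
  have ab: "?a \<le> ?b" by (rule power_mono) auto
  have sub: "?T \<subseteq> ?S" using greaterThanLessThan_subseteq_greaterThanLessThan[of "- ?a" ?a "- ?b" ?b] ab by (intro Int_mono) (simp_all del: of_nat_Suc)
  have "partial_sum (Suc m) \<omega> - partial_sum m \<omega> = (\<Sum>u\<in>?S - ?T. 1 / u)"
    unfolding partial_sum_def using finite_open_window[OF w, of ?b] sub by (intro sum_diff[symmetric])
  also have "\<dots> = (\<Sum>u\<in>?S - ?T. annulus_reciprocal m u)"
    by (intro sum.cong refl) (auto simp: annulus_reciprocal_def)
  also have "\<dots> = (\<Sum>u\<in>D \<omega> \<inter> {-?b..?b}. annulus_reciprocal m u)"
    by (rule sum.mono_neutral_left) (use finite_window[OF w] in \<open>auto simp: annulus_reciprocal_def\<close>)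
  finally show ?thesis by (simp add: linear_statistic_def)
qed

lemma partial_sum_boundary:
  assumes w: "\<omega> \<in> space M"
  shows "reciprocal_sum ((real m)\<^sup>2) \<omega> - partial_sum m \<omega> = linear_statistic (boundary_reciprocal m) ((real m)\<^sup>2) \<omega>"
proof -
  let ?a = "(real m)\<^sup>2"
  let ?S = "D \<omega> \<inter> {-?a..?a}" and ?T = "D \<omega> \<inter> {-?a<..<?a}"
  have "reciprocal_sum ?a \<omega> - partial_sum m \<omega> = (\<Sum>u\<in>?S - ?T. 1 / u)"
    unfolding partial_sum_def reciprocal_sum_def using finite_window[OF w] by (intro sum_diff[symmetric]) auto
  also have "\<dots> = (\<Sum>u\<in>?S - ?T. boundary_reciprocal m u)"
    by (intro sum.cong refl) (auto simp: boundary_reciprocal_def)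
  also have "\<dots> = (\<Sum>u\<in>?S. boundary_reciprocal m u)"
    by (rule sum.mono_neutral_left) (use finite_window[OF w] in \<open>auto simp: boundary_reciprocal_def\<close>)
  finally show ?thesis by (simp add: linear_statistic_def)
qed

lemma annulus_statistic:
  assumes m: "0 < m"
  defines "S \<equiv> linear_statistic (annulus_reciprocal m) ((real (Suc m))\<^sup>2)"
  shows "S \<in> borel_measurable M" "integrable M (\<lambda>\<omega>. \<bar>S \<omega>\<bar>)"
    "(\<integral>\<omega>. \<bar>S \<omega>\<bar> \<partial>M) \<le> sqrt (2 * ((real (Suc m))\<^sup>2 - (real m)\<^sup>2) / ((real m)\<^sup>2)\<^sup>2)"
proof -
  have ab: "0 < (real m)\<^sup>2" "(real m)\<^sup>2 \<le> (real (Suc m))\<^sup>2" using m by (auto intro!: power_mono)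
  have bnd: "\<bar>annulus_reciprocal m u\<bar> \<le> (if (real m)\<^sup>2 \<le> \<bar>u\<bar> \<and> \<bar>u\<bar> \<le> (real (Suc m))\<^sup>2 then 1 / (real m)\<^sup>2 else 0)" for u
  proof (cases "(real m)\<^sup>2 \<le> \<bar>u\<bar>")
    case True
    then have "1 / \<bar>u\<bar> \<le> 1 / (real m)\<^sup>2" using ab(1) by (intro divide_left_mono mult_pos_pos) auto
    then show ?thesis using True by (simp add: annulus_reciprocal_def del: of_nat_Suc)
  qed (simp add: annulus_reciprocal_def del: of_nat_Suc)
  have meas: "annulus_reciprocal m \<in> borel_measurable borel" unfolding annulus_reciprocal_def[abs_def] by measurable
  have odd: "annulus_reciprocal m (- u) = - annulus_reciprocal m u" for u
    by (simp add: annulus_reciprocal_def del: of_nat_Suc)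
  show "S \<in> borel_measurable M" "integrable M (\<lambda>\<omega>. \<bar>S \<omega>\<bar>)"
    "(\<integral>\<omega>. \<bar>S \<omega>\<bar> \<partial>M) \<le> sqrt (2 * ((real (Suc m))\<^sup>2 - (real m)\<^sup>2) / ((real m)\<^sup>2)\<^sup>2)"
    unfolding S_def by (rule expectation_odd_statistic[OF ab meas bnd odd])+
qed

text \<open>The case \<open>a = b\<close> of the estimate for odd functions: the bound is
  \<open>0\<close>, so almost surely the endpoints that separate the closed window from the open one
  contribute nothing.\<close>

lemma boundary_statistic:
  assumes m: "0 < m"
  defines "S \<equiv> linear_statistic (boundary_reciprocal m) ((real m)\<^sup>2)"
  shows "S \<in> borel_measurable M" "integrable M (\<lambda>\<omega>. \<bar>S \<omega>\<bar>)" "(\<integral>\<omega>. \<bar>S \<omega>\<bar> \<partial>M) \<le> 0"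
proof -
  have ab: "0 < (real m)\<^sup>2" "(real m)\<^sup>2 \<le> (real m)\<^sup>2" using m by auto
  have bnd: "\<bar>boundary_reciprocal m u\<bar> \<le> (if (real m)\<^sup>2 \<le> \<bar>u\<bar> \<and> \<bar>u\<bar> \<le> (real m)\<^sup>2 then 1 / (real m)\<^sup>2 else 0)" for u
    by (simp add: boundary_reciprocal_def)
  have meas: "boundary_reciprocal m \<in> borel_measurable borel" unfolding boundary_reciprocal_def[abs_def] by measurable
  have odd: "boundary_reciprocal m (- u) = - boundary_reciprocal m u" for u
    by (simp add: boundary_reciprocal_def)
  note dev = expectation_odd_statistic[OF ab meas bnd odd]
  show "S \<in> borel_measurable M" "integrable M (\<lambda>\<omega>. \<bar>S \<omega>\<bar>)" "(\<integral>\<omega>. \<bar>S \<omega>\<bar> \<partial>M) \<le> 0"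
    unfolding S_def using dev by simp_all
qed

lemma measurable_partial_sum:
  assumes m: "0 < m"
  shows "partial_sum m \<in> borel_measurable M"
proof -
  have [measurable]: "reciprocal_sum ((real m)\<^sup>2) \<in> borel_measurable M"
    by (rule measurable_reciprocal_sum) (use m in simp)
  note [measurable] = boundary_statistic(1)[OF m]
  have "(\<lambda>\<omega>. reciprocal_sum ((real m)\<^sup>2) \<omega> - linear_statistic (boundary_reciprocal m) ((real m)\<^sup>2) \<omega>) \<in> borel_measurable M"
    by measurable
  then show ?thesis
    by (rule measurable_cong[THEN iffD1, rotated]) (simp add: partial_sum_boundary[symmetric])
qed

lemma char_partial_sum_bound:
  assumes m: "0 < m" and t: "0 \<le> t"
  shows "norm ((\<integral>\<omega>. exp (\<i> * of_real (t * partial_sum m \<omega>)) \<partial>M) - exp (- of_real t)) \<le> t * (2 * sqrt (2 * pi / (real m)\<^sup>2))"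
proof -
  let ?X = "reciprocal_sum ((real m)\<^sup>2)" and ?Y = "partial_sum m"
  have m2: "0 < (real m)\<^sup>2" using m by simp
  have [measurable]: "?X \<in> borel_measurable M" "?Y \<in> borel_measurable M"
    using measurable_reciprocal_sum[OF m2] measurable_partial_sum[OF m] .
  have nd: "norm (complex_of_real (?X \<omega>) - of_real (?Y \<omega>)) = \<bar>linear_statistic (boundary_reciprocal m) ((real m)\<^sup>2) \<omega>\<bar>" if "\<omega> \<in> space M" for \<omega>
    using partial_sum_boundary[OF that, of m] by (simp flip: of_real_diff)
  have int: "integrable M (\<lambda>\<omega>. norm (complex_of_real (?X \<omega>) - of_real (?Y \<omega>)))"
    using boundary_statistic(2)[OF m] by (simp add: nd cong: Bochner_Integration.integrable_cong)
  have E: "(\<integral>\<omega>. norm (complex_of_real (?X \<omega>) - of_real (?Y \<omega>)) \<partial>M) \<le> 0"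
    using boundary_statistic(3)[OF m] by (simp add: nd cong: Bochner_Integration.integral_cong)
  have "norm ((\<integral>\<omega>. exp (\<i> * (of_real t * of_real (?X \<omega>))) \<partial>M) - (\<integral>\<omega>. exp (\<i> * (of_real t * of_real (?Y \<omega>))) \<partial>M)) \<le> t * (\<integral>\<omega>. norm (complex_of_real (?X \<omega>) - of_real (?Y \<omega>)) \<partial>M)"
    by (rule expectation_exp_diff_le[OF _ _ _ _ t int]) auto
  also have "\<dots> \<le> 0" using E t by (simp add: mult_nonneg_nonpos)
  finally have "(\<integral>\<omega>. exp (\<i> * of_real (t * ?X \<omega>)) \<partial>M) = (\<integral>\<omega>. exp (\<i> * of_real (t * ?Y \<omega>)) \<partial>M)" by simp
  then show ?thesis using char_reciprocal_sum_bound[OF m2 t] by simp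
qed

text \<open>Consecutive windows differ by an annulus of width of order \<open>m\<close> at distance
  \<open>m^2\<close> from the origin, so the increment has mean modulus of order
  \<open>m powr (- 3/2)\<close>, which is summable. Radii growing linearly would give a bound of
  order \<open>1 / m\<close> only.\<close>

lemma AE_convergent_partial_sum: "AE \<omega> in M. convergent (\<lambda>m. partial_sum m \<omega>)"
proof -
  \<comment> \<open>Indices start at \<open>1\<close>: the annulus for \<open>m = 0\<close> reaches
    the origin, where \<open>1 / u\<close> is unbounded.\<close>
  let ?d = "\<lambda>k \<omega>. \<bar>linear_statistic (annulus_reciprocal (Suc k)) ((real (Suc (Suc k)))\<^sup>2) \<omega>\<bar>"
  let ?b = "\<lambda>k. sqrt (2 * ((real (Suc (Suc k)))\<^sup>2 - (real (Suc k))\<^sup>2) / ((real (Suc k))\<^sup>2)\<^sup>2)"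
  have dm [measurable]: "linear_statistic (annulus_reciprocal (Suc k)) ((real (Suc (Suc k)))\<^sup>2) \<in> borel_measurable M" for k
    by (rule annulus_statistic(1)) simp
  have b0: "0 \<le> ?b k" for k
    by (intro real_sqrt_ge_zero divide_nonneg_nonneg mult_nonneg_nonneg) (auto intro!: power_mono)
  have sb: "summable ?b"
  proof (rule summable_comparison_test_bigo)
    show "summable (\<lambda>n. norm (real n powr (- 3/2)))" by (simp add: summable_real_powr_iff)
    show "?b \<in> O(\<lambda>n. real n powr (- 3/2))" by real_asymp
  qed
  have "(\<integral>\<^sup>+\<omega>. (\<Sum>k. ennreal (?d k \<omega>)) \<partial>M) = (\<Sum>k. \<integral>\<^sup>+\<omega>. ennreal (?d k \<omega>) \<partial>M)"
    by (rule nn_integral_suminf) measurable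
  also have "\<dots> \<le> (\<Sum>k. ennreal (?b k))"
  proof (rule suminf_le)
    show "(\<integral>\<^sup>+\<omega>. ennreal (?d k \<omega>) \<partial>M) \<le> ennreal (?b k)" for k
      using annulus_statistic(2,3)[of "Suc k"]
      by (subst nn_integral_eq_integral) (auto simp del: of_nat_Suc intro!: ennreal_leI)
  qed auto
  also have "\<dots> < \<infinity>"
    using sb b0 by (simp add: suminf_ennreal2 del: of_nat_Suc)
  finally have "(\<integral>\<^sup>+\<omega>. (\<Sum>k. ennreal (?d k \<omega>)) \<partial>M) \<noteq> \<infinity>" by simp
  then have "AE \<omega> in M. (\<Sum>k. ennreal (?d k \<omega>)) \<noteq> \<infinity>"
    by (intro nn_integral_PInf_AE) measurable
  then show ?thesis
  proof (rule AE_mp, intro AE_I2 impI)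
    fix \<omega> assume w: "\<omega> \<in> space M" and fin: "(\<Sum>k. ennreal (?d k \<omega>)) \<noteq> \<infinity>"
    have "summable (\<lambda>k. ?d k \<omega>)"
      by (rule summable_suminf_not_top) (use fin in auto)
    then have "summable (\<lambda>k. partial_sum (Suc (Suc k)) \<omega> - partial_sum (Suc k) \<omega>)"
      unfolding partial_sum_Suc[OF w] by (rule summable_rabs_cancel)
    then have "convergent (\<lambda>n. \<Sum>k<n. partial_sum (Suc (Suc k)) \<omega> - partial_sum (Suc k) \<omega>)"
      by (simp add: summable_iff_convergent)
    moreover have "(\<Sum>k<n. partial_sum (Suc (Suc k)) \<omega> - partial_sum (Suc k) \<omega>) = partial_sum (Suc n) \<omega> - partial_sum (Suc 0) \<omega>" for n
      by (rule sum_lessThan_telescope)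
    ultimately have "convergent (\<lambda>n. partial_sum (Suc n) \<omega> - partial_sum (Suc 0) \<omega>)" by simp
    then have "convergent (\<lambda>n. (partial_sum (Suc n) \<omega> - partial_sum (Suc 0) \<omega>) + partial_sum (Suc 0) \<omega>)"
      by (intro convergent_add convergent_const)
    then show "convergent (\<lambda>m. partial_sum m \<omega>)" using convergent_ignore_initial_segment[of "\<lambda>m. partial_sum m \<omega>" 1] by simp
  qed
qed

lemma distributed_principal_value:
  "distributed M lborel (\<lambda>\<omega>. lim (\<lambda>m. partial_sum m \<omega>)) (\<lambda>x. ennreal (cauchy_density x))"
proof (rule cauchy_distributedI[OF prob_space_axioms])
  let ?X = "\<lambda>\<omega>. lim (\<lambda>m. partial_sum m \<omega>)"
  \<comment> \<open>Measurability and the error bound are available for positive \<open>m\<close>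
    only; dropping the first term does not change the limit.\<close>
  have lim_Suc: "?X = (\<lambda>\<omega>. lim (\<lambda>m. partial_sum (Suc m) \<omega>))"
    unfolding lim_def by (simp only: filterlim_sequentially_Suc[where f = "\<lambda>m. partial_sum m \<omega>" for \<omega>])
  note [measurable] = measurable_partial_sum[OF zero_less_Suc]
  show Xm [measurable]: "?X \<in> borel_measurable M"
    unfolding lim_Suc by (rule borel_measurable_lim_metric) measurable
  fix t :: real assume t: "0 < t"
  have conv: "(\<lambda>m. \<integral>\<omega>. exp (\<i> * of_real (t * partial_sum (Suc m) \<omega>)) \<partial>M) \<longlonglongrightarrow> (\<integral>\<omega>. exp (\<i> * of_real (t * ?X \<omega>)) \<partial>M)"
  proof (rule integral_dominated_convergence[where w = "\<lambda>_. 1"])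
    show "AE \<omega> in M. (\<lambda>m. exp (\<i> * of_real (t * partial_sum (Suc m) \<omega>))) \<longlonglongrightarrow> exp (\<i> * of_real (t * ?X \<omega>))"
      using AE_convergent_partial_sum
    proof eventually_elim
      case (elim \<omega>)
      then have "(\<lambda>m. partial_sum (Suc m) \<omega>) \<longlonglongrightarrow> ?X \<omega>"
        unfolding convergent_LIMSEQ_iff by (rule LIMSEQ_Suc)
      then show ?case by (intro tendsto_intros)
    qed
  qed auto
  have "(\<lambda>m. (\<integral>\<omega>. exp (\<i> * of_real (t * partial_sum (Suc m) \<omega>)) \<partial>M) - exp (- of_real t)) \<longlonglongrightarrow> 0"
  proof (rule Lim_null_comparison)
    show "\<forall>\<^sub>F m in sequentially. norm ((\<integral>\<omega>. exp (\<i> * of_real (t * partial_sum (Suc m) \<omega>)) \<partial>M) - exp (- of_real t)) \<le> t * (2 * sqrt (2 * pi / (real (Suc m))\<^sup>2))"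
      using t by (intro always_eventually allI char_partial_sum_bound) auto
    show "(\<lambda>m. t * (2 * sqrt (2 * pi / (real (Suc m))\<^sup>2))) \<longlonglongrightarrow> 0" by real_asymp
  qed
  then have "(\<lambda>m. \<integral>\<omega>. exp (\<i> * of_real (t * partial_sum (Suc m) \<omega>)) \<partial>M) \<longlonglongrightarrow> exp (- of_real t)"
    by (rule LIM_zero_cancel)
  with conv show "(\<integral>\<omega>. exp (\<i> * of_real (t * ?X \<omega>)) \<partial>M) = of_real (exp (- t))"
    using LIMSEQ_unique by (simp add: exp_of_real[symmetric])
qed

end

text \<open>Infinitely many terms of modulus at least \<open>c\<close> prevent summability, and the
  infinite sum takes its default value \<open>0\<close>. This is the value of a sum over the empty
  configuration, which \<open>inverse_process\<close> uses on the exceptional event.\<close>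

lemma infsum_bounded_below_infinite:
  fixes S :: "real set"
  assumes inf: "infinite S" and c: "0 < c" and S: "\<And>x. x \<in> S \<Longrightarrow> c \<le> \<bar>x\<bar>"
  shows "(\<Sum>\<^sub>\<infinity>x\<in>S. x) = 0"
proof (rule infsum_not_exists)
  show "\<not> (\<lambda>x. x) summable_on S"
  proof
    assume "(\<lambda>x. x) summable_on S"
    then have s: "(\<lambda>x. \<bar>x\<bar>) summable_on S" using summable_on_iff_abs_summable_on_real[of "\<lambda>x. x" S] by simp
    obtain n :: nat where n: "(\<Sum>\<^sub>\<infinity>x\<in>S. \<bar>x\<bar>) / c < real n" using reals_Archimedean2 by blast
    obtain F where F: "F \<subseteq> S" "finite F" "card F = n" using infinite_arbitrarily_large[OF inf] by blast
    have "real n * c = (\<Sum>x\<in>F. c)" using F by simp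
    also have "\<dots> \<le> (\<Sum>x\<in>F. \<bar>x\<bar>)" by (rule sum_mono) (use F S in auto)
    also have "\<dots> \<le> (\<Sum>\<^sub>\<infinity>x\<in>S. \<bar>x\<bar>)" by (rule finite_sum_le_infsum[OF s]) (use F in auto)
    finally show False using n c by (simp add: pos_divide_less_eq)
  qed
qed

section \<open>Identification with the principal value of the original process\<close>

context
  fixes M :: "'a measure" and C :: "'a \<Rightarrow> real set"
  assumes C: "is_process_C 0 M C"
begin

interpretation sine_process M "inverse_process M C"
  by (rule sine_process_inverse[OF C])

text \<open>Holds at every \<open>\<omega>\<close> and not just almost surely, since on the
  exceptional event both sides are \<open>0\<close>. Hence \<open>pv_sum\<close> is measurable with
  respect to \<open>M\<close> itself, without completing the measure.\<close>

lemma infsum_process_eq_partial_sum: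
  assumes w: "\<omega> \<in> space M" and m: "0 < m"
  shows "(\<Sum>\<^sub>\<infinity>x\<in>{x \<in> C \<omega>. \<bar>x\<bar> > 1 / (real m)\<^sup>2}. x) = partial_sum m \<omega>"
proof -
  let ?S = "{x \<in> C \<omega>. \<bar>x\<bar> > 1 / (real m)\<^sup>2}"
  let ?W = "{- (real m)\<^sup>2<..<(real m)\<^sup>2}"
  have m2: "1 \<le> (real m)\<^sup>2" "0 < (real m)\<^sup>2" using m by auto
  show ?thesis
  proof (cases "\<omega> \<in> process_good M C")
    case True
    have nz: "x \<noteq> 0" if "x \<in> C \<omega>" for x using process_nonzero[OF C w] that by auto
    have abs: "1 / (real m)\<^sup>2 < \<bar>x\<bar> \<longleftrightarrow> 1 / x \<in> ?W" if "x \<noteq> 0" for x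
    proof -
      have "1 / (real m)\<^sup>2 < \<bar>x\<bar> \<longleftrightarrow> \<bar>1 / x\<bar> < (real m)\<^sup>2"
        using that m2(2) by (simp add: abs_divide divide_simps mult.commute)
      also have "\<dots> \<longleftrightarrow> 1 / x \<in> ?W" unfolding greaterThanLessThan_iff by linarith
      finally show ?thesis .
    qed
    have img: "(\<lambda>x. 1 / x) ` ?S = inverse_process M C \<omega> \<inter> ?W"
      using True nz abs by (simp add: inverse_process_def[OF C] del: greaterThanLessThan_iff) blast
    have fin: "finite ?S"
      using finite_open_window[OF w, of "(real m)\<^sup>2"] unfolding img[symmetric]
      by (rule finite_imageD) (rule inj_reciprocal[OF C])
    have "partial_sum m \<omega> = (\<Sum>u\<in>(\<lambda>x. 1 / x) ` ?S. 1 / u)" by (simp only: partial_sum_def img)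
    also have "\<dots> = (\<Sum>x\<in>?S. x)" by (subst sum.reindex[OF inj_reciprocal[OF C]]) simp
    finally show ?thesis using fin by simp
  next
    case False
    have "infinite ?S"
    proof
      assume fin: "finite ?S"
      \<comment> \<open>For \<open>m = 1\<close> the strict cut-off omits points at \<open>1\<close>
        and \<open>- 1\<close>, which the shells include; inserting both covers this case.\<close>
      let ?T = "insert 1 (insert (- 1) ?S)"
      have "1 / (real m)\<^sup>2 \<le> 1" using m2 by simp
      then have "C \<omega> \<inter> shell 1 (real (Suc k)) \<subseteq> ?T" for k
        by (auto simp: shell_def)
      then have "card (C \<omega> \<inter> shell 1 (real (Suc k))) \<le> card ?T" for k
        using fin by (intro card_mono) auto
      then show False using False w by (auto simp: process_good_def[OF C])
    qed
    then have "(\<Sum>\<^sub>\<infinity>x\<in>?S. x) = 0"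
      by (rule infsum_bounded_below_infinite[where c = "1 / (real m)\<^sup>2"]) (use m2 in auto)
    then show ?thesis using False by (simp add: partial_sum_def inverse_process_def[OF C])
  qed
qed

text \<open>The terms agree for \<open>m > 0\<close> only: at \<open>m = 0\<close> the cut-off
  \<open>1 / 0\<close> reads as \<open>0\<close> and admits all points of \<open>C\<close>, while
  the inverted window is empty. A limit does not see this term.\<close>

lemma pv_sum_eq_lim_partial_sum:
  assumes w: "\<omega> \<in> space M"
  shows "pv_sum C \<omega> = lim (\<lambda>m. partial_sum m \<omega>)"
proof -
  have "((\<lambda>m. \<Sum>\<^sub>\<infinity>x\<in>{x \<in> C \<omega>. \<bar>x\<bar> > 1 / (real m)\<^sup>2}. x) \<longlonglongrightarrow> L) \<longleftrightarrow> ((\<lambda>m. partial_sum m \<omega>) \<longlonglongrightarrow> L)" for L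
  proof (rule tendsto_cong)
    show "\<forall>\<^sub>F m in sequentially. (\<Sum>\<^sub>\<infinity>x\<in>{x \<in> C \<omega>. \<bar>x\<bar> > 1 / (real m)\<^sup>2}. x) = partial_sum m \<omega>"
      using eventually_gt_at_top[of 0] by eventually_elim (rule infsum_process_eq_partial_sum[OF w])
  qed
  then show ?thesis by (simp add: pv_sum_def lim_def)
qed

lemma distributed_pv_sum: "distributed M lborel (pv_sum C) (\<lambda>x. ennreal (1 / (pi * (1 + x\<^sup>2))))"
proof -
  have "distr M lborel (pv_sum C) = distr M lborel (\<lambda>\<omega>. lim (\<lambda>m. partial_sum m \<omega>))"
    by (intro distr_cong refl pv_sum_eq_lim_partial_sum)
  moreover have "pv_sum C \<in> measurable M lborel \<longleftrightarrow> (\<lambda>\<omega>. lim (\<lambda>m. partial_sum m \<omega>)) \<in> measurable M lborel"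
    by (intro measurable_cong pv_sum_eq_lim_partial_sum)
  ultimately show ?thesis
    using distributed_principal_value by (simp add: distributed_def cauchy_density_def)
qed

end

theorem theorem1p4:
  fixes M :: "'a measure" and C :: "'a \<Rightarrow> real set"
    and \<mu> :: "nat \<Rightarrow> complex mat measure"
  shows
    "(is_process_C 0 M C \<longrightarrow>
        distributed M lborel (pv_sum C) (\<lambda>x. ennreal (1 / (pi * (1 + x\<^sup>2))))) \<and>
     ((\<forall>N\<ge>1. unitary_haar N (\<mu> N)) \<longrightarrow>
        (\<forall>h. - 1/2 < Re h \<and> Re h < 1/2 \<longrightarrow>
          (\<forall>N\<ge>1.
             joint_moment (\<mu> N) 0 h / of_nat N powr (2 * h) = joint_moment_limit \<mu> 0 h \<and>
             joint_moment_limit \<mu> 0 h = 2 powr (- 2 * h) * (1 / cos (of_real pi * h)))))"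
  using distributed_pv_sum joint_moments_unitary by blast

end
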